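(* Let $G$ be a finite planar trivalent graph containing a bigon, and let $G'$ be the graph obtained from $G$ by collapsing the bigon. Then $\mathcal{M}(G)$ is a $\mathbb{CP}^1$-bundle over $\mathcal{M}(G')$. In particular, $$\chi(\mathcal{M}(G))=\chi(\mathbb{CP}^1)\cdot\chi(\mathcal{M}(G'))=2\,\chi(\mathcal{M}(G')).$$
   Context: Graphs are finite; multiple edges are allowed, and closed circle components without vertices are allowed (such a circle counts as a single edge with no vertices). Trivalent means that every vertex has exactly three incident edge-ends. A decoration of $G$ assigns to each edge $e\in E(G)$ a point $D(e)\in\mathbb{CP}^2$, i.e. a complex line through the origin in $\mathbb{C}^3$. It is admissible if at every vertex the three lines attached to the three incident edges are pairwise orthogonal in $\mathbb{C}^3$ with respect to the standard Hermitian inner product. $\mathcal{M}(G)$ is the set of admissible decorations with the subspace topology from $\prod_{e\in E(G)}\mathbb{CP}^2$; $\chi$ denotes the Euler characteristic. A bigon consists of two distinct vertices $u,v$ joined by two parallel edges $c,d$ that bound a face; let $a$ be the remaining edge at $u$ and $b$ the remaining edge at $v$. Collapsing the bigon means deleting $c,d$ and the vertices $u,v$ and joining the loose ends of $a$ and $b$, so that $a$ and $b$ become a single edge (a vertexless circle if $a$ and $b$ were the same edge). *)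

theory Defs
  imports "HOL-Analysis.Analysis" "HOL-Homology.Homology"
begin

section \<open>Multigraphs with circle components\<close>

text \<open>
  The multiset \<open>ends e\<close> contains a vertex once for each end of \<open>e\<close> attached to it: it is
  \<open>{#x, y#}\<close> for an edge from \<open>x\<close> to \<open>y\<close> (with \<open>x = y\<close> for a loop) and \<open>{#}\<close> for a closed
  circle without vertices.
\<close>

record ('v, 'e) mgraph =
  verts :: "'v set"
  edges :: "'e set"
  ends :: "'e \<Rightarrow> 'v multiset"

definition finite_mgraph :: "('v, 'e) mgraph \<Rightarrow> bool" where
  "finite_mgraph G \<longleftrightarrow>
     finite (verts G) \<and> finite (edges G) \<and>
     (\<forall>e \<in> edges G. set_mset (ends G e) \<subseteq> verts G \<and> (size (ends G e) = 2 \<or> ends G e = {#}))"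

text \<open>The index \<open>i\<close> separates the two ends of a loop.\<close>

definition edge_ends :: "('v, 'e) mgraph \<Rightarrow> 'v \<Rightarrow> ('e \<times> nat) set" where
  "edge_ends G x = {(e, i). e \<in> edges G \<and> i < count (ends G e) x}"

definition trivalent :: "('v, 'e) mgraph \<Rightarrow> bool" where
  "trivalent G \<longleftrightarrow> (\<forall>x \<in> verts G. card (edge_ends G x) = 3)"


section \<open>Plane drawings, faces and bigons\<close>

text \<open>
  An edge with two distinct ends is drawn as an arc, a loop as a simple closed curve based at its
  vertex, and a circle component as a simple closed curve missing all vertices. Distinct edges meet
  only in vertices.
\<close>

definition plane_drawing ::
    "('v, 'e) mgraph \<Rightarrow> ('v \<Rightarrow> complex) \<Rightarrow> ('e \<Rightarrow> real \<Rightarrow> complex) \<Rightarrow> bool" where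
  "plane_drawing G pt \<gamma> \<longleftrightarrow>
     inj_on pt (verts G) \<and>
     (\<forall>e \<in> edges G.
        simple_path (\<gamma> e) \<and>
        path_image (\<gamma> e) \<inter> pt ` verts G = pt ` set_mset (ends G e) \<and>
        (if ends G e = {#} then pathstart (\<gamma> e) = pathfinish (\<gamma> e)
         else {#pathstart (\<gamma> e), pathfinish (\<gamma> e)#} = image_mset pt (ends G e))) \<and>
     (\<forall>e \<in> edges G. \<forall>f \<in> edges G. e \<noteq> f \<longrightarrow>
        path_image (\<gamma> e) \<inter> path_image (\<gamma> f) \<subseteq> pt ` verts G)"

definition faces ::
    "('v, 'e) mgraph \<Rightarrow> ('v \<Rightarrow> complex) \<Rightarrow> ('e \<Rightarrow> real \<Rightarrow> complex) \<Rightarrow> complex set set" where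
  "faces G pt \<gamma> = components (- (pt ` verts G \<union> (\<Union>e \<in> edges G. path_image (\<gamma> e))))"

text \<open>
  The edges \<open>a\<close> and \<open>b\<close> may coincide. In a trivalent graph they are determined by
  \<open>u\<close>, \<open>v\<close>, \<open>c\<close>, \<open>d\<close>.
\<close>

definition bigon ::
    "('v, 'e) mgraph \<Rightarrow> ('v \<Rightarrow> complex) \<Rightarrow> ('e \<Rightarrow> real \<Rightarrow> complex)
      \<Rightarrow> 'v \<Rightarrow> 'v \<Rightarrow> 'e \<Rightarrow> 'e \<Rightarrow> 'e \<Rightarrow> 'e \<Rightarrow> bool" where
  "bigon G pt \<gamma> u v c d a b \<longleftrightarrow>
     u \<in> verts G \<and> v \<in> verts G \<and> u \<noteq> v \<and>
     c \<in> edges G \<and> d \<in> edges G \<and> c \<noteq> d \<and>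
     ends G c = {#u, v#} \<and> ends G d = {#u, v#} \<and>
     (\<exists>F \<in> faces G pt \<gamma>. frontier F = path_image (\<gamma> c) \<union> path_image (\<gamma> d)) \<and>
     a \<in> edges G - {c, d} \<and> u \<in># ends G a \<and>
     b \<in> edges G - {c, d} \<and> v \<in># ends G b"

text \<open>
  The edge obtained by joining \<open>a\<close> and \<open>b\<close> keeps the name \<open>a\<close>. If \<open>a = b\<close>, then
  \<open>ends G a = {#u, v#}\<close> and the result is a circle.
\<close>

definition collapse_bigon ::
    "('v, 'e) mgraph \<Rightarrow> 'v \<Rightarrow> 'v \<Rightarrow> 'e \<Rightarrow> 'e \<Rightarrow> 'e \<Rightarrow> 'e \<Rightarrow> ('v, 'e) mgraph" where
  "collapse_bigon G u v c d a b =
     \<lparr> verts = verts G - {u, v},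
       edges = insert a (edges G - {b, c, d}),
       ends = (ends G)
         (a := (if a = b then ends G a else ends G a + ends G b) - {#u, v#}) \<rparr>"


section \<open>Complex projective space\<close>

text \<open>
  Points are the complex lines through the origin of \<open>complex ^ 'n\<close>, so that \<open>'n\<close> with
  \<open>CARD('n) = n + 1\<close> gives the projective space of complex dimension \<open>n\<close>. The topology is the
  quotient topology from the nonzero vectors.
\<close>

definition complex_lines :: "(complex ^ 'n) set set" where
  "complex_lines = {vec.span {x} | x. x \<noteq> 0}"

definition proj_space :: "(complex ^ 'n) set topology" where
  "proj_space = topology (\<lambda>U. U \<subseteq> complex_lines \<and>
     openin (top_of_set (- {0})) {x. x \<noteq> 0 \<and> vec.span {x} \<in> U})"

lemma openin_proj_space:
  fixes U :: "(complex ^ 'n) set set"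
  shows "openin proj_space U \<longleftrightarrow> U \<subseteq> complex_lines \<and>
     openin (top_of_set (- {0})) {x. x \<noteq> 0 \<and> vec.span {x} \<in> U}"
proof -
  have "istopology (\<lambda>U :: (complex ^ 'n) set set. U \<subseteq> complex_lines \<and>
          openin (top_of_set (- {0})) {x. x \<noteq> 0 \<and> vec.span {x} \<in> U})"
    unfolding istopology_def
  proof (intro conjI allI impI)
    fix S T :: "(complex ^ 'n) set set"
    assume S: "S \<subseteq> complex_lines \<and>
        openin (top_of_set (- {0})) {x. x \<noteq> 0 \<and> vec.span {x} \<in> S}"
      and T: "T \<subseteq> complex_lines \<and>
        openin (top_of_set (- {0})) {x. x \<noteq> 0 \<and> vec.span {x} \<in> T}"
    show "S \<inter> T \<subseteq> complex_lines" using S by blast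
    have "{x. x \<noteq> 0 \<and> vec.span {x} \<in> S \<inter> T} =
        {x. x \<noteq> 0 \<and> vec.span {x} \<in> S} \<inter> {x. x \<noteq> 0 \<and> vec.span {x} \<in> T}" by blast
    then show "openin (top_of_set (- {0})) {x. x \<noteq> 0 \<and> vec.span {x} \<in> S \<inter> T}"
      using S T by (simp only: openin_Int)
  next
    fix \<K> :: "(complex ^ 'n) set set set"
    assume K: "\<forall>K \<in> \<K>. K \<subseteq> complex_lines \<and>
        openin (top_of_set (- {0})) {x. x \<noteq> 0 \<and> vec.span {x} \<in> K}"
    show "\<Union>\<K> \<subseteq> complex_lines" using K by blast
    have "{x. x \<noteq> 0 \<and> vec.span {x} \<in> \<Union>\<K>} =
        (\<Union>K \<in> \<K>. {x. x \<noteq> 0 \<and> vec.span {x} \<in> K})" by blast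
    moreover have "openin (top_of_set (- {0})) (\<Union>K \<in> \<K>. {x. x \<noteq> 0 \<and> vec.span {x} \<in> K})"
      using K by (intro openin_Union) blast
    ultimately show "openin (top_of_set (- {0})) {x. x \<noteq> 0 \<and> vec.span {x} \<in> \<Union>\<K>}"
      by simp
  qed
  then show ?thesis by (simp add: proj_space_def topology_inverse')
qed

lemma topspace_proj_space:
  "topspace proj_space = (complex_lines :: (complex ^ 'n) set set)"
proof
  show "topspace proj_space \<subseteq> (complex_lines :: (complex ^ 'n) set set)"
    using openin_proj_space[of "topspace proj_space"] openin_topspace by blast
  have "{x. x \<noteq> 0 \<and> vec.span {x} \<in> complex_lines} = (- {0} :: (complex ^ 'n) set)"
    by (auto simp: complex_lines_def)
  then have "openin proj_space (complex_lines :: (complex ^ 'n) set set)"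
    unfolding openin_proj_space by simp
  then show "(complex_lines :: (complex ^ 'n) set set) \<subseteq> topspace proj_space"
    by (rule openin_subset)
qed

lemma quotient_map_proj_space:
  "quotient_map (top_of_set (- {0 :: complex ^ 'n})) proj_space (\<lambda>x. vec.span {x})"
proof -
  have "{x. x \<in> - {0} \<and> vec.span {x} \<in> U} = {x. x \<noteq> 0 \<and> vec.span {x} \<in> U}"
    for U :: "(complex ^ 'n) set set"
    by auto
  then show ?thesis
    by (auto simp: quotient_map_def topspace_proj_space openin_proj_space complex_lines_def)
qed


section \<open>Admissible decorations\<close>

definition hermitian_inner :: "complex ^ 'n \<Rightarrow> complex ^ 'n \<Rightarrow> complex" where
  "hermitian_inner x y = (\<Sum>i \<in> UNIV. x $ i * cnj (y $ i))"

definition orthogonal_lines :: "(complex ^ 'n) set \<Rightarrow> (complex ^ 'n) set \<Rightarrow> bool" where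
  "orthogonal_lines L M \<longleftrightarrow> (\<forall>x \<in> L. \<forall>y \<in> M. hermitian_inner x y = 0)"

text \<open>
  The condition ranges over pairs of distinct edge-ends; in particular a graph with a loop has no
  admissible decoration.
\<close>

definition admissible :: "('v, 'e) mgraph \<Rightarrow> ('e \<Rightarrow> (complex ^ 3) set) \<Rightarrow> bool" where
  "admissible G D \<longleftrightarrow>
     (\<forall>x \<in> verts G.
        pairwise (\<lambda>h k. orthogonal_lines (D (fst h)) (D (fst k))) (edge_ends G x))"

definition moduli_space :: "('v, 'e) mgraph \<Rightarrow> ('e \<Rightarrow> (complex ^ 3) set) topology" where
  "moduli_space G =
     subtopology (product_topology (\<lambda>_. proj_space) (edges G)) {D. admissible G D}"


section \<open>Fibre bundles\<close>

definition fibre_bundle ::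
    "'f topology \<Rightarrow> 'a topology \<Rightarrow> 'b topology \<Rightarrow> ('a \<Rightarrow> 'b) \<Rightarrow> bool" where
  "fibre_bundle F E B p \<longleftrightarrow>
     continuous_map E B p \<and> p ` topspace E = topspace B \<and>
     (\<forall>x \<in> topspace B. \<exists>U h. openin B U \<and> x \<in> U \<and>
        homeomorphic_map (subtopology E {y \<in> topspace E. p y \<in> U})
          (prod_topology (subtopology B U) F) h \<and>
        (\<forall>y \<in> topspace E. p y \<in> U \<longrightarrow> fst (h y) = p y))"


section \<open>Euler characteristic\<close>

definition int_independent :: "('a, 'm) monoid_scheme \<Rightarrow> 'a set \<Rightarrow> bool" where
  "int_independent G A \<longleftrightarrow> finite A \<and> A \<subseteq> carrier G \<and>
     (\<forall>k :: 'a \<Rightarrow> int. finprod G (\<lambda>x. x [^]\<^bsub>G\<^esub> k x) A = \<one>\<^bsub>G\<^esub> \<longrightarrow> (\<forall>x \<in> A. k x = 0))"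

definition abelian_rank :: "('a, 'm) monoid_scheme \<Rightarrow> enat" where
  "abelian_rank G = (SUP A \<in> {A. int_independent G A}. enat (card A))"

definition betti :: "'a topology \<Rightarrow> nat \<Rightarrow> enat" where
  "betti X n = abelian_rank (homology_group (int n) X)"

text \<open>
  The alternating sum of the Betti numbers, which are those of integral singular homology. It is
  set to \<open>0\<close> when the total rank of the homology is infinite and the sum makes no sense.
\<close>

definition euler_characteristic :: "'a topology \<Rightarrow> int" where
  "euler_characteristic X =
     (if (\<forall>n. betti X n \<noteq> \<infinity>) \<and> finite {n. betti X n \<noteq> 0}
      then \<Sum>n | betti X n \<noteq> 0. (-1) ^ n * int (the_enat (betti X n))
      else 0)"

end

theory Submission
  imports Defs
begin

text \<open>
  At a vertex the line of one edge is determined by the lines of the other two, so a decoration of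
  \<open>G\<close> is a decoration \<open>D\<close> of \<open>G'\<close> together with a line \<open>L\<close> orthogonal to \<open>D a\<close>. Hence \<open>M(G)\<close> is
  the bundle \<open>E = {(D, L). L \<bottom> D a}\<close> inside \<open>M(G') \<times> CP\<^sup>2\<close>, which is trivial over each of the
  three sets where a given coordinate of \<open>D a\<close> does not vanish.

  For the Euler characteristic we show that the \<open>p\<close>-th Betti number of \<open>E\<close> is the sum of the
  \<open>p\<close>-th and the \<open>(p - 2)\<close>-nd Betti number of the base \<open>W\<close>; this needs no finiteness of the
  homology. Complex conjugation \<open>s\<close> and a retraction \<open>r\<close> of \<open>CP\<^sup>2\<close> to a real point act on the
  homology of \<open>W \<times> CP\<^sup>2\<close>, and \<open>2 r + 1 - s\<close> is, up to torsion, twice the projection to the part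
  coming from \<open>W \<times> CP\<^sup>1\<close>. Composed with the inclusion it maps the homology of \<open>E\<close> to that part,
  naturally in open subsets of \<open>W\<close>. Over the three trivialising sets this is an isomorphism modulo
  torsion, because there the inclusion of \<open>E\<close> is homotopic to that of \<open>W \<times> CP\<^sup>1\<close>; by excision and
  the five lemma it is one over all of \<open>W\<close>. The homology of \<open>W \<times> CP\<^sup>1\<close> itself is found by removing
  contractible pieces of \<open>CP\<^sup>1\<close> twice.
\<close>

section \<open>Abelian groups modulo torsion\<close>

text \<open>A Mayer-Vietoris count over the charts does not determine the Betti numbers: the
  connecting maps have to be compared, and that takes one map between the homology of
  \<open>E\<close> and a known group, defined over all of \<open>W\<close> at once. The bundle may
  be twisted, so there need be no fibrewise homeomorphism from \<open>E\<close> to W x CP^1; but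
  both lie in W x CP^2. The homology of that product has a third summand, H_{p-4}(W), which the
  inclusion of a twisted \<open>E\<close> can also hit. It has to be projected away by something
  that is natural in open subsets of \<open>W\<close> and commutes with boundary maps, and
  endomorphisms induced by self-maps of the fibre CP^2 have both properties. Conjugation separates
  the middle summand by its sign, the retraction to a point separates the first. As the eigenvalues
  1 and -1 agree modulo 2, the splitting exists only up to factors of 2 and 2-torsion. This is
  harmless for ranks, and it is the reason for working modulo torsion throughout.\<close>

lemma comm_group_cancel:
  assumes "comm_group G" "a \<in> carrier G" "b \<in> carrier G"
  shows "a \<otimes>\<^bsub>G\<^esub> inv\<^bsub>G\<^esub> (a \<otimes>\<^bsub>G\<^esub> inv\<^bsub>G\<^esub> b) = b"
proof -
  interpret comm_group G by fact
  show ?thesis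
    using assms by (simp add: inv_mult_group m_comm flip: m_assoc)
qed

text \<open>For \<open>\<epsilon>\<close> with \<open>\<epsilon>\<^sup>2 = 2 \<epsilon>\<close> and \<open>\<phi>\<close> with \<open>\<epsilon> \<phi> = 2 \<phi>\<close>, as in the five lemma below, this says that
  \<open>\<phi>\<close> is an isomorphism from \<open>G\<close> to the image of \<open>\<epsilon>\<close> modulo torsion.\<close>

definition mod_torsion_onto ::
    "('a, 'm) monoid_scheme \<Rightarrow> ('b, 'n) monoid_scheme \<Rightarrow> ('a \<Rightarrow> 'b) \<Rightarrow> ('b \<Rightarrow> 'b) \<Rightarrow> bool" where
  "mod_torsion_onto G C \<phi> \<epsilon> \<longleftrightarrow>
     (\<forall>x \<in> carrier G. \<phi> x = \<one>\<^bsub>C\<^esub> \<longrightarrow> (\<exists>k::nat>0. x [^]\<^bsub>G\<^esub> k = \<one>\<^bsub>G\<^esub>)) \<and>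
     (\<forall>y \<in> carrier C. \<exists>x \<in> carrier G. \<exists>k::nat>0. \<epsilon> y [^]\<^bsub>C\<^esub> k = \<phi> x)"

lemma mod_torsion_onto_kernel:
  assumes "mod_torsion_onto G C \<phi> \<epsilon>" "\<phi> x = \<one>\<^bsub>C\<^esub>" "x \<in> carrier G"
  obtains k :: nat where "k > 0" "x [^]\<^bsub>G\<^esub> k = \<one>\<^bsub>G\<^esub>"
  using assms unfolding mod_torsion_onto_def by blast

lemma mod_torsion_onto_multiple:
  assumes "mod_torsion_onto G C \<phi> \<epsilon>" "y \<in> carrier C"
  obtains x and k :: nat where "x \<in> carrier G" "k > 0" "\<epsilon> y [^]\<^bsub>C\<^esub> k = \<phi> x"
  using assms unfolding mod_torsion_onto_def by blast

text \<open>The usual diagram chase, with every vanishing and every preimage available only after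
  passing to a positive power. Since the outer maps reach only the images of \<open>e1\<close>,
  \<open>e2\<close>, \<open>e4\<close>, an element must be passed through the corresponding
  endomorphism before it lifts. The relations \<open>ep\<close> recover the original element up to a
  square.\<close>

lemma mod_torsion_onto_five:
  assumes cg: "comm_group G1" "comm_group G2" "comm_group G3" "comm_group G4" "comm_group G5"
      "comm_group C1" "comm_group C2" "comm_group C3" "comm_group C4" "comm_group C5"
    and f: "f1 \<in> hom G1 G2" "f2 \<in> hom G2 G3" "f3 \<in> hom G3 G4" "f4 \<in> hom G4 G5"
    and g: "g1 \<in> hom C1 C2" "g2 \<in> hom C2 C3" "g3 \<in> hom C3 C4" "g4 \<in> hom C4 C5"
    and exf: "kernel G2 G3 f2 = f1 ` carrier G1" "kernel G3 G4 f3 = f2 ` carrier G2"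
      "kernel G4 G5 f4 = f3 ` carrier G3"
    and exg: "kernel C2 C3 g2 = g1 ` carrier C1" "kernel C3 C4 g3 = g2 ` carrier C2"
      "kernel C4 C5 g4 = g3 ` carrier C3"
    and \<phi>: "p1 \<in> hom G1 C1" "p2 \<in> hom G2 C2" "p3 \<in> hom G3 C3" "p4 \<in> hom G4 C4" "p5 \<in> hom G5 C5"
    and \<epsilon>: "e1 \<in> hom C1 C1" "e2 \<in> hom C2 C2" "e3 \<in> hom C3 C3" "e4 \<in> hom C4 C4"
    and sq: "\<And>x. x \<in> carrier G1 \<Longrightarrow> g1 (p1 x) = p2 (f1 x)"
      "\<And>x. x \<in> carrier G2 \<Longrightarrow> g2 (p2 x) = p3 (f2 x)"
      "\<And>x. x \<in> carrier G3 \<Longrightarrow> g3 (p3 x) = p4 (f3 x)"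
      "\<And>x. x \<in> carrier G4 \<Longrightarrow> g4 (p4 x) = p5 (f4 x)"
    and sqe: "\<And>y. y \<in> carrier C1 \<Longrightarrow> g1 (e1 y) = e2 (g1 y)"
      "\<And>y. y \<in> carrier C2 \<Longrightarrow> g2 (e2 y) = e3 (g2 y)"
      "\<And>y. y \<in> carrier C3 \<Longrightarrow> g3 (e3 y) = e4 (g3 y)"
    and ep: "\<And>x. x \<in> carrier G2 \<Longrightarrow> e2 (p2 x) = p2 x [^]\<^bsub>C2\<^esub> (2::nat)"
      "\<And>x. x \<in> carrier G3 \<Longrightarrow> e3 (p3 x) = p3 x [^]\<^bsub>C3\<^esub> (2::nat)"
      "\<And>y. y \<in> carrier C3 \<Longrightarrow> e3 (e3 y) = e3 y [^]\<^bsub>C3\<^esub> (2::nat)"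
    and M: "mod_torsion_onto G1 C1 p1 e1" "mod_torsion_onto G2 C2 p2 e2"
      "mod_torsion_onto G4 C4 p4 e4" "mod_torsion_onto G5 C5 p5 e5"
  shows "mod_torsion_onto G3 C3 p3 e3"
proof -
  interpret G1: comm_group G1 by fact
  interpret G2: comm_group G2 by fact
  interpret G3: comm_group G3 by fact
  interpret G4: comm_group G4 by fact
  interpret G5: comm_group G5 by fact
  interpret C1: comm_group C1 by fact
  interpret C2: comm_group C2 by fact
  interpret C3: comm_group C3 by fact
  interpret C4: comm_group C4 by fact
  interpret C5: comm_group C5 by fact
  interpret f1: group_hom G1 G2 f1 using f by unfold_locales auto
  interpret f2: group_hom G2 G3 f2 using f by unfold_locales auto
  interpret f3: group_hom G3 G4 f3 using f by unfold_locales auto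
  interpret f4: group_hom G4 G5 f4 using f by unfold_locales auto
  interpret g1: group_hom C1 C2 g1 using g by unfold_locales auto
  interpret g2: group_hom C2 C3 g2 using g by unfold_locales auto
  interpret g3: group_hom C3 C4 g3 using g by unfold_locales auto
  interpret g4: group_hom C4 C5 g4 using g by unfold_locales auto
  interpret p1: group_hom G1 C1 p1 using \<phi> by unfold_locales auto
  interpret p2: group_hom G2 C2 p2 using \<phi> by unfold_locales auto
  interpret p3: group_hom G3 C3 p3 using \<phi> by unfold_locales auto
  interpret p4: group_hom G4 C4 p4 using \<phi> by unfold_locales auto
  interpret p5: group_hom G5 C5 p5 using \<phi> by unfold_locales auto
  interpret e1: group_hom C1 C1 e1 using \<epsilon> by unfold_locales auto
  interpret e2: group_hom C2 C2 e2 using \<epsilon> by unfold_locales auto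
  interpret e3: group_hom C3 C3 e3 using \<epsilon> by unfold_locales auto
  interpret e4: group_hom C4 C4 e4 using \<epsilon> by unfold_locales auto
  have "\<exists>k::nat>0. x [^]\<^bsub>G3\<^esub> k = \<one>\<^bsub>G3\<^esub>" if x: "x \<in> carrier G3" and px: "p3 x = \<one>\<^bsub>C3\<^esub>" for x
  proof -
    have "p4 (f3 x) = \<one>\<^bsub>C4\<^esub>" by (metis sq(3)[OF x] px g3.hom_one)
    from mod_torsion_onto_kernel[OF M(3) this f3.hom_closed[OF x]]
    obtain k :: nat where k: "k > 0" "f3 x [^]\<^bsub>G4\<^esub> k = \<one>\<^bsub>G4\<^esub>" .
    then have "x [^]\<^bsub>G3\<^esub> k \<in> kernel G3 G4 f3" using x by (simp add: kernel_def f3.hom_nat_pow)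
    then obtain x2 where x2: "x2 \<in> carrier G2" "x [^]\<^bsub>G3\<^esub> k = f2 x2" unfolding exf(2) by (rule imageE)
    have "g2 (p2 x2) = \<one>\<^bsub>C3\<^esub>"
      using sq(2)[OF x2(1)] px x by (simp flip: x2(2) add: p3.hom_nat_pow)
    then have "p2 x2 \<in> kernel C2 C3 g2" using x2 by (simp add: kernel_def)
    then obtain c1 where c1: "c1 \<in> carrier C1" "p2 x2 = g1 c1" unfolding exg(1) by (rule imageE)
    \<comment> \<open>\<open>c1\<close> itself may have no power that lifts to \<open>G1\<close>;
      only \<open>e1 c1\<close> does. In \<open>C2\<close> this replaces \<open>p2 x2\<close> by
      \<open>e2 (p2 x2)\<close>, its square, which is where the factor 2 in the exponents comes
      from.\<close>
    obtain x1 and m :: nat where x1: "x1 \<in> carrier G1" "m > 0" "e1 c1 [^]\<^bsub>C1\<^esub> m = p1 x1"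
      using mod_torsion_onto_multiple[OF M(1) c1(1)] .
    have "p2 (f1 x1) = g1 (e1 c1 [^]\<^bsub>C1\<^esub> m)" using sq(1) x1 by simp
    also have "\<dots> = e2 (p2 x2) [^]\<^bsub>C2\<^esub> m" using c1 sqe by (simp add: g1.hom_nat_pow)
    also have "\<dots> = p2 (x2 [^]\<^bsub>G2\<^esub> (2 * m))"
      using ep(1) x2 by (simp add: C2.nat_pow_pow p2.hom_nat_pow)
    finally have eq: "p2 (f1 x1) = p2 (x2 [^]\<^bsub>G2\<^esub> (2 * m))" .
    \<comment> \<open>Correcting by \<open>f1 x1\<close> removes the image under \<open>p2\<close>
      and does not affect the image under \<open>f2\<close>, which kills the range of
      \<open>f1\<close>. So \<open>z\<close> is torsion, and its image in \<open>G3\<close> is a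
      power of \<open>x\<close>.\<close>
    define z where "z = x2 [^]\<^bsub>G2\<^esub> (2 * m) \<otimes>\<^bsub>G2\<^esub> inv\<^bsub>G2\<^esub> (f1 x1)"
    have z: "z \<in> carrier G2" "p2 z = \<one>\<^bsub>C2\<^esub>" using x1 x2 eq by (auto simp: z_def p2.hom_mult p2.hom_inv)
    from mod_torsion_onto_kernel[OF M(2) z(2,1)]
    obtain N :: nat where N: "N > 0" "z [^]\<^bsub>G2\<^esub> N = \<one>\<^bsub>G2\<^esub>" .
    have "f1 x1 \<in> kernel G2 G3 f2" unfolding exf(1) using x1(1) by (rule imageI)
    then have "f2 z = (x [^]\<^bsub>G3\<^esub> k) [^]\<^bsub>G3\<^esub> (2 * m)"
      using x2 x1 by (simp add: z_def kernel_def f2.hom_nat_pow)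
    then have "f2 (z [^]\<^bsub>G2\<^esub> N) = x [^]\<^bsub>G3\<^esub> (k * (2 * m) * N)"
      using z x by (simp add: f2.hom_nat_pow G3.nat_pow_pow)
    then have "x [^]\<^bsub>G3\<^esub> (k * (2 * m) * N) = \<one>\<^bsub>G3\<^esub>" using N by simp
    then show ?thesis using k x1 N by (meson mult_pos_pos zero_less_numeral)
  qed
  moreover have "\<exists>x \<in> carrier G3. \<exists>k::nat>0. e3 y [^]\<^bsub>C3\<^esub> k = p3 x" if y: "y \<in> carrier C3" for y
  proof -
    obtain x4 and k :: nat where x4: "x4 \<in> carrier G4" "k > 0" "e4 (g3 y) [^]\<^bsub>C4\<^esub> k = p4 x4"
      using mod_torsion_onto_multiple[OF M(3) g3.hom_closed[OF y]] .
    have gg: "g4 (g3 w) = \<one>\<^bsub>C5\<^esub>" if "w \<in> carrier C3" for w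
      using imageI[OF that, of g3] unfolding exg(3)[symmetric] kernel_def by simp
    have "p5 (f4 x4) = g4 (g3 (e3 y) [^]\<^bsub>C4\<^esub> k)" using sq(4) x4 sqe(3) y by simp
    also have "\<dots> = \<one>\<^bsub>C5\<^esub>" using y gg by (simp add: g4.hom_nat_pow)
    finally have "p5 (f4 x4) = \<one>\<^bsub>C5\<^esub>" .
    from mod_torsion_onto_kernel[OF M(4) this f4.hom_closed[OF x4(1)]]
    obtain N :: nat where N: "N > 0" "f4 x4 [^]\<^bsub>G5\<^esub> N = \<one>\<^bsub>G5\<^esub>" .
    then have "x4 [^]\<^bsub>G4\<^esub> N \<in> kernel G4 G5 f4" using x4 by (simp add: kernel_def f4.hom_nat_pow)
    then obtain x3 where x3: "x3 \<in> carrier G3" "x4 [^]\<^bsub>G4\<^esub> N = f3 x3" unfolding exf(3) by (rule imageE)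
    \<comment> \<open>\<open>x3\<close> hits the target only up to the error \<open>w\<close>, which
      dies in \<open>C4\<close> and therefore comes from \<open>C2\<close>.\<close>
    define w where "w = p3 x3 \<otimes>\<^bsub>C3\<^esub> inv\<^bsub>C3\<^esub> (e3 y [^]\<^bsub>C3\<^esub> (k * N))"
    have w: "w \<in> carrier C3" using x3 y by (simp add: w_def)
    have "g3 (p3 x3) = g3 (e3 y [^]\<^bsub>C3\<^esub> (k * N))"
      using sq(3)[OF x3(1)] x4 y sqe(3)[OF y]
      by (simp flip: x3(2) C4.nat_pow_pow C3.nat_pow_pow add: p4.hom_nat_pow g3.hom_nat_pow)
    then have "w \<in> kernel C3 C4 g3" using w x3 y by (simp add: kernel_def w_def)
    then obtain c2 where c2: "c2 \<in> carrier C2" "w = g2 c2" unfolding exg(2) by (rule imageE)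
    obtain x2 and m :: nat where x2: "x2 \<in> carrier G2" "m > 0" "e2 c2 [^]\<^bsub>C2\<^esub> m = p2 x2"
      using mod_torsion_onto_multiple[OF M(2) c2(1)] .
    have "p3 (f2 x2) = g2 (e2 c2 [^]\<^bsub>C2\<^esub> m)" using sq(2) x2 by simp
    also have "\<dots> = e3 w [^]\<^bsub>C3\<^esub> m" using c2 sqe by (simp add: g2.hom_nat_pow)
    \<comment> \<open>Both factors of \<open>w\<close> are squared by \<open>e3\<close>: the first
      because it lies in the range of \<open>p3\<close>, the second because it lies in the range of
      \<open>e3\<close>. Solving for the second expresses a power of \<open>e3 y\<close> as a value
      of \<open>p3\<close>.\<close>
    also have "e3 w = p3 x3 [^]\<^bsub>C3\<^esub> (2::nat) \<otimes>\<^bsub>C3\<^esub> inv\<^bsub>C3\<^esub> (e3 y [^]\<^bsub>C3\<^esub> (2 * k * N))"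
      using x3 y ep by (simp add: w_def e3.hom_nat_pow C3.nat_pow_pow mult.assoc)
    also have "\<dots> [^]\<^bsub>C3\<^esub> m = p3 x3 [^]\<^bsub>C3\<^esub> (2 * m) \<otimes>\<^bsub>C3\<^esub> inv\<^bsub>C3\<^esub> (e3 y [^]\<^bsub>C3\<^esub> (2 * k * N * m))"
      using x3 y by (simp add: C3.nat_pow_distrib C3.nat_pow_pow C3.nat_pow_inv)
    finally have eq: "p3 (f2 x2) = p3 x3 [^]\<^bsub>C3\<^esub> (2 * m) \<otimes>\<^bsub>C3\<^esub> inv\<^bsub>C3\<^esub> (e3 y [^]\<^bsub>C3\<^esub> (2 * k * N * m))" .
    have "e3 y [^]\<^bsub>C3\<^esub> (2 * k * N * m) = p3 (x3 [^]\<^bsub>G3\<^esub> (2 * m) \<otimes>\<^bsub>G3\<^esub> inv\<^bsub>G3\<^esub> (f2 x2))"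
      using x3 y x2 by (simp add: p3.hom_nat_pow eq comm_group_cancel[OF assms(8)])
    moreover have "2 * k * N * m > 0" using x4 N x2 by simp
    moreover have "x3 [^]\<^bsub>G3\<^esub> (2 * m) \<otimes>\<^bsub>G3\<^esub> inv\<^bsub>G3\<^esub> (f2 x2) \<in> carrier G3" using x3 x2 by simp
    ultimately show ?thesis by metis
  qed
  ultimately show ?thesis unfolding mod_torsion_onto_def by blast
qed

lemma mod_torsion_onto_cong_iso:
  assumes "comm_group G" "comm_group C" "comm_group G'" "comm_group C'"
    and f: "f \<in> iso G G'" and g: "g \<in> iso C C'"
    and \<phi>: "p \<in> hom G C" "p' \<in> hom G' C'" and \<epsilon>: "e \<in> hom C C" "e' \<in> hom C' C'"
    and sq: "\<And>x. x \<in> carrier G \<Longrightarrow> g (p x) = p' (f x)"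
    and sqe: "\<And>y. y \<in> carrier C \<Longrightarrow> g (e y) = e' (g y)"
    and M: "mod_torsion_onto G C p e"
  shows "mod_torsion_onto G' C' p' e'"
proof -
  interpret G: comm_group G by fact
  interpret C: comm_group C by fact
  interpret G': comm_group G' by fact
  interpret C': comm_group C' by fact
  interpret f: group_hom G G' f using f by unfold_locales (auto simp: iso_def)
  interpret g: group_hom C C' g using g by unfold_locales (auto simp: iso_def)
  interpret p: group_hom G C p using \<phi> by unfold_locales
  interpret p': group_hom G' C' p' using \<phi> by unfold_locales
  interpret e: group_hom C C e using \<epsilon> by unfold_locales
  interpret e': group_hom C' C' e' using \<epsilon> by unfold_locales
  have fs: "f ` carrier G = carrier G'" "inj_on g (carrier C)" "g ` carrier C = carrier C'"
    using f g by (auto simp: iso_def bij_betw_def)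
  have "\<exists>k::nat>0. x' [^]\<^bsub>G'\<^esub> k = \<one>\<^bsub>G'\<^esub>" if x': "x' \<in> carrier G'" and px: "p' x' = \<one>\<^bsub>C'\<^esub>" for x'
  proof -
    obtain x where x: "x \<in> carrier G" "x' = f x" using fs(1) x' by blast
    have "g (p x) = g \<one>\<^bsub>C\<^esub>" using sq x px by simp
    then have "p x = \<one>\<^bsub>C\<^esub>" using fs x by (meson C.one_closed inj_on_def p.hom_closed)
    from mod_torsion_onto_kernel[OF M this x(1)]
    obtain k :: nat where "k > 0" "x [^]\<^bsub>G\<^esub> k = \<one>\<^bsub>G\<^esub>" .
    then show ?thesis using x f.hom_nat_pow f.hom_one by metis
  qed
  moreover have "\<exists>x \<in> carrier G'. \<exists>k::nat>0. e' y' [^]\<^bsub>C'\<^esub> k = p' x" if y': "y' \<in> carrier C'" for y'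
  proof -
    obtain y where y: "y \<in> carrier C" "y' = g y" using fs(3) y' by blast
    obtain x and k :: nat where x: "x \<in> carrier G" "k > 0" "e y [^]\<^bsub>C\<^esub> k = p x"
      using mod_torsion_onto_multiple[OF M y(1)] .
    have "e' y' [^]\<^bsub>C'\<^esub> k = p' (f x)"
      using sq[OF x(1)] sqe y x g.hom_nat_pow e.hom_closed by metis
    then show ?thesis using x f.hom_closed by metis
  qed
  ultimately show ?thesis unfolding mod_torsion_onto_def by blast
qed

section \<open>The rank of an abelian group\<close>

text \<open>\<open>abelian_rank\<close> counts independent sets. A family that is independent as a
  family is injective, because \<open>y i = y j\<close> would give the relation with coefficients 1
  and -1; so its range has the cardinality of the index set.\<close>

lemma enat_card_le_abelian_rank:
  fixes y :: "'i \<Rightarrow> 'a" and H (structure)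
  assumes "comm_group H" "finite I" and y: "\<And>i. i \<in> I \<Longrightarrow> y i \<in> carrier H"
    and ind: "\<And>k :: 'i \<Rightarrow> int. finprod H (\<lambda>i. y i [^]\<^bsub>H\<^esub> k i) I = \<one>\<^bsub>H\<^esub> \<Longrightarrow> \<forall>i \<in> I. k i = 0"
  shows "enat (card I) \<le> abelian_rank H"
proof -
  interpret comm_group H by fact
  have inj: "inj_on y I"
  proof (rule inj_onI, rule ccontr)
    fix i j assume ij: "i \<in> I" "j \<in> I" "y i = y j" "i \<noteq> j"
    define k where "k = (\<lambda>l. if l = i then 1 else if l = j then - 1 else 0 :: int)"
    have "finprod H (\<lambda>l. y l [^]\<^bsub>H\<^esub> k l) I = finprod H (\<lambda>l. y l [^]\<^bsub>H\<^esub> k l) {i, j}"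
      using assms(2) ij y by (intro finprod_mono_neutral_cong_right) (auto simp: k_def)
    also have "\<dots> = y i \<otimes>\<^bsub>H\<^esub> inv\<^bsub>H\<^esub> (y j)"
      using ij y by (simp add: k_def int_pow_neg)
    also have "\<dots> = \<one>\<^bsub>H\<^esub>" using ij y by simp
    finally show False using ind[of k] ij by (auto simp: k_def)
  qed
  have "int_independent H (y ` I)"
    unfolding int_independent_def
  proof (intro conjI allI impI ballI)
    show "finite (y ` I)" "y ` I \<subseteq> carrier H" using assms by auto
    fix k :: "'a \<Rightarrow> int" and x
    assume "finprod H (\<lambda>x. x [^]\<^bsub>H\<^esub> k x) (y ` I) = \<one>\<^bsub>H\<^esub>" and x: "x \<in> y ` I"
    moreover have "(\<lambda>x. x [^]\<^bsub>H\<^esub> k x) \<in> y ` I \<rightarrow> carrier H" using y by auto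
    ultimately have "finprod H (\<lambda>i. y i [^]\<^bsub>H\<^esub> k (y i)) I = \<one>\<^bsub>H\<^esub>"
      using inj by (simp add: finprod_reindex)
    from ind[OF this] show "k x = 0" using x by auto
  qed
  then have "enat (card (y ` I)) \<le> abelian_rank H"
    unfolding abelian_rank_def by (intro SUP_upper) auto
  then show ?thesis using inj by (simp add: card_image)
qed

lemma hom_finprod:
  assumes "comm_group G" "comm_group H" "f \<in> hom G H" "\<And>i. i \<in> I \<Longrightarrow> y i \<in> carrier G"
  shows "f (finprod G y I) = finprod H (\<lambda>i. f (y i)) I"
proof -
  interpret G: comm_group G by fact
  interpret H: comm_group H by fact
  interpret f: group_hom G H f using assms by unfold_locales
  show ?thesis using assms(4)
  proof (induct I rule: infinite_finite_induct)
    case (insert i I)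
    then have "y \<in> I \<rightarrow> carrier G" "(\<lambda>i. f (y i)) \<in> I \<rightarrow> carrier H" by auto
    then show ?case using insert by simp
  qed auto
qed

lemma finprod_int_pow:
  assumes "comm_group G" "\<And>i. i \<in> I \<Longrightarrow> y i \<in> carrier G"
  shows "finprod G y I [^]\<^bsub>G\<^esub> (k::int) = finprod G (\<lambda>i. y i [^]\<^bsub>G\<^esub> k) I"
proof -
  interpret G: comm_group G by fact
  have "(\<lambda>x. x [^]\<^bsub>G\<^esub> k) \<in> hom G G" by (auto simp: hom_def G.int_pow_distrib)
  from hom_finprod[OF assms(1,1) this] assms(2) show ?thesis by blast
qed

text \<open>Two maps into a common group stand in for a homomorphism from \<open>G\<close> to
  \<open>H\<close>. An independent set of \<open>G\<close> has powers whose images under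
  \<open>g\<close> are values of \<open>h\<close>; a relation between the chosen preimages in
  \<open>H\<close> becomes in \<open>C\<close> the statement that \<open>g\<close> kills a product
  of powers of the original elements. That product is torsion, hence some power of it is a relation
  in \<open>G\<close>.\<close>

lemma abelian_rank_le_if_multiples:
  assumes "comm_group G" "comm_group H" "comm_group C"
    and g: "g \<in> hom G C" and h: "h \<in> hom H C"
    and ker: "\<And>x. \<lbrakk>x \<in> carrier G; g x = \<one>\<^bsub>C\<^esub>\<rbrakk> \<Longrightarrow> \<exists>k::nat>0. x [^]\<^bsub>G\<^esub> k = \<one>\<^bsub>G\<^esub>"
    and mult: "\<And>x. x \<in> carrier G \<Longrightarrow> \<exists>y \<in> carrier H. \<exists>k::nat>0. g x [^]\<^bsub>C\<^esub> k = h y"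
  shows "abelian_rank G \<le> abelian_rank H"
  unfolding abelian_rank_def[of G]
proof (rule SUP_least)
  fix A assume "A \<in> {A. int_independent G A}"
  then have A: "finite A" "A \<subseteq> carrier G"
    "\<And>k :: _ \<Rightarrow> int. finprod G (\<lambda>x. x [^]\<^bsub>G\<^esub> k x) A = \<one>\<^bsub>G\<^esub> \<Longrightarrow> \<forall>x \<in> A. k x = 0"
    by (auto simp: int_independent_def)
  interpret G: comm_group G by fact
  interpret H: comm_group H by fact
  interpret C: comm_group C by fact
  interpret g: group_hom G C g using assms by unfold_locales
  interpret h: group_hom H C h using assms by unfold_locales
  have "\<forall>x \<in> A. \<exists>y. \<exists>k::nat. y \<in> carrier H \<and> k > 0 \<and> g x [^]\<^bsub>C\<^esub> k = h y"
    using mult A by blast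
  then obtain y and m :: "_ \<Rightarrow> nat" where y: "\<And>x. x \<in> A \<Longrightarrow> y x \<in> carrier H"
    and m: "\<And>x. x \<in> A \<Longrightarrow> m x > 0" "\<And>x. x \<in> A \<Longrightarrow> g x [^]\<^bsub>C\<^esub> m x = h (y x)"
    by metis
  show "enat (card A) \<le> abelian_rank H"
  proof (rule enat_card_le_abelian_rank[of H A y])
    fix k :: "_ \<Rightarrow> int" assume k: "finprod H (\<lambda>i. y i [^]\<^bsub>H\<^esub> k i) A = \<one>\<^bsub>H\<^esub>"
    \<comment> \<open>The exponent \<open>m x\<close> is the one at which the image of
      \<open>x\<close> becomes \<open>h (y x)\<close>; with it \<open>g z\<close> is exactly the
      image under \<open>h\<close> of the given relation.\<close>
    define z where "z = finprod G (\<lambda>x. x [^]\<^bsub>G\<^esub> (int (m x) * k x)) A"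
    have z: "z \<in> carrier G" using A unfolding z_def by (intro G.finprod_closed) auto
    have "\<one>\<^bsub>C\<^esub> = h (finprod H (\<lambda>i. y i [^]\<^bsub>H\<^esub> k i) A)" using k by simp
    also have "\<dots> = finprod C (\<lambda>i. h (y i [^]\<^bsub>H\<^esub> k i)) A"
      using y by (intro hom_finprod assms) auto
    also have "\<dots> = finprod C (\<lambda>x. g (x [^]\<^bsub>G\<^esub> (int (m x) * k x))) A"
    proof (rule C.finprod_cong')
      show "h (y x [^]\<^bsub>H\<^esub> k x) = g (x [^]\<^bsub>G\<^esub> (int (m x) * k x))" if "x \<in> A" for x
      proof -
        have "h (y x [^]\<^bsub>H\<^esub> k x) = (g x [^]\<^bsub>C\<^esub> m x) [^]\<^bsub>C\<^esub> k x"
          using that y m by (simp add: h.hom_int_pow)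
        also have "\<dots> = g x [^]\<^bsub>C\<^esub> (int (m x) * k x)"
          using that A by (subst C.int_pow_pow[symmetric]) (auto simp: int_pow_int)
        also have "\<dots> = g (x [^]\<^bsub>G\<^esub> (int (m x) * k x))" using that A by (simp add: g.hom_int_pow subsetD)
        finally show ?thesis .
      qed
    qed (use A in auto)
    also have "\<dots> = g z" unfolding z_def using A by (intro hom_finprod[symmetric] assms) auto
    finally obtain l :: nat where l: "l > 0" "z [^]\<^bsub>G\<^esub> l = \<one>\<^bsub>G\<^esub>" using ker[OF z] by auto
    have "\<one>\<^bsub>G\<^esub> = z [^]\<^bsub>G\<^esub> int l" using l by (simp add: int_pow_int)
    also have "\<dots> = finprod G (\<lambda>x. (x [^]\<^bsub>G\<^esub> (int (m x) * k x)) [^]\<^bsub>G\<^esub> int l) A"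
      unfolding z_def using A by (intro finprod_int_pow assms) auto
    also have "\<dots> = finprod G (\<lambda>x. x [^]\<^bsub>G\<^esub> (int (m x) * k x * int l)) A"
      using A by (intro G.finprod_cong') (auto simp: G.int_pow_pow subsetD)
    finally have "\<forall>x \<in> A. int (m x) * k x * int l = 0" by (intro A(3)) simp
    then show "\<forall>x \<in> A. k x = 0" using l m by fastforce
  qed (use A y assms in auto)
qed

text \<open>Modulo torsion both groups are the image of the same endomorphism \<open>e\<close>.
  Applied to the element \<open>g x\<close> of \<open>C\<close>, the hypothesis on \<open>H\<close>
  says that some power of \<open>e (g x)\<close> has the form \<open>e (h y)\<close>; the roles of
  \<open>G\<close> and \<open>H\<close> are symmetric.\<close>

lemma abelian_rank_cong_mod_torsion_onto:
  assumes "comm_group G" "comm_group H" "comm_group C"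
    and "g \<in> hom G C" "h \<in> hom H C"
    and "mod_torsion_onto G C (e \<circ> g) e" "mod_torsion_onto H C (e \<circ> h) e" "e \<in> hom C C"
  shows "abelian_rank G = abelian_rank H"
proof (rule antisym)
  have cl: "g x \<in> carrier C" if "x \<in> carrier G" for x using that assms by (auto simp: hom_def)
  have cl': "h x \<in> carrier C" if "x \<in> carrier H" for x using that assms by (auto simp: hom_def)
  have eg: "e \<circ> g \<in> hom G C" "e \<circ> h \<in> hom H C" using assms by (auto intro: hom_compose)
  show "abelian_rank G \<le> abelian_rank H"
    using assms(6,7) cl
    by (intro abelian_rank_le_if_multiples[OF assms(1-3) eg]) (auto simp: mod_torsion_onto_def)
  show "abelian_rank H \<le> abelian_rank G"
    using assms(6,7) cl'
    by (intro abelian_rank_le_if_multiples[OF assms(2,1,3) eg(2,1)]) (auto simp: mod_torsion_onto_def)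
qed

lemma abelian_rank_iso:
  assumes "comm_group G" "comm_group H" "G \<cong> H"
  shows "abelian_rank G = abelian_rank H"
proof -
  have *: "abelian_rank G \<le> abelian_rank H" if cg: "comm_group G" "comm_group H" and f: "f \<in> iso G H"
    for G :: "('a, 'b) monoid_scheme" and H :: "('c, 'd) monoid_scheme" and f
  proof (rule abelian_rank_le_if_multiples[of G H H f "\<lambda>x. x"])
    interpret G: comm_group G by fact
    interpret H: comm_group H by fact
    interpret f: group_hom G H f using f by unfold_locales (auto simp: iso_def)
    show "\<exists>k::nat>0. x [^]\<^bsub>G\<^esub> k = \<one>\<^bsub>G\<^esub>" if "x \<in> carrier G" "f x = \<one>\<^bsub>H\<^esub>" for x
    proof -
      have "inj_on f (carrier G)" using f by (simp add: iso_def bij_betw_def)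
      then have "x = \<one>\<^bsub>G\<^esub>" using that by (metis G.one_closed f.hom_one inj_onD)
      then show ?thesis by (intro exI[of _ 1]) simp
    qed
    show "\<exists>y \<in> carrier H. \<exists>k::nat>0. f x [^]\<^bsub>H\<^esub> k = y" if "x \<in> carrier G" for x
      using that by (intro bexI[of _ "f x"] exI[of _ 1]) auto
  qed (use that in \<open>auto simp: iso_def hom_def\<close>)
  from assms(3) obtain f where f: "f \<in> iso G H" by (auto simp: is_iso_def)
  have "abelian_rank H \<le> abelian_rank G"
  proof (rule abelian_rank_le_if_multiples[of H G H "\<lambda>x. x" f])
    show "\<exists>y \<in> carrier G. \<exists>k::nat>0. x [^]\<^bsub>H\<^esub> k = f y" if "x \<in> carrier H" for x
    proof -
      have "x \<in> f ` carrier G" using f that by (simp add: iso_def bij_betw_def)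
      then obtain y where "y \<in> carrier G" "x = f y" by (rule imageE)
      moreover have "x [^]\<^bsub>H\<^esub> (1::nat) = x"
        using assms(2) that by (simp add: comm_group_def group.is_monoid monoid.l_one)
      ultimately show ?thesis by (metis zero_less_one)
    qed
    show "\<exists>k::nat>0. x [^]\<^bsub>H\<^esub> k = \<one>\<^bsub>H\<^esub>" if "x \<in> carrier H" "x = \<one>\<^bsub>H\<^esub>" for x
      using that assms(2) by (intro exI[of _ 1]) (simp add: comm_group_def group.is_monoid)
  qed (use assms f in \<open>auto simp: iso_def hom_def\<close>)
  with *[OF assms(1,2) f] show ?thesis by simp
qed


text \<open>Fraction-free Gaussian elimination, one column of \<open>M\<close> at a time.\<close>

lemma int_linear_dependence:
  fixes M :: "'s \<Rightarrow> 't \<Rightarrow> int"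
  assumes "finite T" "finite S" "card T < card S"
  obtains k where "\<exists>s \<in> S. k s \<noteq> 0" "\<And>t. t \<in> T \<Longrightarrow> (\<Sum>s\<in>S. k s * M s t) = 0"
proof -
  have "\<exists>k. (\<exists>s \<in> S. k s \<noteq> 0) \<and> (\<forall>t \<in> T. (\<Sum>s\<in>S. k s * M s t) = 0)"
    using assms
  proof (induction T arbitrary: S M rule: finite_induct)
    case empty
    then have "S \<noteq> {}" by auto
    then show ?case by (intro exI[of _ "\<lambda>_. 1"]) auto
  next
    case (insert t T)
    show ?case
    proof (cases "\<forall>s \<in> S. M s t = 0")
      case True
      have "card T < card S" using insert by simp
      with insert.IH[of S M] insert.prems obtain k where
        "\<exists>s \<in> S. k s \<noteq> 0" "\<forall>t \<in> T. (\<Sum>s\<in>S. k s * M s t) = 0" by auto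
      then show ?thesis using True by (intro exI[of _ k]) auto
    next
      case False
      then obtain s0 where s0: "s0 \<in> S" "M s0 t \<noteq> 0" by auto
      \<comment> \<open>Row \<open>s\<close> is multiplied by the pivot \<open>M s0 t\<close>
        instead of being divided by it. Column \<open>t\<close> of \<open>M'\<close>
        vanishes.\<close>
      define M' where "M' = (\<lambda>s t'. M s0 t * M s t' - M s t * M s0 t')"
      have "card T < card (S - {s0})" using insert s0 by simp
      with insert.IH[of "S - {s0}" M'] insert.prems obtain k where
        k: "\<exists>s \<in> S - {s0}. k s \<noteq> 0" "\<forall>t \<in> T. (\<Sum>s\<in>S - {s0}. k s * M' s t) = 0" by auto
      \<comment> \<open>Coefficients for the rows of \<open>M'\<close>, rewritten for the rows of
        \<open>M\<close>: the pivot row collects everything that was subtracted.\<close>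
      define l where "l = (\<lambda>s. if s = s0 then - (\<Sum>s\<in>S - {s0}. k s * M s t) else k s * M s0 t)"
      have l: "(\<Sum>s\<in>S. l s * M s t') = (\<Sum>s\<in>S - {s0}. k s * M' s t')" for t'
      proof -
        have "(\<Sum>s\<in>S. l s * M s t') = l s0 * M s0 t' + (\<Sum>s\<in>S - {s0}. l s * M s t')"
          using insert.prems s0 by (simp add: sum.remove)
        also have "(\<Sum>s\<in>S - {s0}. l s * M s t') = (\<Sum>s\<in>S - {s0}. k s * M s0 t * M s t')"
          by (intro sum.cong) (auto simp: l_def)
        also have "l s0 * M s0 t' = - (\<Sum>s\<in>S - {s0}. k s * M s t * M s0 t')"
          by (simp add: l_def sum_distrib_right)
        finally show ?thesis by (simp add: M'_def algebra_simps sum_subtractf)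
      qed
      have "(\<Sum>s\<in>S. l s * M s t) = 0" by (simp add: l M'_def algebra_simps)
      moreover have "\<exists>s \<in> S. l s \<noteq> 0" using k(1) s0 by (auto simp: l_def)
      ultimately show ?thesis using l k(2) by (intro exI[of _ l]) auto
    qed
  qed
  then show ?thesis using that by blast
qed

text \<open>The cardinalities of independent sets are bounded by \<open>r\<close>, so the supremum
  is attained. Adjoining a further element to a largest independent set produces a relation, and in
  it the new element has a nonzero exponent because the old ones alone are independent.\<close>

lemma abelian_rank_maximal:
  assumes "comm_group G" "abelian_rank G = enat r"
  obtains A where "int_independent G A" "card A = r"
    "\<forall>x \<in> carrier G.
      \<exists>(n::int) k. n \<noteq> 0 \<and> x [^]\<^bsub>G\<^esub> n = finprod G (\<lambda>a. a [^]\<^bsub>G\<^esub> (k a :: int)) A"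
proof -
  interpret comm_group G by fact
  have e: "int_independent G {}" by (simp add: int_independent_def)
  have le: "card A \<le> r" if "int_independent G A" for A
  proof -
    have "enat (card A) \<le> abelian_rank G"
      unfolding abelian_rank_def using that by (intro SUP_upper) auto
    then show ?thesis using assms(2) by simp
  qed
  have "\<exists>A. int_independent G A \<and> (\<forall>B. int_independent G B \<longrightarrow> card B \<le> card A)"
    using e le by (intro ex_has_greatest_nat[of _ "{}" card "Suc r"]) (auto simp: less_Suc_eq_le)
  then obtain A where A: "int_independent G A" "\<And>B. int_independent G B \<Longrightarrow> card B \<le> card A"
    by auto
  have "abelian_rank G \<le> enat (card A)"
    unfolding abelian_rank_def using A(2) by (intro SUP_least) auto
  then have card: "card A = r" using le[OF A(1)] assms(2) by simp
  have A': "finite A" "A \<subseteq> carrier G"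
    "\<And>k :: _ \<Rightarrow> int. finprod G (\<lambda>x. x [^]\<^bsub>G\<^esub> k x) A = \<one>\<^bsub>G\<^esub> \<Longrightarrow> \<forall>x \<in> A. k x = 0"
    using A(1) by (auto simp: int_independent_def)
  have "\<exists>(n::int) k. n \<noteq> 0 \<and> x [^]\<^bsub>G\<^esub> n = finprod G (\<lambda>a. a [^]\<^bsub>G\<^esub> (k a :: int)) A"
    if x: "x \<in> carrier G" for x
  proof (cases "x \<in> A")
    case True
    have "finprod G (\<lambda>a. a [^]\<^bsub>G\<^esub> (if a = x then 1 else 0 :: int)) A
        = finprod G (\<lambda>a. if a = x then a else \<one>\<^bsub>G\<^esub>) A"
      using A' by (intro finprod_cong') auto
    also have "\<dots> = x" using True A' by (intro finprod_singleton_swap) auto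
    finally show ?thesis using x by (intro exI[of _ 1] exI[of _ "\<lambda>a. if a = x then 1 else 0"]) simp
  next
    case False
    have "\<not> int_independent G (insert x A)"
    proof
      assume "int_independent G (insert x A)"
      from A(2)[OF this] False A'(1) show False by simp
    qed
    then obtain k :: "_ \<Rightarrow> int" and y where
      k: "finprod G (\<lambda>x. x [^]\<^bsub>G\<^esub> k x) (insert x A) = \<one>\<^bsub>G\<^esub>" "y \<in> insert x A" "k y \<noteq> 0"
      using A' x by (auto simp: int_independent_def)
    have cl: "(\<lambda>x. x [^]\<^bsub>G\<^esub> k x) \<in> A \<rightarrow> carrier G" using A' by auto
    have p: "x [^]\<^bsub>G\<^esub> k x \<otimes>\<^bsub>G\<^esub> finprod G (\<lambda>x. x [^]\<^bsub>G\<^esub> k x) A = \<one>\<^bsub>G\<^esub>"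
      using k(1) False A' x cl by simp
    have "k x \<noteq> 0"
    proof
      assume "k x = 0"
      then have "finprod G (\<lambda>x. x [^]\<^bsub>G\<^esub> k x) A = \<one>\<^bsub>G\<^esub>" using p cl by simp
      from A'(3)[OF this] k \<open>k x = 0\<close> show False by auto
    qed
    have "x [^]\<^bsub>G\<^esub> (- k x) = finprod G (\<lambda>x. x [^]\<^bsub>G\<^esub> k x) A"
      using p x cl by (simp add: int_pow_neg) (metis finprod_closed int_pow_closed inv_equality inv_inv m_comm)
    then show ?thesis using \<open>k x \<noteq> 0\<close> by (intro exI[of _ "- k x"] exI[of _ k]) simp
  qed
  then show ?thesis using that A(1) card by blast
qed

text \<open>Steinitz exchange up to multiples. The exponents expressing powers of the elements of an
  independent set \<open>B\<close> through the \<open>y a\<close> form an integer matrix; with more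
  rows than columns its rows are dependent, which would be a relation in \<open>B\<close>.\<close>

lemma abelian_rank_le_card:
  fixes y :: "'i \<Rightarrow> 'a" and G (structure)
  assumes "comm_group G" "finite A" and y: "\<And>a. a \<in> A \<Longrightarrow> y a \<in> carrier G"
    and gen: "\<And>x. x \<in> carrier G \<Longrightarrow>
      \<exists>(n::int) k. n \<noteq> 0 \<and> x [^]\<^bsub>G\<^esub> n = finprod G (\<lambda>a. y a [^]\<^bsub>G\<^esub> (k a :: int)) A"
  shows "abelian_rank G \<le> enat (card A)"
  unfolding abelian_rank_def
proof (rule SUP_least)
  interpret comm_group G by fact
  fix B assume "B \<in> {A. int_independent G A}"
  then have B: "finite B" "B \<subseteq> carrier G"
    "\<And>k :: _ \<Rightarrow> int. finprod G (\<lambda>x. x [^]\<^bsub>G\<^esub> k x) B = \<one>\<^bsub>G\<^esub> \<Longrightarrow> \<forall>x \<in> B. k x = 0"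
    by (auto simp: int_independent_def)
  have "\<forall>x \<in> B. \<exists>(n::int) k. n \<noteq> 0 \<and> x [^]\<^bsub>G\<^esub> n = finprod G (\<lambda>a. y a [^]\<^bsub>G\<^esub> (k a :: int)) A"
    using gen B by blast
  then obtain n :: "_ \<Rightarrow> int" and M :: "_ \<Rightarrow> _ \<Rightarrow> int" where
    n: "\<And>x. x \<in> B \<Longrightarrow> n x \<noteq> 0"
    and M: "\<And>x. x \<in> B \<Longrightarrow> x [^]\<^bsub>G\<^esub> n x = finprod G (\<lambda>a. y a [^]\<^bsub>G\<^esub> M x a) A"
    by metis
  show "enat (card B) \<le> enat (card A)"
  proof (rule ccontr)
    assume "\<not> enat (card B) \<le> enat (card A)"
    then have "card A < card B" by simp
    from int_linear_dependence[OF assms(2) B(1) this, of M]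
    obtain k where k: "\<exists>s \<in> B. k s \<noteq> 0" "\<And>t. t \<in> A \<Longrightarrow> (\<Sum>s\<in>B. k s * M s t) = 0" by blast
    have "finprod G (\<lambda>x. x [^]\<^bsub>G\<^esub> (n x * k x)) B
        = finprod G (\<lambda>x. finprod G (\<lambda>a. y a [^]\<^bsub>G\<^esub> (M x a * k x)) A) B"
    proof (rule finprod_cong')
      fix x assume x: "x \<in> B"
      have "x [^]\<^bsub>G\<^esub> (n x * k x) = (x [^]\<^bsub>G\<^esub> n x) [^]\<^bsub>G\<^esub> k x" using x B by (simp add: int_pow_pow subsetD)
      also have "\<dots> = finprod G (\<lambda>a. (y a [^]\<^bsub>G\<^esub> M x a) [^]\<^bsub>G\<^esub> k x) A"
        unfolding M[OF x] using y by (intro finprod_int_pow assms) auto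
      also have "\<dots> = finprod G (\<lambda>a. y a [^]\<^bsub>G\<^esub> (M x a * k x)) A"
        using y by (intro finprod_cong') (auto simp: int_pow_pow)
      finally show "x [^]\<^bsub>G\<^esub> (n x * k x) = finprod G (\<lambda>a. y a [^]\<^bsub>G\<^esub> (M x a * k x)) A" .
    qed (use y in \<open>auto intro!: finprod_closed\<close>)
    \<comment> \<open>Exchanging the two products turns the exponent of each \<open>y a\<close> into
      a column sum, and these were made to vanish.\<close>
    also have "\<dots> = finprod G (\<lambda>a. finprod G (\<lambda>x. y a [^]\<^bsub>G\<^esub> (M x a * k x)) B) A"
      using B(1) assms(2) y
    proof (induction B rule: finite_induct)
      case (insert x F)
      have "finprod G (\<lambda>x. finprod G (\<lambda>a. y a [^]\<^bsub>G\<^esub> (M x a * k x)) A) (insert x F)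
         = finprod G (\<lambda>a. y a [^]\<^bsub>G\<^esub> (M x a * k x)) A \<otimes>\<^bsub>G\<^esub>
           finprod G (\<lambda>a. finprod G (\<lambda>x. y a [^]\<^bsub>G\<^esub> (M x a * k x)) F) A"
        using insert by (subst finprod_insert) (auto intro!: finprod_closed)
      also have "\<dots> = finprod G (\<lambda>a. y a [^]\<^bsub>G\<^esub> (M x a * k x) \<otimes>\<^bsub>G\<^esub> finprod G (\<lambda>x. y a [^]\<^bsub>G\<^esub> (M x a * k x)) F) A"
        using insert by (intro finprod_multf[symmetric]) (auto intro!: finprod_closed)
      also have "\<dots> = finprod G (\<lambda>a. finprod G (\<lambda>x. y a [^]\<^bsub>G\<^esub> (M x a * k x)) (insert x F)) A"
        using insert by (intro finprod_cong') (auto intro!: finprod_closed)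
      finally show ?case .
    qed simp
    also have "\<dots> = finprod G (\<lambda>a. \<one>\<^bsub>G\<^esub>) A"
    proof (rule finprod_cong')
      fix a assume a: "a \<in> A"
      then have ya: "y a \<in> carrier G" by (rule y)
      have "finprod G (\<lambda>x. y a [^]\<^bsub>G\<^esub> (M x a * k x)) F = y a [^]\<^bsub>G\<^esub> (\<Sum>x\<in>F. k x * M x a)"
        if "finite F" for F
        using that ya
      proof (induction F rule: finite_induct)
        case (insert x F)
        then show ?case by (subst finprod_insert) (auto simp: int_pow_mult mult.commute)
      qed simp
      then show "finprod G (\<lambda>x. y a [^]\<^bsub>G\<^esub> (M x a * k x)) B = \<one>\<^bsub>G\<^esub>" using B(1) k(2)[OF a] by simp
    qed auto
    finally have "\<forall>x \<in> B. n x * k x = 0" by (intro B(3)) simp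
    then show False using n k(1) by auto
  qed
qed

lemma comm_group_DirProd:
  assumes "comm_group G" "comm_group H"
  shows "comm_group (G \<times>\<times> H)"
proof -
  interpret G: comm_group G by fact
  interpret H: comm_group H by fact
  interpret GH: group "G \<times>\<times> H" using DirProd_group G.is_group H.is_group by blast
  show ?thesis by (rule GH.group_comm_groupI) (auto simp: G.m_comm H.m_comm)
qed

text \<open>For finite ranks, maximal independent sets of the two factors together give a basis of
  the product up to multiples. If one rank is infinite, the embedded factor already makes the rank
  of the product infinite.\<close>

lemma abelian_rank_DirProd:
  assumes cg: "comm_group G" "comm_group H"
  shows "abelian_rank (G \<times>\<times> H) = abelian_rank G + abelian_rank H"
proof -
  interpret G: comm_group G by fact
  interpret H: comm_group H by fact
  have GH: "comm_group (G \<times>\<times> H)" using cg by (rule comm_group_DirProd)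
  interpret GH: comm_group "G \<times>\<times> H" by fact
  have homs: "(\<lambda>x. (x, \<one>\<^bsub>H\<^esub>)) \<in> hom G (G \<times>\<times> H)" "(\<lambda>y. (\<one>\<^bsub>G\<^esub>, y)) \<in> hom H (G \<times>\<times> H)"
    "fst \<in> hom (G \<times>\<times> H) G" "snd \<in> hom (G \<times>\<times> H) H"
    by (auto simp: hom_def DirProd_def)
  have pow: "(x, y) [^]\<^bsub>G \<times>\<times> H\<^esub> (n::int) = (x [^]\<^bsub>G\<^esub> n, y [^]\<^bsub>H\<^esub> n)"
    if "x \<in> carrier G" "y \<in> carrier H" for x y n
    using that hom_int_pow[OF homs(3) _ GH.is_group G.is_group, of "(x, y)" n]
      hom_int_pow[OF homs(4) _ GH.is_group H.is_group, of "(x, y)" n]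
    by (auto simp: prod_eq_iff)
  define y where "y = case_sum (\<lambda>x. (x, \<one>\<^bsub>H\<^esub>)) (\<lambda>y. (\<one>\<^bsub>G\<^esub>, y))"
  have prod: "finprod (G \<times>\<times> H) (\<lambda>i. y i [^]\<^bsub>G \<times>\<times> H\<^esub> k i) (Sum_Type.Plus A B) =
      (finprod G (\<lambda>a. a [^]\<^bsub>G\<^esub> k (Inl a)) A, finprod H (\<lambda>b. b [^]\<^bsub>H\<^esub> k (Inr b)) B)"
    (is "?p = _") and cl: "\<And>i. i \<in> Sum_Type.Plus A B \<Longrightarrow> y i \<in> carrier (G \<times>\<times> H)"
    if fin: "finite A" "finite B" and sub: "A \<subseteq> carrier G" "B \<subseteq> carrier H"
    for A B and k :: "_ \<Rightarrow> int"
  proof -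
    show cl: "y i \<in> carrier (G \<times>\<times> H)" if "i \<in> Sum_Type.Plus A B" for i using that sub by (auto simp: y_def)
    have "fst ?p = finprod G (\<lambda>i. fst (y i [^]\<^bsub>G \<times>\<times> H\<^esub> k i)) (Sum_Type.Plus A B)"
      using GH.int_pow_closed[OF cl] by (intro hom_finprod GH cg homs)
    also have "\<dots> = finprod G (\<lambda>i. fst (y i [^]\<^bsub>G \<times>\<times> H\<^esub> k i)) (Inl ` A)"
      using fin sub by (intro G.finprod_mono_neutral_cong_right) (auto simp: y_def pow subsetD)
    also have "\<dots> = finprod G (\<lambda>i. fst (y (Inl i) [^]\<^bsub>G \<times>\<times> H\<^esub> k (Inl i))) A"
      using sub by (intro G.finprod_reindex) (auto simp: y_def pow subsetD)
    also have "\<dots> = finprod G (\<lambda>i. i [^]\<^bsub>G\<^esub> k (Inl i)) A"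
      using sub by (intro G.finprod_cong') (auto simp: y_def pow subsetD)
    finally have 1: "fst ?p = \<dots>" .
    have "snd ?p = finprod H (\<lambda>i. snd (y i [^]\<^bsub>G \<times>\<times> H\<^esub> k i)) (Sum_Type.Plus A B)"
      using GH.int_pow_closed[OF cl] by (intro hom_finprod GH cg homs)
    also have "\<dots> = finprod H (\<lambda>i. snd (y i [^]\<^bsub>G \<times>\<times> H\<^esub> k i)) (Inr ` B)"
      using fin sub by (intro H.finprod_mono_neutral_cong_right) (auto simp: y_def pow subsetD)
    also have "\<dots> = finprod H (\<lambda>i. snd (y (Inr i) [^]\<^bsub>G \<times>\<times> H\<^esub> k (Inr i))) B"
      using sub by (intro H.finprod_reindex) (auto simp: y_def pow subsetD)
    also have "\<dots> = finprod H (\<lambda>i. i [^]\<^bsub>H\<^esub> k (Inr i)) B"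
      using sub by (intro H.finprod_cong') (auto simp: y_def pow subsetD)
    finally show "?p = (finprod G (\<lambda>a. a [^]\<^bsub>G\<^esub> k (Inl a)) A, finprod H (\<lambda>b. b [^]\<^bsub>H\<^esub> k (Inr b)) B)"
      using 1 by (simp add: prod_eq_iff)
  qed
  have ge: "enat (card A + card B) \<le> abelian_rank (G \<times>\<times> H)"
    if A: "int_independent G A" and B: "int_independent H B" for A B
  proof -
    have fin: "finite A" "finite B" and sub: "A \<subseteq> carrier G" "B \<subseteq> carrier H"
      using A B by (auto simp: int_independent_def)
    have "enat (card (Sum_Type.Plus A B)) \<le> abelian_rank (G \<times>\<times> H)"
    proof (rule enat_card_le_abelian_rank[of _ _ y])
      fix k :: "_ \<Rightarrow> int" assume k: "finprod (G \<times>\<times> H) (\<lambda>i. y i [^]\<^bsub>G \<times>\<times> H\<^esub> k i) (Sum_Type.Plus A B) = \<one>\<^bsub>G \<times>\<times> H\<^esub>"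
      then have k: "finprod G (\<lambda>a. a [^]\<^bsub>G\<^esub> k (Inl a)) A = \<one>\<^bsub>G\<^esub>" "finprod H (\<lambda>b. b [^]\<^bsub>H\<^esub> k (Inr b)) B = \<one>\<^bsub>H\<^esub>"
        using prod[OF fin sub, of k] by auto
      have 1: "finprod G (\<lambda>a. a [^]\<^bsub>G\<^esub> l a) A = \<one>\<^bsub>G\<^esub> \<Longrightarrow> \<forall>a \<in> A. l a = 0" for l :: "_ \<Rightarrow> int"
        using A by (simp add: int_independent_def)
      have 2: "finprod H (\<lambda>b. b [^]\<^bsub>H\<^esub> l b) B = \<one>\<^bsub>H\<^esub> \<Longrightarrow> \<forall>b \<in> B. l b = 0" for l :: "_ \<Rightarrow> int"
        using B by (simp add: int_independent_def)
      have "\<forall>a \<in> A. k (Inl a) = 0" by (rule 1[OF k(1)])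
      moreover have "\<forall>b \<in> B. k (Inr b) = 0" by (rule 2[OF k(2)])
      ultimately show "\<forall>i \<in> Sum_Type.Plus A B. k i = 0" by auto
    qed (use GH fin cl[OF fin sub] in auto)
    then show ?thesis using fin by (simp add: card_Plus)
  qed
  have upper: "abelian_rank (G \<times>\<times> H) = enat (r + s)"
    if r: "abelian_rank G = enat r" and s: "abelian_rank H = enat s" for r s
  proof -
    obtain A where A: "int_independent G A" "card A = r" "\<forall>x \<in> carrier G.
      \<exists>(n::int) k. n \<noteq> 0 \<and> x [^]\<^bsub>G\<^esub> n = finprod G (\<lambda>a. a [^]\<^bsub>G\<^esub> (k a :: int)) A"
      using abelian_rank_maximal[OF cg(1) r] .
    obtain B where B: "int_independent H B" "card B = s" "\<forall>x \<in> carrier H.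
      \<exists>(n::int) k. n \<noteq> 0 \<and> x [^]\<^bsub>H\<^esub> n = finprod H (\<lambda>a. a [^]\<^bsub>H\<^esub> (k a :: int)) B"
      using abelian_rank_maximal[OF cg(2) s] .
    have fin: "finite A" "finite B" and sub: "A \<subseteq> carrier G" "B \<subseteq> carrier H"
      using A B by (auto simp: int_independent_def)
    have "abelian_rank (G \<times>\<times> H) \<le> enat (card (Sum_Type.Plus A B))"
    proof (rule abelian_rank_le_card[of _ _ y])
      fix z assume "z \<in> carrier (G \<times>\<times> H)"
      then obtain g h where z: "z = (g, h)" "g \<in> carrier G" "h \<in> carrier H" by auto
      obtain n :: int and k where n: "n \<noteq> 0" "g [^]\<^bsub>G\<^esub> n = finprod G (\<lambda>a. a [^]\<^bsub>G\<^esub> (k a :: int)) A"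
        using bspec[OF A(3) z(2)] by (elim exE conjE)
      obtain m :: int and l where m: "m \<noteq> 0" "h [^]\<^bsub>H\<^esub> m = finprod H (\<lambda>a. a [^]\<^bsub>H\<^esub> (l a :: int)) B"
        using bspec[OF B(3) z(3)] by (elim exE conjE)
      \<comment> \<open>The two components are expressible at different exponents;
        \<open>n * m\<close> serves both.\<close>
      have "g [^]\<^bsub>G\<^esub> (n * m) = finprod G (\<lambda>a. (a [^]\<^bsub>G\<^esub> k a) [^]\<^bsub>G\<^esub> m) A"
        using z sub n by (simp flip: G.int_pow_pow) (intro finprod_int_pow cg, auto)
      also have "\<dots> = finprod G (\<lambda>a. a [^]\<^bsub>G\<^esub> (k a * m)) A"
        using sub by (intro G.finprod_cong') (auto simp: G.int_pow_pow subsetD)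
      finally have 1: "g [^]\<^bsub>G\<^esub> (n * m) = \<dots>" .
      have "h [^]\<^bsub>H\<^esub> (m * n) = finprod H (\<lambda>a. (a [^]\<^bsub>H\<^esub> l a) [^]\<^bsub>H\<^esub> n) B"
        using z sub m by (simp flip: H.int_pow_pow) (intro finprod_int_pow cg, auto)
      also have "\<dots> = finprod H (\<lambda>a. a [^]\<^bsub>H\<^esub> (l a * n)) B"
        using sub by (intro H.finprod_cong') (auto simp: H.int_pow_pow subsetD)
      finally have 2: "h [^]\<^bsub>H\<^esub> (n * m) = \<dots>" by (simp add: mult.commute)
      have "z [^]\<^bsub>G \<times>\<times> H\<^esub> (n * m) = finprod (G \<times>\<times> H)
          (\<lambda>i. y i [^]\<^bsub>G \<times>\<times> H\<^esub> case_sum (\<lambda>a. k a * m) (\<lambda>b. l b * n) i) (Sum_Type.Plus A B)"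
        by (simp add: prod[OF fin sub] z pow 1 2)
      moreover have "n * m \<noteq> 0" using n m by simp
      ultimately show "\<exists>(n::int) k. n \<noteq> 0 \<and> z [^]\<^bsub>G \<times>\<times> H\<^esub> n =
          finprod (G \<times>\<times> H) (\<lambda>i. y i [^]\<^bsub>G \<times>\<times> H\<^esub> (k i :: int)) (Sum_Type.Plus A B)" by (intro exI conjI)
    qed (use GH fin cl[OF fin sub] in auto)
    then show ?thesis using ge[OF A(1) B(1)] A(2) B(2) fin by (intro antisym) (auto simp: card_Plus)
  qed
  have one: "x [^]\<^bsub>G \<times>\<times> H\<^esub> (1::nat) = x" if "x \<in> carrier (G \<times>\<times> H)" for x
    using that GH.nat_pow_eone by blast
  have "abelian_rank G \<le> abelian_rank (G \<times>\<times> H)"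
    using one by (intro abelian_rank_le_if_multiples[OF cg(1) GH GH homs(1), of "\<lambda>x. x"])
      (force simp: hom_def intro!: exI[of _ "1::nat"])+
  moreover have "abelian_rank H \<le> abelian_rank (G \<times>\<times> H)"
    using one by (intro abelian_rank_le_if_multiples[OF cg(2) GH GH homs(2), of "\<lambda>x. x"])
      (force simp: hom_def intro!: exI[of _ "1::nat"])+
  ultimately show ?thesis
    by (cases "abelian_rank G"; cases "abelian_rank H") (auto simp: upper)
qed

lemma abelian_rank_trivial_group:
  assumes "trivial_group G" "comm_group G"
  shows "abelian_rank G = 0"
proof -
  interpret comm_group G by fact
  have "abelian_rank G \<le> enat (card ({} :: 'a set))"
    using assms(1) by (intro abelian_rank_le_card[of _ _ "\<lambda>x. x"] assms(2)) (auto simp: trivial_group_def intro!: exI[of _ "1::int"])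
  then show ?thesis by (simp flip: zero_enat_def)
qed

lemma abelian_rank_integer_group: "abelian_rank integer_group = 1"
proof -
  have cg: "comm_group integer_group" by (rule abelian_integer_group)
  interpret comm_group integer_group by fact
  have "abelian_rank integer_group \<le> enat (card {1::int})"
    by (intro abelian_rank_le_card[of _ _ "\<lambda>x. x"] cg) (auto intro!: exI[of _ "1::int"])
  moreover have "enat (card {1::int}) \<le> abelian_rank integer_group"
    by (rule enat_card_le_abelian_rank[OF cg, of _ "\<lambda>x. x"]) auto
  ultimately show ?thesis by (simp add: one_enat_def)
qed

section \<open>Maps between projective spaces\<close>

text \<open>A product of quotient maps need not be a quotient map, but a product of open maps is
  open. This is what allows a map on W x CP^n to be described on W x (nonzero vectors) over any
  base.\<close>

lemma open_map_prod:
  assumes "open_map X X' f" "open_map Y Y' g"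
  shows "open_map (prod_topology X Y) (prod_topology X' Y') (\<lambda>(x, y). (f x, g y))"
  unfolding open_map_def
proof (intro allI impI)
  fix U assume U: "openin (prod_topology X Y) U"
  show "openin (prod_topology X' Y') ((\<lambda>(x, y). (f x, g y)) ` U)"
    unfolding openin_prod_topology_alt
  proof (intro allI impI)
    fix a b assume "(a, b) \<in> (\<lambda>(x, y). (f x, g y)) ` U"
    then obtain x y where xy: "(x, y) \<in> U" "a = f x" "b = g y" by auto
    then obtain V W where "openin X V" "openin Y W" "x \<in> V" "y \<in> W" "V \<times> W \<subseteq> U"
      using U unfolding openin_prod_topology_alt by metis
    then show "\<exists>V W. openin X' V \<and> openin Y' W \<and> a \<in> V \<and> b \<in> W \<and>
        V \<times> W \<subseteq> (\<lambda>(x, y). (f x, g y)) ` U"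
      using xy assms unfolding open_map_def
      by (intro exI[of _ "f ` V"] exI[of _ "g ` W"]) force
  qed
qed

abbreviation nonzero_vecs :: "(complex ^ 'n) topology" where
  "nonzero_vecs \<equiv> top_of_set (- {0})"

lemma span_singleton_eq_iff:
  fixes x y :: "complex ^ 'n"
  assumes "x \<noteq> 0"
  shows "vec.span {x} = vec.span {y} \<longleftrightarrow> (\<exists>k. k \<noteq> 0 \<and> y = k *s x)"
proof
  assume eq: "vec.span {x} = vec.span {y}"
  then have "y \<in> vec.span {x}" "x \<in> vec.span {y}" by (auto intro: vec.span_base)
  then obtain k l where kl: "y = k *s x" "x = l *s y" unfolding vec.span_singleton by blast
  then have "k \<noteq> 0" using assms by (metis vector_smult_lzero vec.scale_zero_right)
  then show "\<exists>k. k \<noteq> 0 \<and> y = k *s x" using kl by blast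
next
  assume "\<exists>k. k \<noteq> 0 \<and> y = k *s x"
  then obtain k where k: "k \<noteq> 0" "y = k *s x" by auto
  have "x = inverse k *s y" using k by (simp add: vector_smult_assoc)
  then have "x \<in> vec.span {y}" by (auto simp: vec.span_singleton)
  moreover have "y \<in> vec.span {x}" using k by (auto simp: vec.span_singleton)
  ultimately show "vec.span {x} = vec.span {y}"
    by (intro vec.span_eq[THEN iffD2]) auto
qed

lemma continuous_on_vector_smult [continuous_intros]:
  fixes f :: "'a::topological_space \<Rightarrow> complex" and g :: "'a \<Rightarrow> complex ^ 'n"
  assumes "continuous_on S f" "continuous_on S g"
  shows "continuous_on S (\<lambda>x. f x *s g x)"
  unfolding vector_scalar_mult_def by (intro continuous_intros assms)

text \<open>The union of all lines meeting an open set \<open>U\<close> is, away from 0, the union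
  of the preimages of \<open>U\<close> under the scalings, each of them open.\<close>

lemma open_map_proj_space: "open_map nonzero_vecs proj_space (\<lambda>x :: complex ^ 'n. vec.span {x})"
  unfolding open_map_def
proof (intro allI impI)
  fix U :: "(complex ^ 'n) set"
  assume "openin nonzero_vecs U"
  then have U: "open U" "0 \<notin> U" by (auto simp: openin_open_eq open_Compl)
  have "{x. x \<noteq> 0 \<and> vec.span {x} \<in> (\<lambda>x. vec.span {x}) ` U} = (\<Union>k \<in> - {0}. (\<lambda>x. k *s x) -` U)"
  proof (intro Set.set_eqI iffI)
    fix x assume "x \<in> {x. x \<noteq> 0 \<and> vec.span {x} \<in> (\<lambda>x. vec.span {x}) ` U}"
    then show "x \<in> (\<Union>k \<in> - {0}. (\<lambda>x. k *s x) -` U)" by (auto simp: span_singleton_eq_iff)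
  next
    fix x assume "x \<in> (\<Union>k \<in> - {0}. (\<lambda>x. k *s x) -` U)"
    then obtain k where k: "k \<noteq> 0" "k *s x \<in> U" by auto
    then have x: "x \<noteq> 0" using U by auto
    have "vec.span {x} = vec.span {k *s x}" using k x span_singleton_eq_iff by blast
    then show "x \<in> {x. x \<noteq> 0 \<and> vec.span {x} \<in> (\<lambda>x. vec.span {x}) ` U}" using k x by auto
  qed
  moreover have "open (\<Union>k \<in> - {0}. (\<lambda>x. k *s x) -` U)"
    by (intro open_UN ballI open_vimage U) (intro continuous_intros)
  ultimately have "openin nonzero_vecs {x. x \<noteq> 0 \<and> vec.span {x} \<in> (\<lambda>x. vec.span {x}) ` U}"
    by (auto simp: openin_open_eq open_Compl)
  then show "openin proj_space ((\<lambda>x. vec.span {x}) ` U)"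
    using U unfolding openin_proj_space complex_lines_def by auto
qed

lemma complex_linesE:
  assumes "L \<in> topspace proj_space"
  obtains x where "x \<noteq> 0" "L = vec.span {x}"
  using assms by (auto simp: topspace_proj_space complex_lines_def)

lemma span_in_proj_space [simp]: "vec.span {x} \<in> topspace proj_space \<longleftrightarrow> x \<noteq> 0"
proof
  assume "vec.span {x} \<in> topspace proj_space"
  then obtain y where y: "y \<noteq> 0" "vec.span {x} = vec.span {y}" by (rule complex_linesE)
  then show "x \<noteq> 0" using span_singleton_eq_iff[OF y(1), of x] by auto
qed (auto simp: topspace_proj_space complex_lines_def)

lemma quotient_map_prod_proj_space:
  "quotient_map (prod_topology A (nonzero_vecs :: (complex ^ 'n) topology))
     (prod_topology A proj_space) (\<lambda>(a, x). (a, vec.span {x}))"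
proof (rule continuous_open_imp_quotient_map)
  show "continuous_map (prod_topology A (nonzero_vecs :: (complex ^ 'n) topology))
     (prod_topology A proj_space) (\<lambda>(a, x). (a, vec.span {x}))"
    using quotient_imp_continuous_map[OF quotient_map_proj_space[where 'n = 'n]]
    by (simp add: continuous_map_prod_top)
  show "open_map (prod_topology A (nonzero_vecs :: (complex ^ 'n) topology))
     (prod_topology A proj_space) (\<lambda>(a, x). (a, vec.span {x}))"
    using open_map_prod[OF open_map_id open_map_proj_space] by simp
  show "(\<lambda>(a, x :: complex ^ 'n). (a, vec.span {x})) ` topspace (prod_topology A nonzero_vecs) =
      topspace (prod_topology A proj_space)"
    by (force simp: topspace_proj_space complex_lines_def)
qed

section \<open>Sets of lines and maps of lines\<close>

definition lines_of :: "(complex ^ 'n) set \<Rightarrow> (complex ^ 'n) set set" where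
  "lines_of S = (\<lambda>x. vec.span {x}) ` (S - {0})"

definition scale_invariant :: "(complex ^ 'n) set \<Rightarrow> bool" where
  "scale_invariant S \<longleftrightarrow> (\<forall>x \<in> S. \<forall>k. k \<noteq> 0 \<longrightarrow> k *s x \<in> S)"

lemma span_in_lines_of:
  assumes "scale_invariant S"
  shows "vec.span {x} \<in> lines_of S \<longleftrightarrow> x \<noteq> 0 \<and> x \<in> S"
proof
  assume "vec.span {x} \<in> lines_of S"
  then obtain y where y: "y \<noteq> 0" "y \<in> S" "vec.span {y} = vec.span {x}" by (auto simp: lines_of_def)
  then obtain k where "k \<noteq> 0" "x = k *s y" using span_singleton_eq_iff by blast
  then show "x \<noteq> 0 \<and> x \<in> S" using y assms by (auto simp: scale_invariant_def)
qed (auto simp: lines_of_def)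

lemma openin_lines_of: "open S \<Longrightarrow> openin proj_space (lines_of S)"
  using open_map_proj_space unfolding open_map_def lines_of_def
  by (metis Diff_eq inf_commute open_openin openin_subtopology_Int2 subtopology_UNIV)

lemma lines_of_subset: "lines_of S \<subseteq> topspace proj_space"
  by (auto simp: lines_of_def)

definition line_map :: "(complex ^ 'n \<Rightarrow> complex ^ 'm) \<Rightarrow> (complex ^ 'n) set \<Rightarrow> (complex ^ 'm) set" where
  "line_map T L = vec.span (T ` L)"

text \<open>Weaker than linearity, so as to cover conjugation and maps that scale by the squared
  modulus of the factor, such as \<open>chart_rotation\<close>.\<close>

definition line_preserving :: "(complex ^ 'n \<Rightarrow> complex ^ 'm) \<Rightarrow> bool" where
  "line_preserving T \<longleftrightarrow> (\<forall>k x. T (k *s x) \<in> vec.span {T x})"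

lemma line_map_span:
  assumes "line_preserving T"
  shows "line_map T (vec.span {x}) = vec.span {T x}"
proof (rule antisym)
  show "line_map T (vec.span {x}) \<subseteq> vec.span {T x}"
    using assms unfolding line_map_def line_preserving_def
    by (intro vec.span_minimal vec.subspace_span) (auto simp: vec.span_singleton[of x])
  have "T x \<in> T ` vec.span {x}" by (simp add: vec.span_base)
  then show "vec.span {T x} \<subseteq> line_map T (vec.span {x})"
    unfolding line_map_def by (intro vec.span_mono) auto
qed

text \<open>The quotient map from nonzero vectors, multiplied by the identity of \<open>A\<close>,
  restricts to a quotient map over the open set \<open>Z\<close>; continuity can therefore be tested
  on vectors. Only vectors on lines of \<open>Z\<close> have to be kept away from 0.\<close>

lemma continuous_map_line_map:
  fixes T :: "'a \<Rightarrow> complex ^ 'n \<Rightarrow> complex ^ 'm"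
  assumes Z: "openin (prod_topology A proj_space) Z"
    and cont: "continuous_map (prod_topology A euclidean) euclidean (\<lambda>(a, x). T a x)"
    and T: "\<And>a. a \<in> topspace A \<Longrightarrow> line_preserving (T a)"
    and nz: "\<And>a x. \<lbrakk>a \<in> topspace A; x \<noteq> 0; (a, vec.span {x}) \<in> Z\<rbrakk> \<Longrightarrow> T a x \<noteq> 0"
  shows "continuous_map (subtopology (prod_topology A proj_space) Z) proj_space (\<lambda>(a, L). line_map (T a) L)"
proof -
  define Z' where "Z' = {z \<in> topspace (prod_topology A (nonzero_vecs :: (complex ^ 'n) topology)).
      (\<lambda>(a, x). (a, vec.span {x})) z \<in> Z}"
  have q: "quotient_map (subtopology (prod_topology A (nonzero_vecs :: (complex ^ 'n) topology)) Z')
      (subtopology (prod_topology A proj_space) Z) (\<lambda>(a, x). (a, vec.span {x}))"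
    using Z by (intro quotient_map_restriction quotient_map_prod_proj_space) (auto simp: Z'_def)
  have "continuous_map (subtopology (prod_topology A (nonzero_vecs :: (complex ^ 'n) topology)) Z')
      nonzero_vecs (\<lambda>(a, x). T a x)"
    unfolding continuous_map_in_subtopology
  proof
    show "continuous_map (subtopology (prod_topology A (nonzero_vecs :: (complex ^ 'n) topology)) Z')
      euclidean (\<lambda>(a, x). T a x)"
      using cont by (simp add: prod_topology_subtopology subtopology_subtopology continuous_map_from_subtopology)
  qed (use nz in \<open>auto simp: Z'_def\<close>)
  then have "continuous_map (subtopology (prod_topology A (nonzero_vecs :: (complex ^ 'n) topology)) Z')
      proj_space ((\<lambda>x. vec.span {x}) \<circ> (\<lambda>(a, x). T a x))"
    by (rule continuous_map_compose) (rule quotient_imp_continuous_map[OF quotient_map_proj_space])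
  then have "continuous_map (subtopology (prod_topology A (nonzero_vecs :: (complex ^ 'n) topology)) Z')
      proj_space ((\<lambda>(a, L). line_map (T a) L) \<circ> (\<lambda>(a, x). (a, vec.span {x})))"
    by (rule continuous_map_eq) (use T in \<open>auto simp: line_map_span\<close>)
  then show ?thesis using continuous_compose_quotient_map_eq[OF q] by blast
qed

lemma continuous_map_line_map_single:
  fixes T :: "complex ^ 'n \<Rightarrow> complex ^ 'm"
  assumes Z: "openin proj_space Z" and cont: "continuous_on UNIV T" and T: "line_preserving T"
    and nz: "\<And>x. \<lbrakk>x \<noteq> 0; vec.span {x} \<in> Z\<rbrakk> \<Longrightarrow> T x \<noteq> 0"
  shows "continuous_map (subtopology proj_space Z) proj_space (line_map T)"
proof -
  have "continuous_map (subtopology (prod_topology (discrete_topology {()}) proj_space) ({()} \<times> Z))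
      proj_space (\<lambda>(a, L). line_map T L)"
    using assms
    by (intro continuous_map_line_map)
      (auto simp: openin_prod_Times_iff case_prod_unfold intro!: continuous_map_compose[OF continuous_map_snd, unfolded o_def])
  then have c: "continuous_map (prod_topology (discrete_topology {()}) (subtopology proj_space Z)) proj_space (line_map T \<circ> snd)"
    by (simp add: subtopology_Times o_def case_prod_unfold)
  have "continuous_map (subtopology proj_space Z) (prod_topology (discrete_topology {()}) (subtopology proj_space Z)) (\<lambda>L. ((), L))"
    by (intro continuous_map_pairedI) auto
  from continuous_map_compose[OF this c] show ?thesis by (simp add: o_def)
qed

section \<open>Exactness, excision and homotopies\<close>

lemma openin_Diff_closure_subset:
  assumes "openin X U" "openin X V" "topspace X \<subseteq> U \<union> V"
  shows "X closure_of (topspace X - V) \<subseteq> X interior_of U"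
proof -
  have "closedin X (topspace X - V)" using assms by blast
  moreover have "topspace X - V \<subseteq> U" using assms by blast
  ultimately show ?thesis using assms by (simp add: closure_of_closedin interior_of_openin)
qed

text \<open>What is excised is the complement of \<open>V\<close> in the union: a closed set
  contained in the open set \<open>U\<close>.\<close>

lemma homology_excision_open_Un:
  assumes U: "openin X U" and V: "openin X V"
  shows "hom_induced p (subtopology X V) (U \<inter> V) (subtopology X (U \<union> V)) U id
    \<in> iso (relative_homology_group p (subtopology X V) (U \<inter> V))
          (relative_homology_group p (subtopology X (U \<union> V)) U)"
proof -
  define Y where "Y = subtopology X (U \<union> V)"
  have sub: "U \<subseteq> topspace X" "V \<subseteq> topspace X" using U V openin_subset by auto
  have top: "topspace Y = U \<union> V" using sub by (auto simp: Y_def)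
  have UV: "openin Y U" "openin Y V" using U V unfolding Y_def by (auto simp: openin_subtopology_alt)
  have "hom_induced p (subtopology Y (topspace Y - (topspace Y - V))) (U - (topspace Y - V))
      (subtopology Y (topspace Y)) U id
    \<in> iso (relative_homology_group p (subtopology Y (topspace Y - (topspace Y - V))) (U - (topspace Y - V)))
          (relative_homology_group p (subtopology Y (topspace Y)) U)"
    using UV top by (intro homology_excision_axiom openin_Diff_closure_subset) auto
  moreover have "topspace Y - (topspace Y - V) = V" "U - (topspace Y - V) = U \<inter> V" using top by auto
  moreover have "subtopology Y V = subtopology X V" by (simp add: Y_def subtopology_subtopology Int_absorb1)
  ultimately show ?thesis by (simp add: subtopology_topspace flip: Y_def)
qed

lemma exact_triple:
  assumes "T \<subseteq> S"
  shows exact_triple_mid: "kernel (relative_homology_group p X T) (relative_homology_group p X S) (hom_induced p X T X S id)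
      = hom_induced p (subtopology X S) T X T id ` carrier (relative_homology_group p (subtopology X S) T)"
    and exact_triple_rel: "kernel (relative_homology_group p X S) (relative_homology_group (p - 1) (subtopology X S) T) (hom_relboundary p X S T)
      = hom_induced p X T X S id ` carrier (relative_homology_group p X T)"
    and exact_triple_sub: "kernel (relative_homology_group (p - 1) (subtopology X S) T) (relative_homology_group (p - 1) X T)
          (hom_induced (p - 1) (subtopology X S) T X T id)
      = hom_relboundary p X S T ` carrier (relative_homology_group p X S)"
  using homology_exactness_triple_1[OF assms, of p X] homology_exactness_triple_2[OF assms, of p X]
    homology_exactness_triple_3[OF assms, of p X] by simp_all

lemma group_hom_induced: "group_hom (relative_homology_group p X S) (relative_homology_group p Y T) (hom_induced p X S Y T f)"
  by (simp add: group_hom_def group_hom_axioms_def hom_induced_hom)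

lemma group_hom_relboundary:
  "group_hom (relative_homology_group p X S) (relative_homology_group (p - 1) (subtopology X S) T) (hom_relboundary p X S T)"
  by (simp add: group_hom_def group_hom_axioms_def group_homomorphism_hom_relboundary)

lemma (in group_hom) iso_if_kernel_trivial:
  assumes "h ` carrier G = carrier H" "kernel G H h = {\<one>}"
  shows "h \<in> iso G H"
proof -
  have "x = \<one>" if "x \<in> carrier G" "h x = \<one>\<^bsub>H\<^esub>" for x
  proof -
    have "x \<in> kernel G H h" using that by (simp add: kernel_def)
    then show ?thesis using assms(2) by simp
  qed
  then show ?thesis using assms(1) by (simp add: iso_iff)
qed

text \<open>In the exact sequence of the triple \<open>X\<close>, \<open>S\<close>,
  \<open>T\<close>, the map in question stands between groups of the pair \<open>(S, T)\<close>, in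
  degrees \<open>p\<close> and \<open>p - 1\<close>.\<close>

lemma iso_if_trivial_sub_pair:
  assumes TS: "T \<subseteq> S" and triv: "\<And>p. trivial_group (relative_homology_group p (subtopology X S) T)"
  shows "hom_induced p X T X S id \<in> iso (relative_homology_group p X T) (relative_homology_group p X S)"
proof -
  have one: "carrier (relative_homology_group p (subtopology X S) T) = {\<one>\<^bsub>relative_homology_group p (subtopology X S) T\<^esub>}" for p
    using triv by (simp add: trivial_group_def)
  have "carrier (relative_homology_group p X S) \<subseteq>
      kernel (relative_homology_group p X S) (relative_homology_group (p - 1) (subtopology X S) T) (hom_relboundary p X S T)"
    using one[of "p - 1"] hom_relboundary[of p X S T] unfolding kernel_def by blast
  then have "carrier (relative_homology_group p X S) \<subseteq> hom_induced p X T X S id ` carrier (relative_homology_group p X T)"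
    unfolding exact_triple_rel[OF TS] .
  then have "hom_induced p X T X S id ` carrier (relative_homology_group p X T) = carrier (relative_homology_group p X S)"
    by (intro antisym) (auto simp: hom_induced_carrier)
  moreover have "kernel (relative_homology_group p X T) (relative_homology_group p X S) (hom_induced p X T X S id)
      = {\<one>\<^bsub>relative_homology_group p X T\<^esub>}"
    unfolding exact_triple_mid[OF TS] one by (simp add: group_hom.hom_one[OF group_hom_induced])
  ultimately show ?thesis by (rule group_hom.iso_if_kernel_trivial[OF group_hom_induced])
qed

text \<open>In the same triple sequence, the boundary map stands between groups of
  \<open>(X, T)\<close>.\<close>

lemma iso_relboundary_if_trivial_pair:
  assumes TS: "T \<subseteq> S" and triv: "\<And>p. trivial_group (relative_homology_group p X T)"
  shows "hom_relboundary p X S T \<in> iso (relative_homology_group p X S) (relative_homology_group (p - 1) (subtopology X S) T)"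
proof -
  have one: "carrier (relative_homology_group p X T) = {\<one>\<^bsub>relative_homology_group p X T\<^esub>}" for p
    using triv by (simp add: trivial_group_def)
  have "carrier (relative_homology_group (p - 1) (subtopology X S) T) \<subseteq>
      kernel (relative_homology_group (p - 1) (subtopology X S) T) (relative_homology_group (p - 1) X T)
          (hom_induced (p - 1) (subtopology X S) T X T id)"
    using one[of "p - 1"] hom_induced_carrier[of "p - 1" "subtopology X S" T X T id] unfolding kernel_def by blast
  then have "carrier (relative_homology_group (p - 1) (subtopology X S) T) \<subseteq> hom_relboundary p X S T ` carrier (relative_homology_group p X S)"
    unfolding exact_triple_sub[OF TS] .
  then have "hom_relboundary p X S T ` carrier (relative_homology_group p X S) = carrier (relative_homology_group (p - 1) (subtopology X S) T)"
    by (intro antisym) (auto simp: hom_relboundary)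
  moreover have "kernel (relative_homology_group p X S) (relative_homology_group (p - 1) (subtopology X S) T) (hom_relboundary p X S T)
      = {\<one>\<^bsub>relative_homology_group p X S\<^esub>}"
    unfolding exact_triple_rel[OF TS] one by (simp add: group_hom.hom_one[OF group_hom_induced])
  ultimately show ?thesis by (rule group_hom.iso_if_kernel_trivial[OF group_hom_relboundary])
qed

lemma homotopic_with_subtopologies:
  assumes "homotopic_with (\<lambda>h. h \<in> S \<rightarrow> T) X Y f g"
  shows "homotopic_with (\<lambda>h. True) (subtopology X S) (subtopology Y T) f g"
proof -
  obtain h where h: "continuous_map (prod_topology (top_of_set {0..1::real}) X) Y h"
    "\<And>x. h (0, x) = f x" "\<And>x. h (1, x) = g x" "\<And>t. t \<in> {0..1} \<Longrightarrow> (\<lambda>x. h (t, x)) \<in> S \<rightarrow> T"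
    using assms unfolding homotopic_with_def by auto
  have "continuous_map (prod_topology (top_of_set {0..1::real}) (subtopology X S)) (subtopology Y T) h"
    unfolding prod_topology_subtopology(2) continuous_map_in_subtopology
  proof
    show "continuous_map (subtopology (prod_topology (top_of_set {0..1}) X) (topspace (top_of_set {0..1::real}) \<times> S)) Y h"
      using h(1) by (rule continuous_map_from_subtopology)
    have "h (t, x) \<in> T" if "t \<in> {0..1}" "x \<in> S" for t x using h(4)[OF that(1)] that(2) by auto
    then show "h \<in> topspace (subtopology (prod_topology (top_of_set {0..1}) X) (topspace (top_of_set {0..1::real}) \<times> S)) \<rightarrow> T"
      by auto
  qed
  then show ?thesis using h unfolding homotopic_with_def by auto
qed

text \<open>The homotopy carries \<open>S\<close> into itself at all times, so it restricts to
  \<open>S\<close> and makes \<open>f\<close> a homotopy inverse of the inclusion of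
  \<open>S\<close>.\<close>

lemma trivial_relative_homology_group_deformation:
  assumes h: "homotopic_with (\<lambda>h. h \<in> S \<rightarrow> S) X X f id" and f: "f ` topspace X \<subseteq> S"
  shows "trivial_group (relative_homology_group p X S)"
proof (rule trivial_relative_homology_group_gen)
  show "continuous_map X (subtopology X S) f"
    using homotopic_with_imp_continuous_maps[OF h] f by (auto simp: continuous_map_in_subtopology)
  show "homotopic_with (\<lambda>h. True) (subtopology X S) (subtopology X S) f id"
    by (rule homotopic_with_subtopologies[OF h])
  show "homotopic_with (\<lambda>k. True) X X f id" using h by (rule homotopic_with_mono) simp
qed

section \<open>Products of the base with sets of lines\<close>

abbreviation cyl :: "'w topology \<Rightarrow> (complex ^ 'n) set set \<Rightarrow> ('w \<times> (complex ^ 'n) set) topology" where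
  "cyl W Z \<equiv> prod_topology W (subtopology proj_space Z)"

lemma subtopology_cyl:
  "subtopology (cyl W Z) (topspace W \<times> A) = cyl W (Z \<inter> A)"
  by (simp add: prod_topology_subtopology subtopology_subtopology Times_Int_Times)

text \<open>Homotopies are written down on vectors. The dependence on \<open>w\<close> is there for
  the later homotopy from a fixed coordinate plane to orthogonal complements that vary with the base
  point; \<open>continuous_map_line_map\<close> is applied with [0,1] x \<open>W\<close> as its
  parameter space.\<close>

lemma homotopic_line_maps:
  fixes T :: "real \<Rightarrow> 'w \<Rightarrow> complex ^ 'n \<Rightarrow> complex ^ 'm"
  assumes Z: "openin proj_space Z" and A: "A \<subseteq> Z"
    and cont: "continuous_map (prod_topology (prod_topology (top_of_set {0..1}) W) euclidean) euclidean
      (\<lambda>((t, w), x). T t w x)"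
    and lp: "\<And>t w. \<lbrakk>0 \<le> t; t \<le> 1; w \<in> topspace W\<rbrakk> \<Longrightarrow> line_preserving (T t w)"
    and Z': "\<And>t w x. \<lbrakk>0 \<le> t; t \<le> 1; w \<in> topspace W; x \<noteq> 0; vec.span {x} \<in> Z\<rbrakk> \<Longrightarrow>
      T t w x \<noteq> 0 \<and> vec.span {T t w x} \<in> Z'"
    and B: "\<And>t w x. \<lbrakk>0 \<le> t; t \<le> 1; w \<in> topspace W; x \<noteq> 0; vec.span {x} \<in> A\<rbrakk> \<Longrightarrow> vec.span {T t w x} \<in> B"
  shows "homotopic_with (\<lambda>h. h \<in> topspace W \<times> A \<rightarrow> topspace W \<times> B) (cyl W Z) (cyl W Z')
     (\<lambda>(w, L). (w, line_map (T 0 w) L)) (\<lambda>(w, L). (w, line_map (T 1 w) L))"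
  unfolding homotopic_with_def
proof (intro exI conjI allI ballI)
  let ?I = "top_of_set {0..1::real}"
  let ?h = "\<lambda>(t :: real, (w, L)). (w, line_map (T t w) L)"
  have ex: "\<exists>x. x \<noteq> 0 \<and> L = vec.span {x}" if "L \<in> Z" for L
    using openin_subset[OF Z] that complex_linesE by (metis subsetD)
  have "continuous_map (subtopology (prod_topology (prod_topology ?I W) proj_space) (topspace (prod_topology ?I W) \<times> Z))
      proj_space (\<lambda>(a, L). line_map ((\<lambda>(t, w). T t w) a) L)"
    using cont lp Z' Z by (intro continuous_map_line_map) (auto simp: openin_prod_Times_iff case_prod_unfold)
  then have 1: "continuous_map (prod_topology (prod_topology ?I W) (subtopology proj_space Z))
      proj_space (\<lambda>((t, w), L). line_map (T t w) L)"
    by (simp add: prod_topology_subtopology(2) case_prod_unfold)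
  have 2: "continuous_map (prod_topology ?I (cyl W Z)) (prod_topology (prod_topology ?I W) (subtopology proj_space Z))
      (\<lambda>(t, (w, L)). ((t, w), L))"
    unfolding case_prod_unfold
    by (intro continuous_map_pairedI continuous_map_fst continuous_map_snd continuous_map_fst_of continuous_map_snd_of
        continuous_map_compose[OF continuous_map_snd, unfolded o_def])
  have 3: "continuous_map (prod_topology ?I (cyl W Z)) proj_space (\<lambda>(t :: real, (w, L)). line_map (T t w) L)"
    using continuous_map_compose[OF 2 1] by (simp add: o_def case_prod_unfold)
  have 4: "continuous_map (prod_topology ?I (cyl W Z)) (subtopology proj_space Z') (\<lambda>(t :: real, (w, L)). line_map (T t w) L)"
    unfolding continuous_map_in_subtopology
  proof (intro conjI 3 subsetI, clarsimp)
    fix t :: real and w L assume "0 \<le> t" "t \<le> 1" "w \<in> topspace W" "L \<in> Z"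
    with ex Z' lp show "line_map (T t w) L \<in> Z'" by (metis line_map_span)
  qed
  show "continuous_map (prod_topology ?I (cyl W Z)) (cyl W Z') ?h"
    using 4 unfolding case_prod_unfold
    by (intro continuous_map_pairedI)
      (auto intro!: continuous_map_compose[OF continuous_map_snd continuous_map_fst, unfolded o_def])
  fix t :: real assume t: "t \<in> {0..1}"
  show "(\<lambda>x. ?h (t, x)) \<in> topspace W \<times> A \<rightarrow> topspace W \<times> B"
  proof clarsimp
    fix w L assume w: "w \<in> topspace W" and "L \<in> A"
    with ex A obtain x where "x \<noteq> 0" "L = vec.span {x}" by blast
    then show "line_map (T t w) L \<in> B" using B[of t w x] lp[of t w] t w \<open>L \<in> A\<close> by (auto simp: line_map_span)
  qed
qed auto

text \<open>An equivalence rather than an implication, because the zigzag of isomorphisms along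
  which the sign is carried runs in both directions.\<close>

lemma inv_action_iso:
  assumes "group G" "group H" and \<phi>: "\<phi> \<in> iso G H"
    and s: "\<And>c. c \<in> carrier G \<Longrightarrow> s c \<in> carrier G"
    and comm: "\<And>c. c \<in> carrier G \<Longrightarrow> \<phi> (s c) = t (\<phi> c)"
  shows "(\<forall>c \<in> carrier G. s c = inv\<^bsub>G\<^esub> c) \<longleftrightarrow> (\<forall>d \<in> carrier H. t d = inv\<^bsub>H\<^esub> d)"
proof -
  interpret group_hom G H \<phi>
    using assms by (simp add: group_hom_def group_hom_axioms_def iso_def)
  have im: "carrier H = \<phi> ` carrier G" and inj: "inj_on \<phi> (carrier G)"
    using \<phi> by (auto simp: iso_def bij_betw_def)
  have "(\<forall>d \<in> carrier H. t d = inv\<^bsub>H\<^esub> d) \<longleftrightarrow> (\<forall>c \<in> carrier G. \<phi> (s c) = \<phi> (inv\<^bsub>G\<^esub> c))"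
    unfolding im using comm by auto
  also have "\<dots> \<longleftrightarrow> (\<forall>c \<in> carrier G. s c = inv\<^bsub>G\<^esub> c)"
    by (intro ball_cong refl inj_on_eq_iff[OF inj] s G.inv_closed)
  finally show ?thesis by simp
qed

lemma cyl_excision:
  assumes "openin proj_space U" "openin proj_space V"
  shows "hom_induced p (cyl W V) (topspace W \<times> (U \<inter> V)) (cyl W (U \<union> V)) (topspace W \<times> U) id
    \<in> iso (relative_homology_group p (cyl W V) (topspace W \<times> (U \<inter> V)))
          (relative_homology_group p (cyl W (U \<union> V)) (topspace W \<times> U))"
proof -
  have "openin (prod_topology W proj_space) (topspace W \<times> U)" "openin (prod_topology W proj_space) (topspace W \<times> V)"
    using assms by (auto simp: openin_prod_Times_iff)
  from homology_excision_open_Un[OF this] show ?thesis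
    by (simp add: prod_topology_subtopology(2) Times_Int_Times flip: Sigma_Un_distrib2)
qed

lemma cyl_iso_if_trivial_sub_pair:
  assumes "B \<subseteq> A" "A \<subseteq> Z" and "\<And>p. trivial_group (relative_homology_group p (cyl W A) (topspace W \<times> B))"
  shows "hom_induced p (cyl W Z) (topspace W \<times> B) (cyl W Z) (topspace W \<times> A) id
    \<in> iso (relative_homology_group p (cyl W Z) (topspace W \<times> B)) (relative_homology_group p (cyl W Z) (topspace W \<times> A))"
  using assms by (intro iso_if_trivial_sub_pair) (auto simp: subtopology_cyl Int_absorb1)

lemma cyl_iso_relboundary_if_trivial_pair:
  assumes "B \<subseteq> A" "A \<subseteq> Z" and "\<And>p. trivial_group (relative_homology_group p (cyl W Z) (topspace W \<times> B))"
  shows "hom_relboundary p (cyl W Z) (topspace W \<times> A) (topspace W \<times> B)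
    \<in> iso (relative_homology_group p (cyl W Z) (topspace W \<times> A)) (relative_homology_group (p - 1) (cyl W A) (topspace W \<times> B))"
  using iso_relboundary_if_trivial_pair[of "topspace W \<times> B" "topspace W \<times> A" "cyl W Z" p] assms
  by (auto simp: subtopology_cyl Int_absorb1)

lemma continuous_map_snd_proj:
  fixes T :: "real \<Rightarrow> complex ^ 'n \<Rightarrow> complex ^ 'm"
  assumes "continuous_on ({0..1} \<times> UNIV) (\<lambda>(t, x). T t x)"
  shows "continuous_map (prod_topology (prod_topology (top_of_set {0..1}) W) euclidean) euclidean
      (\<lambda>((t, w), x). T t x)"
proof -
  have "prod_topology (top_of_set {0..1::real}) (euclidean :: (complex ^ 'n) topology) = top_of_set ({0..1} \<times> UNIV)"
    by (metis prod_topology_subtopology_eu subtopology_UNIV)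
  then have "continuous_map (prod_topology (top_of_set {0..1}) euclidean) euclidean (\<lambda>(t, x). T t x)"
    using assms by simp
  moreover have "continuous_map (prod_topology (prod_topology (top_of_set {0..1::real}) W) euclidean)
      (prod_topology (top_of_set {0..1}) (euclidean :: (complex ^ 'n) topology)) (\<lambda>z. (fst (fst z), snd z))"
    by (intro continuous_map_pairedI continuous_map_snd
        continuous_map_compose[OF continuous_map_fst continuous_map_fst, unfolded o_def])
  ultimately have "continuous_map (prod_topology (prod_topology (top_of_set {0..1::real}) W) euclidean) euclidean
      ((\<lambda>(t, x). T t x) \<circ> (\<lambda>z. (fst (fst z), snd z)))"
    by (rule continuous_map_compose[rotated])
  then show ?thesis by (simp add: o_def case_prod_unfold)
qed

lemma homotopic_line_maps_id:
  fixes T :: "real \<Rightarrow> complex ^ 'n \<Rightarrow> complex ^ 'n"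
  assumes Z: "openin proj_space Z" and A: "A \<subseteq> Z"
    and cont: "continuous_on ({0..1} \<times> UNIV) (\<lambda>(t, x). T t x)"
    and lp: "\<And>t. \<lbrakk>0 \<le> t; t \<le> 1\<rbrakk> \<Longrightarrow> line_preserving (T t)"
    and TZ: "\<And>t x. \<lbrakk>0 \<le> t; t \<le> 1; x \<noteq> 0; vec.span {x} \<in> Z\<rbrakk> \<Longrightarrow> T t x \<noteq> 0 \<and> vec.span {T t x} \<in> Z"
    and TA: "\<And>t x. \<lbrakk>0 \<le> t; t \<le> 1; x \<noteq> 0; vec.span {x} \<in> A\<rbrakk> \<Longrightarrow> vec.span {T t x} \<in> A"
    and T1: "\<And>x. T 1 x = x"
  shows "homotopic_with (\<lambda>h. h \<in> topspace W \<times> A \<rightarrow> topspace W \<times> A) (cyl W Z) (cyl W Z)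
      (\<lambda>(w, L). (w, line_map (T 0) L)) id"
proof -
  have "homotopic_with (\<lambda>h. h \<in> topspace W \<times> A \<rightarrow> topspace W \<times> A) (cyl W Z) (cyl W Z)
      (\<lambda>(w, L). (w, line_map (T 0) L)) (\<lambda>(w, L). (w, line_map (T 1) L))"
    using assms by (intro homotopic_line_maps continuous_map_snd_proj) auto
  then show ?thesis
  proof (rule homotopic_with_eq)
    fix z assume "z \<in> topspace (cyl W Z)"
    then obtain w L where z: "z = (w, L)" "L \<in> topspace proj_space" by auto
    then obtain x where "L = vec.span {x}" using complex_linesE by blast
    then show "id z = (case z of (w, L) \<Rightarrow> (w, line_map (T 1) L))"
      using lp[of 1] z by (simp add: line_map_span T1)
  next
    fix h k :: "'a \<times> (complex ^ 'n) set \<Rightarrow> 'a \<times> (complex ^ 'n) set"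
    assume hk: "\<And>x. x \<in> topspace (cyl W Z) \<Longrightarrow> h x = k x"
    have "topspace W \<times> A \<subseteq> topspace (cyl W Z)" using A openin_subset[OF Z] by auto
    then show "(h \<in> topspace W \<times> A \<rightarrow> topspace W \<times> A) = (k \<in> topspace W \<times> A \<rightarrow> topspace W \<times> A)"
      using hk by (auto simp: Pi_iff subset_iff)
  qed auto
qed

lemma trivial_cyl_pair:
  fixes T :: "real \<Rightarrow> complex ^ 'n \<Rightarrow> complex ^ 'n"
  assumes Z: "openin proj_space Z" and A: "A \<subseteq> Z"
    and cont: "continuous_on ({0..1} \<times> UNIV) (\<lambda>(t, x). T t x)"
    and lp: "\<And>t. \<lbrakk>0 \<le> t; t \<le> 1\<rbrakk> \<Longrightarrow> line_preserving (T t)"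
    and TZ: "\<And>t x. \<lbrakk>0 \<le> t; t \<le> 1; x \<noteq> 0; vec.span {x} \<in> Z\<rbrakk> \<Longrightarrow> T t x \<noteq> 0 \<and> vec.span {T t x} \<in> Z"
    and TA: "\<And>t x. \<lbrakk>0 \<le> t; t \<le> 1; x \<noteq> 0; vec.span {x} \<in> A\<rbrakk> \<Longrightarrow> vec.span {T t x} \<in> A"
    and T1: "\<And>x. T 1 x = x"
    and T0: "\<And>x. \<lbrakk>x \<noteq> 0; vec.span {x} \<in> Z\<rbrakk> \<Longrightarrow> vec.span {T 0 x} \<in> A"
  shows "trivial_group (relative_homology_group p (cyl W Z) (topspace W \<times> A))"
proof (rule trivial_relative_homology_group_deformation)
  show "homotopic_with (\<lambda>h. h \<in> topspace W \<times> A \<rightarrow> topspace W \<times> A) (cyl W Z) (cyl W Z)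
      (\<lambda>(w, L). (w, line_map (T 0) L)) id"
    by (rule homotopic_line_maps_id[OF Z A cont lp TZ TA T1])
  show "(\<lambda>(w, L). (w, line_map (T 0) L)) ` topspace (cyl W Z) \<subseteq> topspace W \<times> A"
  proof clarsimp
    fix w L assume L: "L \<in> topspace proj_space" "L \<in> Z"
    then obtain x where "x \<noteq> 0" "L = vec.span {x}" using complex_linesE by blast
    then show "line_map (T 0) L \<in> A" using L T0 lp[of 0] by (auto simp: line_map_span)
  qed
qed

text \<open>A fibrewise contraction of \<open>Z\<close> to \<open>L0\<close> makes the constant
  section a homotopy inverse of \<open>fst\<close>.\<close>

lemma iso_fst_cyl:
  fixes T :: "real \<Rightarrow> complex ^ 'n \<Rightarrow> complex ^ 'n"
  assumes Z: "openin proj_space Z" and L0: "L0 \<in> Z"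
    and cont: "continuous_on ({0..1} \<times> UNIV) (\<lambda>(t, x). T t x)"
    and lp: "\<And>t. \<lbrakk>0 \<le> t; t \<le> 1\<rbrakk> \<Longrightarrow> line_preserving (T t)"
    and TZ: "\<And>t x. \<lbrakk>0 \<le> t; t \<le> 1; x \<noteq> 0; vec.span {x} \<in> Z\<rbrakk> \<Longrightarrow> T t x \<noteq> 0 \<and> vec.span {T t x} \<in> Z"
    and T1: "\<And>x. T 1 x = x"
    and T0: "\<And>x. \<lbrakk>x \<noteq> 0; vec.span {x} \<in> Z\<rbrakk> \<Longrightarrow> vec.span {T 0 x} = L0"
  shows "group_isomorphisms (homology_group p (cyl W Z)) (homology_group p W)
    (hom_induced p (cyl W Z) {} W {} fst) (hom_induced p W {} (cyl W Z) {} (\<lambda>w. (w, L0)))"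
proof (rule homotopy_equivalence_relative_homology_group_isomorphisms)
  have "L0 \<in> topspace proj_space" using L0 openin_subset[OF Z] by blast
  then show "continuous_map W (cyl W Z) (\<lambda>w. (w, L0))"
    using L0 by (intro continuous_map_pairedI) auto
  have "homotopic_with (\<lambda>h. h \<in> topspace W \<times> {} \<rightarrow> topspace W \<times> {}) (cyl W Z) (cyl W Z)
      (\<lambda>(w, L). (w, line_map (T 0) L)) id"
    by (rule homotopic_line_maps_id[OF Z empty_subsetI cont lp TZ _ T1]) auto
  then show "homotopic_with (\<lambda>h. h \<in> {} \<rightarrow> {}) (cyl W Z) (cyl W Z) ((\<lambda>w. (w, L0)) \<circ> fst) id"
    unfolding Sigma_empty2
  proof (rule homotopic_with_eq)
    fix z assume "z \<in> topspace (cyl W Z)"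
    then obtain w L where z: "z = (w, L)" "L \<in> topspace proj_space" "L \<in> Z" by auto
    then obtain x where "x \<noteq> 0" "L = vec.span {x}" using complex_linesE by blast
    then show "((\<lambda>w. (w, L0)) \<circ> fst) z = (case z of (w, L) \<Rightarrow> (w, line_map (T 0) L))"
      using lp[of 0] z T0 by (simp add: line_map_span)
  qed auto
  show "homotopic_with (\<lambda>k. k \<in> {} \<rightarrow> {}) W W (fst \<circ> (\<lambda>w. (w, L0))) id"
    by (simp add: o_def id_def[symmetric])
qed (auto simp: continuous_map_fst)

section \<open>The product with the projective line\<close>

lemma lines_of_Int:
  assumes "scale_invariant S" "scale_invariant S'"
  shows "lines_of S \<inter> lines_of S' = lines_of (S \<inter> S')"
proof -
  have "scale_invariant (S \<inter> S')" using assms by (auto simp: scale_invariant_def)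
  have "L \<in> lines_of (S \<inter> S')" if "L \<in> lines_of S" "L \<in> lines_of S'" for L
  proof -
    obtain x where "L = vec.span {x}" using \<open>L \<in> lines_of S\<close> by (auto simp: lines_of_def)
    then show ?thesis using that assms \<open>scale_invariant (S \<inter> S')\<close> by (simp add: span_in_lines_of)
  qed
  then show ?thesis by (auto simp: lines_of_def)
qed

lemma lines_of_Un: "lines_of S \<union> lines_of S' = lines_of (S \<union> S')"
  by (auto simp: lines_of_def)

definition conj_vec :: "complex ^ 'n \<Rightarrow> complex ^ 'n" where
  "conj_vec x = (\<chi> i. cnj (x $ i))"

lemma conj_vec_nth [simp]: "conj_vec x $ i = cnj (x $ i)"
  by (simp add: conj_vec_def)

lemma conj_vec_eq_0_iff [simp]: "conj_vec x = 0 \<longleftrightarrow> x = 0"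
  by (simp add: vec_eq_iff)

lemma line_preserving_conj_vec: "line_preserving conj_vec"
  unfolding line_preserving_def vec.span_singleton
proof (intro allI)
  fix k :: complex and x :: "complex ^ 'n"
  have "conj_vec (k *s x) = cnj k *s conj_vec x" by (simp add: vec_eq_iff)
  then show "conj_vec (k *s x) \<in> range (\<lambda>k. k *s conj_vec x)" by (rule range_eqI)
qed

lemma continuous_on_conj_vec: "continuous_on S conj_vec"
  unfolding conj_vec_def by (intro continuous_intros)

abbreviation conj_line :: "(complex ^ 'n) set \<Rightarrow> (complex ^ 'n) set" where
  "conj_line \<equiv> line_map conj_vec"

lemma conj_line_span: "conj_line (vec.span {x}) = vec.span {conj_vec x}"
  by (rule line_map_span[OF line_preserving_conj_vec])

lemma continuous_map_conj_line: "continuous_map proj_space proj_space conj_line"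
  using continuous_map_line_map_single[OF openin_topspace continuous_on_conj_vec line_preserving_conj_vec]
  by simp

abbreviation conj_cyl :: "'w \<times> (complex ^ 'n) set \<Rightarrow> 'w \<times> (complex ^ 'n) set" where
  "conj_cyl \<equiv> (\<lambda>(w, L). (w, conj_line L))"

lemma continuous_map_conj_cyl:
  assumes "\<And>L. L \<in> Z \<Longrightarrow> conj_line L \<in> Z'"
  shows "continuous_map (cyl W Z) (cyl W Z') conj_cyl"
  unfolding case_prod_unfold
proof (intro continuous_map_pairedI continuous_map_fst)
  have "continuous_map (subtopology proj_space Z) (subtopology proj_space Z') conj_line"
    using assms by (auto simp: continuous_map_in_subtopology intro: continuous_map_from_subtopology continuous_map_conj_line)
  then show "continuous_map (cyl W Z) (subtopology proj_space Z') (\<lambda>x. conj_line (snd x))"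
    using continuous_map_compose[OF continuous_map_snd] by (fastforce simp: o_def)
qed

text \<open>The cone of lines in the affine chart whose coordinate \<open>y\<^sub>2 / y\<^sub>1\<close> lies in a set invariant
  under positive scaling; multiplying by \<open>\<bar>y\<^sub>1\<bar>\<^sup>2\<close> avoids the division.\<close>

definition chart_form :: "complex ^ 2 \<Rightarrow> complex" where
  "chart_form y = y $ 2 * cnj (y $ 1)"

definition cone_lines :: "complex set \<Rightarrow> (complex ^ 2) set set" where
  "cone_lines K = lines_of (chart_form -` K)"

definition positive_cone :: "complex set \<Rightarrow> bool" where
  "positive_cone K \<longleftrightarrow> (\<forall>z \<in> K. \<forall>r>0. complex_of_real r * z \<in> K)"

lemma chart_form_scale: "chart_form (k *s y) = complex_of_real ((cmod k)\<^sup>2) * chart_form y"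
  unfolding complex_norm_square by (simp add: chart_form_def algebra_simps)

lemma chart_form_conj: "chart_form (conj_vec y) = cnj (chart_form y)"
  by (simp add: chart_form_def)

lemma scale_invariant_chart_form: "positive_cone K \<Longrightarrow> scale_invariant (chart_form -` K)"
  by (auto simp: scale_invariant_def positive_cone_def chart_form_scale simp del: of_real_power)

lemma span_in_cone_lines:
  "positive_cone K \<Longrightarrow> vec.span {y} \<in> cone_lines K \<longleftrightarrow> y \<noteq> 0 \<and> chart_form y \<in> K"
  unfolding cone_lines_def by (subst span_in_lines_of) (auto intro: scale_invariant_chart_form)

lemma continuous_on_chart_form: "continuous_on S chart_form"
  unfolding chart_form_def by (intro continuous_intros)

lemma openin_cone_lines: "open K \<Longrightarrow> openin proj_space (cone_lines K)"
  unfolding cone_lines_def by (intro openin_lines_of open_vimage continuous_on_chart_form)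

lemma cone_lines_Int: "\<lbrakk>positive_cone K; positive_cone K'\<rbrakk> \<Longrightarrow> cone_lines K \<inter> cone_lines K' = cone_lines (K \<inter> K')"
  unfolding cone_lines_def by (simp add: lines_of_Int scale_invariant_chart_form vimage_Int)

lemma cone_lines_Un: "cone_lines K \<union> cone_lines K' = cone_lines (K \<union> K')"
  unfolding cone_lines_def by (simp add: lines_of_Un vimage_Un)

lemma cone_lines_mono: "K \<subseteq> K' \<Longrightarrow> cone_lines K \<subseteq> cone_lines K'"
  unfolding cone_lines_def lines_of_def by auto

lemma conj_cone_lines:
  assumes "L \<in> cone_lines K" "positive_cone K" "\<And>z. z \<in> K \<Longrightarrow> cnj z \<in> K'"
  shows "conj_line L \<in> cone_lines K'"
proof -
  obtain x where "x \<noteq> 0" "L = vec.span {x}" "chart_form x \<in> K"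
    using assms(1) by (auto simp: cone_lines_def lines_of_def)
  then show ?thesis using assms(3) by (auto simp: conj_line_span cone_lines_def lines_of_def chart_form_conj)
qed

section \<open>Contractions in the affine charts of CP^1\<close>

definition affine_line :: "complex \<Rightarrow> (complex ^ 2) set" where
  "affine_line p = vec.span {vector [1, p]}"

lemma chart_form_vector: "chart_form (vector [1, p]) = p"
  by (simp add: chart_form_def vector_2)

lemma vector_1_neq_0: "(vector [1, p] :: complex ^ 2) \<noteq> 0"
  by (metis vector_2(1) zero_index zero_neq_one)

lemma affine_line_in_proj_space: "affine_line p \<in> topspace proj_space"
  unfolding affine_line_def using vector_1_neq_0 by simp

lemma affine_line_in_cone: "p \<in> K \<Longrightarrow> affine_line p \<in> cone_lines K"
  unfolding affine_line_def cone_lines_def lines_of_def using chart_form_vector vector_1_neq_0 by force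

lemma conj_affine_line: "conj_line (affine_line p) = affine_line (cnj p)"
proof -
  have "conj_vec (vector [1, p]) = (vector [1, cnj p] :: complex ^ 2)"
    by (simp add: vec_eq_iff forall_2 vector_2)
  then show ?thesis by (simp add: affine_line_def conj_line_span)
qed

text \<open>The straight-line contraction of the affine coordinate y_2 / y_1 to \<open>p\<close>,
  multiplied by y_1 so that it is linear in \<open>y\<close> and defined on all vectors.\<close>

definition chart_contraction :: "complex \<Rightarrow> real \<Rightarrow> complex ^ 2 \<Rightarrow> complex ^ 2" where
  "chart_contraction p t y = (\<chi> i. if i = 1 then y $ 1 else of_real t * y $ 2 + of_real (1 - t) * (p * y $ 1))"

lemma chart_contraction_nth:
  "chart_contraction p t y $ 1 = y $ 1" "chart_contraction p t y $ 2 = of_real t * y $ 2 + of_real (1 - t) * (p * y $ 1)"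
  by (simp_all add: chart_contraction_def)

lemma chart_form_contraction:
  "chart_form (chart_contraction p t y) =
     of_real t * chart_form y + of_real ((1 - t) * (cmod (y $ 1))\<^sup>2) * p"
  unfolding of_real_mult complex_norm_square
  by (simp add: chart_form_def chart_contraction_nth algebra_simps)

lemma continuous_on_chart_contraction: "continuous_on S (\<lambda>(t, y). chart_contraction p t y)"
proof -
  have "continuous_on S (\<lambda>x. if i = 1 then snd x $ 1 else of_real (fst x) * snd x $ 2 + of_real (1 - fst x) * (p * snd x $ 1))" for i :: 2
    by (cases "i = 1") (auto intro!: continuous_intros)
  then show ?thesis unfolding chart_contraction_def case_prod_unfold
    by (intro continuous_on_vec_lambda) simp
qed

lemma line_preserving_if_linear:
  assumes "\<And>k x. T (k *s x) = k *s T x"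
  shows "line_preserving T"
  using assms by (auto simp: line_preserving_def vec.span_singleton)

lemma line_preserving_chart_contraction: "line_preserving (chart_contraction p t)"
  by (intro line_preserving_if_linear) (simp add: vec_eq_iff forall_2 chart_contraction_nth algebra_simps)

lemma chart_contraction_1: "chart_contraction p 1 y = y"
  by (simp add: vec_eq_iff forall_2 chart_contraction_nth)

lemma span_chart_contraction_0:
  assumes "y $ 1 \<noteq> 0"
  shows "vec.span {chart_contraction p 0 y} = affine_line p"
proof -
  have "chart_contraction p 0 y = y $ 1 *s vector [1, p]"
    by (simp add: vec_eq_iff forall_2 chart_contraction_nth vector_2)
  then show ?thesis
    unfolding affine_line_def using span_singleton_eq_iff[OF vector_1_neq_0] assms by metis
qed

lemma chart_contraction_neq_0:
  assumes "y $ 1 \<noteq> 0"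
  shows "chart_contraction p t y \<noteq> 0"
  using assms by (metis chart_contraction_nth(1) zero_index)

lemma chart_form_nonzeroD: "chart_form y \<in> K \<Longrightarrow> 0 \<notin> K \<Longrightarrow> y $ 1 \<noteq> 0"
  by (auto simp: chart_form_def)

text \<open>The set \<open>K\<close> is star-shaped about \<open>p\<close> in terms of the affine
  coordinate, whereas \<open>chart_form\<close> is that coordinate times the squared modulus
  \<open>r\<close> of y_1. Being a cone, \<open>K\<close> allows division by \<open>r\<close> before
  the contraction and multiplication afterwards.\<close>

lemma chart_form_contraction_mem:
  assumes K: "positive_cone K" "\<And>z t. \<lbrakk>z \<in> K; 0 \<le> t; t \<le> 1\<rbrakk> \<Longrightarrow> of_real t * z + of_real (1 - t) * p \<in> K" "0 \<notin> K"
    and y: "chart_form y \<in> K" and t: "0 \<le> t" "t \<le> 1"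
  shows "chart_form (chart_contraction p t y) \<in> K"
proof -
  define r where "r = (cmod (y $ 1))\<^sup>2"
  have r: "r > 0" using chart_form_nonzeroD[OF y K(3)] by (simp add: r_def)
  have "of_real (1 / r) * chart_form y \<in> K"
    using K(1) y r unfolding positive_cone_def by (metis zero_less_divide_1_iff)
  from K(2)[OF this t] have "of_real r * (of_real t * (of_real (1 / r) * chart_form y) + of_real (1 - t) * p) \<in> K"
    using K(1) r unfolding positive_cone_def by blast
  also have "of_real r * (of_real t * (of_real (1 / r) * chart_form y) + of_real (1 - t) * p) = chart_form (chart_contraction p t y)"
    using r by (simp add: chart_form_contraction r_def[symmetric] field_simps)
  finally show ?thesis .
qed

lemma chart_contraction_fixes:
  assumes "vec.span {x} = affine_line p"
  shows "chart_contraction p t x = x"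
proof -
  have "vec.span {vector [1, p]} = vec.span {x}" using assms by (simp add: affine_line_def)
  then obtain k where "x = k *s vector [1, p]" using span_singleton_eq_iff[OF vector_1_neq_0] by blast
  then show ?thesis by (simp add: vec_eq_iff forall_2 chart_contraction_nth vector_2 algebra_simps)
qed

lemma trivial_cone_pair:
  assumes "open K" "J \<subseteq> K" "positive_cone K" "positive_cone J" "0 \<notin> K" "p \<in> J"
    and K: "\<And>z t. \<lbrakk>z \<in> K; 0 \<le> t; t \<le> 1\<rbrakk> \<Longrightarrow> of_real t * z + of_real (1 - t) * p \<in> K"
    and J: "\<And>z t. \<lbrakk>z \<in> J; 0 \<le> t; t \<le> 1\<rbrakk> \<Longrightarrow> of_real t * z + of_real (1 - t) * p \<in> J"
  shows "trivial_group (relative_homology_group q (cyl W (cone_lines K)) (topspace W \<times> cone_lines J))"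
proof (rule trivial_cyl_pair[of _ _ "chart_contraction p"])
  fix t :: real and x assume t: "0 \<le> t" "t \<le> 1"
  show "chart_contraction p t x \<noteq> 0 \<and> vec.span {chart_contraction p t x} \<in> cone_lines K"
    if "vec.span {x} \<in> cone_lines K"
    using that assms(3,5) chart_form_contraction_mem[OF assms(3) K assms(5) _ t]
    by (auto simp: span_in_cone_lines chart_contraction_neq_0 dest!: chart_form_nonzeroD)
  have "0 \<notin> J" using assms by auto
  then show "vec.span {chart_contraction p t x} \<in> cone_lines J" if "vec.span {x} \<in> cone_lines J"
    using that assms(4) chart_form_contraction_mem[OF assms(4) J _ _ t]
    by (auto simp: span_in_cone_lines chart_contraction_neq_0 dest!: chart_form_nonzeroD)
next
  fix x assume "vec.span {x} \<in> cone_lines K"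
  then show "vec.span {chart_contraction p 0 x} \<in> cone_lines J"
    using assms(3,5,6)
    by (auto simp: span_in_cone_lines span_chart_contraction_0 affine_line_in_cone dest!: chart_form_nonzeroD)
qed (use assms in \<open>auto simp: line_preserving_chart_contraction continuous_on_chart_contraction
      chart_contraction_1 intro!: openin_cone_lines dest: subsetD[OF cone_lines_mono]\<close>)

lemma trivial_cone_point:
  assumes "open K" "positive_cone K" "0 \<notin> K" "p \<in> K"
    and K: "\<And>z t. \<lbrakk>z \<in> K; 0 \<le> t; t \<le> 1\<rbrakk> \<Longrightarrow> of_real t * z + of_real (1 - t) * p \<in> K"
  shows "trivial_group (relative_homology_group q (cyl W (cone_lines K)) (topspace W \<times> {affine_line p}))"
proof (rule trivial_cyl_pair[of _ _ "chart_contraction p"])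
  fix t :: real and x assume t: "0 \<le> t" "t \<le> 1"
  show "chart_contraction p t x \<noteq> 0 \<and> vec.span {chart_contraction p t x} \<in> cone_lines K"
    if "vec.span {x} \<in> cone_lines K"
    using that assms(2,3) chart_form_contraction_mem[OF assms(2) K assms(3) _ t]
    by (auto simp: span_in_cone_lines chart_contraction_neq_0 dest!: chart_form_nonzeroD)
next
  fix x assume "vec.span {x} \<in> cone_lines K"
  then show "vec.span {chart_contraction p 0 x} \<in> {affine_line p}"
    using assms(2,3) by (auto simp: span_in_cone_lines span_chart_contraction_0 dest!: chart_form_nonzeroD)
qed (use assms in \<open>auto simp: line_preserving_chart_contraction continuous_on_chart_contraction
      chart_contraction_1 affine_line_in_cone chart_contraction_fixes intro!: openin_cone_lines\<close>)

lemma iso_fst_cone: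
  assumes "open K" "positive_cone K" "0 \<notin> K" "p \<in> K"
    and K: "\<And>z t. \<lbrakk>z \<in> K; 0 \<le> t; t \<le> 1\<rbrakk> \<Longrightarrow> of_real t * z + of_real (1 - t) * p \<in> K"
  shows "group_isomorphisms (homology_group q (cyl W (cone_lines K))) (homology_group q W)
    (hom_induced q (cyl W (cone_lines K)) {} W {} fst) (hom_induced q W {} (cyl W (cone_lines K)) {} (\<lambda>w. (w, affine_line p)))"
proof (rule iso_fst_cyl[of _ _ "chart_contraction p"])
  fix t :: real and x assume t: "0 \<le> t" "t \<le> 1"
  show "chart_contraction p t x \<noteq> 0 \<and> vec.span {chart_contraction p t x} \<in> cone_lines K"
    if "vec.span {x} \<in> cone_lines K"
    using that assms(2,3) chart_form_contraction_mem[OF assms(2) K assms(3) _ t]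
    by (auto simp: span_in_cone_lines chart_contraction_neq_0 dest!: chart_form_nonzeroD)
next
  fix x assume "vec.span {x} \<in> cone_lines K"
  then show "vec.span {chart_contraction p 0 x} = affine_line p"
    using assms(2,3) by (auto simp: span_in_cone_lines span_chart_contraction_0 dest!: chart_form_nonzeroD)
qed (use assms in \<open>auto simp: line_preserving_chart_contraction continuous_on_chart_contraction
      chart_contraction_1 affine_line_in_cone intro!: openin_cone_lines\<close>)

abbreviation chart_lines :: "'n \<Rightarrow> (complex ^ 'n) set set" where
  "chart_lines i \<equiv> lines_of {x. x $ i \<noteq> 0}"

lemma span_in_chart_lines: "vec.span {x} \<in> chart_lines i \<longleftrightarrow> x $ i \<noteq> 0"
  by (subst span_in_lines_of) (auto simp: scale_invariant_def)

lemma openin_chart_lines: "openin proj_space (chart_lines i)"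
  by (intro openin_lines_of open_Collect_neq continuous_intros)

lemma trivial_chart_point:
  "trivial_group (relative_homology_group q (cyl W (chart_lines 1)) (topspace W \<times> {affine_line p}))"
  by (rule trivial_cyl_pair[of _ _ "chart_contraction p"])
    (auto simp: line_preserving_chart_contraction continuous_on_chart_contraction openin_chart_lines
      chart_contraction_1 span_in_chart_lines chart_contraction_fixes chart_contraction_neq_0
      span_chart_contraction_0 chart_contraction_nth affine_line_def vector_2)

definition swap_vec :: "complex ^ 2 \<Rightarrow> complex ^ 2" where
  "swap_vec y = vector [y $ 2, y $ 1]"

lemma swap_vec_nth: "swap_vec y $ 1 = y $ 2" "swap_vec y $ 2 = y $ 1"
  by (simp_all add: swap_vec_def vector_2)

lemma swap_vec_swap_vec: "swap_vec (swap_vec y) = y"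
  by (simp add: vec_eq_iff forall_2 swap_vec_nth)

lemma continuous_on_swap_vec: "continuous_on S swap_vec"
proof -
  have eq: "swap_vec = (\<lambda>y. \<chi> i. if i = 1 then y $ 2 else y $ 1)"
    by (simp add: fun_eq_iff vec_eq_iff forall_2 swap_vec_nth)
  show ?thesis
    unfolding eq
  proof (rule continuous_on_vec_lambda)
    show "continuous_on S (\<lambda>y :: complex ^ 2. if i = 1 then y $ 2 else y $ 1)" for i :: 2
      by (cases "i = 1") (auto intro!: continuous_intros)
  qed
qed

text \<open>Exchanging the coordinates inverts the affine coordinate, so the point -1 is fixed by
  the swap and lies in both charts. It is also real, hence fixed by conjugation, and it lies in
  \<open>slit_cone\<close>; these properties single it out as the base point of CP^1.\<close>

lemma span_swap_affine_line:
  assumes "vec.span {y} = affine_line (- 1)"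
  shows "vec.span {swap_vec y} = affine_line (- 1)"
proof -
  have "vec.span {vector [1, - 1]} = vec.span {y}" using assms by (simp add: affine_line_def)
  then obtain k where k: "k \<noteq> 0" "y = k *s vector [1, - 1]" using span_singleton_eq_iff[OF vector_1_neq_0] by blast
  have "swap_vec y = (- k) *s vector [1, - 1]"
    by (simp add: k vec_eq_iff forall_2 swap_vec_nth vector_2)
  then show ?thesis
    unfolding affine_line_def using span_singleton_eq_iff[OF vector_1_neq_0] k by (metis neg_equal_0_iff_equal)
qed

lemma trivial_chart_2_point:
  "trivial_group (relative_homology_group q (cyl W (chart_lines 2)) (topspace W \<times> {affine_line (- 1)}))"
proof (rule trivial_cyl_pair[of _ _ "\<lambda>t y. swap_vec (chart_contraction (- 1) t (swap_vec y))"])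
  show "continuous_on ({0..1} \<times> UNIV) (\<lambda>(t, y). swap_vec (chart_contraction (- 1) t (swap_vec y)))"
    unfolding case_prod_unfold
    by (intro continuous_on_compose2[OF continuous_on_swap_vec[of UNIV]]
        continuous_on_compose2[OF continuous_on_chart_contraction[of UNIV, unfolded case_prod_unfold],
          of _ "\<lambda>z. (fst z, swap_vec (snd z))", simplified] continuous_intros) auto
  show "line_preserving (\<lambda>y. swap_vec (chart_contraction (- 1) t (swap_vec y)))" for t
    by (intro line_preserving_if_linear)
      (simp add: vec_eq_iff forall_2 swap_vec_nth chart_contraction_nth algebra_simps)
  show "vec.span {swap_vec (chart_contraction (- 1) t (swap_vec x))} \<in> {affine_line (- 1)}"
    if "vec.span {x} \<in> {affine_line (- 1)}" for t x
    using that by (simp add: span_swap_affine_line chart_contraction_fixes swap_vec_swap_vec)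
  show "vec.span {swap_vec (chart_contraction (- 1) 0 (swap_vec x))} \<in> {affine_line (- 1)}"
    if "vec.span {x} \<in> chart_lines 2" for x
    using that by (simp add: span_in_chart_lines span_swap_affine_line span_chart_contraction_0 swap_vec_nth)
  show "swap_vec (chart_contraction (- 1) t (swap_vec x)) \<noteq> 0 \<and>
      vec.span {swap_vec (chart_contraction (- 1) t (swap_vec x))} \<in> chart_lines 2"
    if "vec.span {x} \<in> chart_lines 2" for t x
    using that by (auto simp: span_in_chart_lines swap_vec_nth chart_contraction_nth vec_eq_iff intro!: exI[of _ 2])
  show "{affine_line (- 1)} \<subseteq> chart_lines 2"
    by (simp add: affine_line_def span_in_chart_lines vector_2)
qed (auto simp: openin_chart_lines chart_contraction_1 swap_vec_swap_vec)

lemma continuous_map_id_cyl: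
  assumes "Z \<subseteq> Z'"
  shows "continuous_map (cyl W Z) (cyl W Z') id"
proof -
  have "continuous_map (cyl W Z) (cyl W Z') (\<lambda>z. (fst z, snd z))"
    using continuous_map_snd[of W "subtopology proj_space Z"] assms
    by (intro continuous_map_pairedI continuous_map_fst) (auto simp: continuous_map_in_subtopology)
  then show ?thesis by (simp add: id_def)
qed

lemma hom_induced_conj_comm:
  assumes sub: "Z \<subseteq> Z'" "A \<subseteq> A'"
    and c: "\<And>L. L \<in> Z \<Longrightarrow> conj_line L \<in> Z" "\<And>L. L \<in> Z' \<Longrightarrow> conj_line L \<in> Z'"
      "\<And>L. L \<in> A \<Longrightarrow> conj_line L \<in> A" "\<And>L. L \<in> A' \<Longrightarrow> conj_line L \<in> A'"
  shows "hom_induced p (cyl W Z) (topspace W \<times> A) (cyl W Z') (topspace W \<times> A') id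
      (hom_induced p (cyl W Z) (topspace W \<times> A) (cyl W Z) (topspace W \<times> A) conj_cyl x) =
    hom_induced p (cyl W Z') (topspace W \<times> A') (cyl W Z') (topspace W \<times> A') conj_cyl
      (hom_induced p (cyl W Z) (topspace W \<times> A) (cyl W Z') (topspace W \<times> A') id x)"
proof -
  have im: "conj_cyl \<in> topspace W \<times> A \<rightarrow> topspace W \<times> A" "conj_cyl \<in> topspace W \<times> A' \<rightarrow> topspace W \<times> A'"
    "id \<in> topspace W \<times> A \<rightarrow> topspace W \<times> A'"
    using sub c by auto
  show ?thesis
    using hom_induced_compose'[where p = p and x = x, OF continuous_map_conj_cyl[OF c(1)] im(1) continuous_map_id_cyl[OF sub(1)] im(3)]
      hom_induced_compose'[where p = p and x = x, OF continuous_map_id_cyl[OF sub(1)] im(3) continuous_map_conj_cyl[OF c(2)] im(2)]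
    by (metis comp_id id_comp)
qed

lemma hom_relboundary_conj_comm:
  assumes sub: "B \<subseteq> A" "A \<subseteq> Z"
    and c: "\<And>L. L \<in> Z \<Longrightarrow> conj_line L \<in> Z" "\<And>L. L \<in> A \<Longrightarrow> conj_line L \<in> A" "\<And>L. L \<in> B \<Longrightarrow> conj_line L \<in> B"
  shows "hom_relboundary p (cyl W Z) (topspace W \<times> A) (topspace W \<times> B)
      (hom_induced p (cyl W Z) (topspace W \<times> A) (cyl W Z) (topspace W \<times> A) conj_cyl x) =
    hom_induced (p - 1) (cyl W A) (topspace W \<times> B) (cyl W A) (topspace W \<times> B) conj_cyl
      (hom_relboundary p (cyl W Z) (topspace W \<times> A) (topspace W \<times> B) x)"
proof -
  have "conj_cyl \<in> topspace W \<times> A \<rightarrow> topspace W \<times> A" "conj_cyl \<in> topspace W \<times> B \<rightarrow> topspace W \<times> B"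
    using c by auto
  from fun_cong[OF naturality_hom_induced_relboundary[OF continuous_map_conj_cyl[OF c(1), of Z W] this], of p x]
  show ?thesis using sub by (simp add: subtopology_cyl Int_absorb1)
qed

abbreviation conj_inverts :: "int \<Rightarrow> 'w topology \<Rightarrow> (complex ^ 'n) set set \<Rightarrow> (complex ^ 'n) set set \<Rightarrow> bool" where
  "conj_inverts p W Z A \<equiv> (\<forall>x \<in> carrier (relative_homology_group p (cyl W Z) (topspace W \<times> A)).
     hom_induced p (cyl W Z) (topspace W \<times> A) (cyl W Z) (topspace W \<times> A) conj_cyl x =
       inv\<^bsub>relative_homology_group p (cyl W Z) (topspace W \<times> A)\<^esub> x)"

text \<open>The two charts of CP^1 overlap in the punctured plane. That in turn is covered by the
  slit plane and the right half-plane, both contractible, which overlap in two contractible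
  quadrants. All these pieces are stable under conjugation except the quadrants, which it
  interchanges: this is the source of the sign -1.\<close>

abbreviation "punctured_cone \<equiv> - {0 :: complex}"
abbreviation "slit_cone \<equiv> - {z. Im z = 0 \<and> 0 \<le> Re z}"
abbreviation "right_cone \<equiv> {z. 0 < Re z}"
abbreviation "upper_cone \<equiv> {z. 0 < Re z \<and> 0 < Im z}"
abbreviation "lower_cone \<equiv> {z. 0 < Re z \<and> Im z < 0}"

lemma open_cones: "open punctured_cone" "open slit_cone" "open right_cone" "open upper_cone" "open lower_cone"
proof -
  have "closed {z. Im z = 0 \<and> 0 \<le> Re z}"
    by (intro closed_Collect_conj closed_Collect_eq closed_Collect_le continuous_intros)
  then show "open slit_cone" by (simp add: open_Compl)
  show "open right_cone" "open upper_cone" "open lower_cone"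
    by (intro open_Collect_conj open_Collect_less continuous_intros)+
qed (simp add: open_Compl)

lemma positive_cones: "positive_cone punctured_cone" "positive_cone slit_cone" "positive_cone right_cone"
  "positive_cone upper_cone" "positive_cone lower_cone" "positive_cone (upper_cone \<union> lower_cone)"
  by (auto simp: positive_cone_def zero_le_mult_iff mult_less_0_iff mult_pos_neg)

lemma cone_sets: "slit_cone \<inter> right_cone = upper_cone \<union> lower_cone" "slit_cone \<union> right_cone = punctured_cone"
  "lower_cone \<inter> upper_cone = {}"
  by (auto simp: complex_eq_iff)

lemma convex_combination_pos:
  fixes a b t :: real
  assumes "0 < a" "0 < b" "0 \<le> t" "t \<le> 1"
  shows "0 < t * a + (1 - t) * b"
  using assms by (cases "t = 0") (auto intro: add_pos_nonneg)

text \<open>The right half-plane is contracted to a point of the lower quadrant, the same one to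
  which that quadrant is contracted; one homotopy then trivialises the pair of the two.\<close>

lemma cone_contractions:
  fixes t :: real
  assumes t: "0 \<le> t" "t \<le> 1"
  shows "z \<in> slit_cone \<Longrightarrow> of_real t * z + of_real (1 - t) * - 1 \<in> slit_cone"
    and "z \<in> right_cone \<Longrightarrow> of_real t * z + of_real (1 - t) * Complex 1 (- 1) \<in> right_cone"
    and "z \<in> upper_cone \<Longrightarrow> of_real t * z + of_real (1 - t) * Complex 1 1 \<in> upper_cone"
    and "z \<in> lower_cone \<Longrightarrow> of_real t * z + of_real (1 - t) * Complex 1 (- 1) \<in> lower_cone"
proof -
  have 1: "0 < t * a + (1 - t)" if "0 < a" for a using convex_combination_pos[of a 1 t] that t by simp
  have 2: "t * a - (1 - t) < 0" if "a < 0" for a using convex_combination_pos[of "- a" 1 t] that t by simp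
  show "z \<in> right_cone \<Longrightarrow> of_real t * z + of_real (1 - t) * Complex 1 (- 1) \<in> right_cone"
    "z \<in> upper_cone \<Longrightarrow> of_real t * z + of_real (1 - t) * Complex 1 1 \<in> upper_cone"
    "z \<in> lower_cone \<Longrightarrow> of_real t * z + of_real (1 - t) * Complex 1 (- 1) \<in> lower_cone"
    using 1[of "Re z"] 1[of "Im z"] 2[of "Im z"] by auto
  show "z \<in> slit_cone \<Longrightarrow> of_real t * z + of_real (1 - t) * - 1 \<in> slit_cone"
    using 2[of "Re z"] t by (cases "t = 0") auto
qed

lemma chart_lines_Int: "chart_lines (2::2) \<inter> chart_lines (1::2) = cone_lines punctured_cone"
proof -
  have "{x :: complex ^ 2. x $ 2 \<noteq> 0} \<inter> {x. x $ 1 \<noteq> 0} = chart_form -` punctured_cone"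
    by (auto simp: chart_form_def)
  then show ?thesis unfolding cone_lines_def by (subst lines_of_Int) (auto simp: scale_invariant_def)
qed

lemma chart_lines_Un: "chart_lines (2::2) \<union> chart_lines (1::2) = topspace (proj_space :: (complex ^ 2) set topology)"
proof
  show "topspace (proj_space :: (complex ^ 2) set topology) \<subseteq> chart_lines (2::2) \<union> chart_lines (1::2)"
  proof
    fix L assume "L \<in> topspace (proj_space :: (complex ^ 2) set topology)"
    then obtain x where "x \<noteq> 0" "L = vec.span {x}" by (rule complex_linesE)
    then show "L \<in> chart_lines (2::2) \<union> chart_lines (1::2)"
      by (auto simp: span_in_chart_lines vec_eq_iff forall_2)
  qed
qed (use lines_of_subset in auto)

lemma conj_chart_lines: "L \<in> chart_lines i \<Longrightarrow> conj_line L \<in> chart_lines i"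
  unfolding lines_of_def by (auto simp: conj_line_span)

section \<open>Excision and boundary isomorphisms in the fibre CP^1\<close>

context
  fixes W :: "'w topology"
begin

abbreviation (input) "base_line \<equiv> {affine_line (- 1)}"

lemma punctured_cone_excision:
  "hom_induced p (cyl W (cone_lines right_cone)) (topspace W \<times> cone_lines (upper_cone \<union> lower_cone))
      (cyl W (cone_lines punctured_cone)) (topspace W \<times> cone_lines slit_cone) id
    \<in> iso (relative_homology_group p (cyl W (cone_lines right_cone)) (topspace W \<times> cone_lines (upper_cone \<union> lower_cone)))
        (relative_homology_group p (cyl W (cone_lines punctured_cone)) (topspace W \<times> cone_lines slit_cone))"
  using cyl_excision[OF openin_cone_lines openin_cone_lines, OF open_cones(2,3), of p W]
  unfolding cone_lines_Un cone_lines_Int[OF positive_cones(2,3)] cone_sets .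

lemma punctured_cone_base_iso:
  "hom_induced p (cyl W (cone_lines punctured_cone)) (topspace W \<times> base_line)
      (cyl W (cone_lines punctured_cone)) (topspace W \<times> cone_lines slit_cone) id
    \<in> iso (relative_homology_group p (cyl W (cone_lines punctured_cone)) (topspace W \<times> base_line))
        (relative_homology_group p (cyl W (cone_lines punctured_cone)) (topspace W \<times> cone_lines slit_cone))"
  by (intro cyl_iso_if_trivial_sub_pair trivial_cone_point cone_lines_mono)
    (use open_cones positive_cones cone_contractions(1) in \<open>auto intro!: affine_line_in_cone\<close>)

lemma base_line_in_punctured: "base_line \<subseteq> cone_lines punctured_cone"
  by (auto intro: affine_line_in_cone)

lemma punctured_chart: "cone_lines punctured_cone \<subseteq> chart_lines (1::2)" "cone_lines punctured_cone \<subseteq> chart_lines (2::2)"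
  using chart_lines_Int by auto

lemma chart_relboundary_iso:
  "hom_relboundary p (cyl W (chart_lines (1::2))) (topspace W \<times> cone_lines punctured_cone) (topspace W \<times> base_line)
    \<in> iso (relative_homology_group p (cyl W (chart_lines (1::2))) (topspace W \<times> cone_lines punctured_cone))
        (relative_homology_group (p - 1) (cyl W (cone_lines punctured_cone)) (topspace W \<times> base_line))"
  by (intro cyl_iso_relboundary_if_trivial_pair trivial_chart_point base_line_in_punctured punctured_chart)

lemma chart_excision:
  "hom_induced p (cyl W (chart_lines (1::2))) (topspace W \<times> cone_lines punctured_cone)
      (cyl W (topspace (proj_space :: (complex ^ 2) set topology))) (topspace W \<times> chart_lines (2::2)) id
    \<in> iso (relative_homology_group p (cyl W (chart_lines (1::2))) (topspace W \<times> cone_lines punctured_cone))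
        (relative_homology_group p (cyl W (topspace (proj_space :: (complex ^ 2) set topology))) (topspace W \<times> chart_lines (2::2)))"
  using cyl_excision[OF openin_chart_lines[of "2::2"] openin_chart_lines[of "1::2"], of p W]
  unfolding chart_lines_Int chart_lines_Un .

lemma proj_base_iso:
  "hom_induced p (cyl W (topspace (proj_space :: (complex ^ 2) set topology))) (topspace W \<times> base_line)
      (cyl W (topspace (proj_space :: (complex ^ 2) set topology))) (topspace W \<times> chart_lines (2::2)) id
    \<in> iso (relative_homology_group p (cyl W (topspace (proj_space :: (complex ^ 2) set topology))) (topspace W \<times> base_line))
        (relative_homology_group p (cyl W (topspace (proj_space :: (complex ^ 2) set topology))) (topspace W \<times> chart_lines (2::2)))"
  by (intro cyl_iso_if_trivial_sub_pair trivial_chart_2_point lines_of_subset)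
    (use base_line_in_punctured punctured_chart in blast)

lemma right_relboundary_iso:
  "hom_relboundary p (cyl W (cone_lines right_cone)) (topspace W \<times> cone_lines (upper_cone \<union> lower_cone)) (topspace W \<times> cone_lines lower_cone)
    \<in> iso (relative_homology_group p (cyl W (cone_lines right_cone)) (topspace W \<times> cone_lines (upper_cone \<union> lower_cone)))
        (relative_homology_group (p - 1) (cyl W (cone_lines (upper_cone \<union> lower_cone))) (topspace W \<times> cone_lines lower_cone))"
  by (intro cyl_iso_relboundary_if_trivial_pair trivial_cone_pair[of _ _ "Complex 1 (- 1)"] cone_lines_mono)
    (use open_cones positive_cones cone_contractions(2,4) in auto)

lemma upper_excision:
  "hom_induced p (cyl W (cone_lines upper_cone)) {} (cyl W (cone_lines (upper_cone \<union> lower_cone))) (topspace W \<times> cone_lines lower_cone) id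
    \<in> iso (homology_group p (cyl W (cone_lines upper_cone)))
        (relative_homology_group p (cyl W (cone_lines (upper_cone \<union> lower_cone))) (topspace W \<times> cone_lines lower_cone))"
proof -
  have "cone_lines {} = {}" by (auto simp: cone_lines_def lines_of_def)
  then show ?thesis
    using cyl_excision[OF openin_cone_lines openin_cone_lines, OF open_cones(5,4), of p W]
    unfolding cone_lines_Un cone_lines_Int[OF positive_cones(5,4)] cone_sets by (simp add: Un_commute)
qed

lemmas upper_fst_iso = iso_fst_cone[of upper_cone "Complex 1 1", OF open_cones(4) positive_cones(4) _ _ cone_contractions(3)]
lemmas lower_fst_iso = iso_fst_cone[of lower_cone "Complex 1 (- 1)", OF open_cones(5) positive_cones(5) _ _ cone_contractions(4)]

text \<open>The boundary map embeds this relative group into the homology of the two quadrants. A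
  class in its image bounds in the right half-plane, so its projection to \<open>W\<close> vanishes
  and it is a difference of the same class placed in the upper and in the lower quadrant.
  Conjugation interchanges the quadrants and so changes the sign.\<close>

lemma conj_inverts_right:
  "conj_inverts p W (cone_lines right_cone) (cone_lines (upper_cone \<union> lower_cone))"
proof
  let ?R = "cyl W (cone_lines right_cone)" and ?Q = "cyl W (cone_lines (upper_cone \<union> lower_cone))"
  let ?tQ = "topspace W \<times> cone_lines (upper_cone \<union> lower_cone)"
  let ?tL = "topspace W \<times> cone_lines lower_cone"
  let ?U = "cyl W (cone_lines upper_cone)" and ?L = "cyl W (cone_lines lower_cone)"
  let ?H = "\<lambda>Z. homology_group (p - 1) Z"
  interpret RQ: comm_group "relative_homology_group p ?R ?tQ" by simp
  interpret HQ: comm_group "?H ?Q" by simp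
  interpret HW: comm_group "?H W" by simp
  have sQR: "cone_lines (upper_cone \<union> lower_cone) \<subseteq> cone_lines right_cone" by (rule cone_lines_mono) auto
  have sUQ: "cone_lines upper_cone \<subseteq> cone_lines (upper_cone \<union> lower_cone)" by (rule cone_lines_mono) auto
  have sLQ: "cone_lines lower_cone \<subseteq> cone_lines (upper_cone \<union> lower_cone)" by (rule cone_lines_mono) auto
  have subQ: "subtopology ?R ?tQ = ?Q" using sQR by (simp add: subtopology_cyl Int_absorb1)
  have triv: "trivial_group (relative_homology_group p ?R ?tL)"
    by (intro trivial_cone_pair[of _ _ "Complex 1 (- 1)"])
      (use open_cones positive_cones cone_contractions(2,4) in auto)
  define D where "D = hom_boundary p ?R ?tQ"
  have D_hom: "group_hom (relative_homology_group p ?R ?tQ) (?H ?Q) D"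
    using hom_boundary_hom[of p ?R ?tQ] by (simp add: D_def subQ group_hom_def group_hom_axioms_def)
  interpret D: group_hom "relative_homology_group p ?R ?tQ" "?H ?Q" D by (rule D_hom)
  \<comment> \<open>The kernel of \<open>D\<close> comes from the homology of \<open>?R\<close>, and
    its map to the pair passes through the pair of \<open>?R\<close> and the lower quadrant, whose
    groups are trivial.\<close>
  have D_inj: "x = \<one>\<^bsub>relative_homology_group p ?R ?tQ\<^esub>"
    if "x \<in> carrier (relative_homology_group p ?R ?tQ)" "D x = \<one>\<^bsub>?H ?Q\<^esub>" for x
  proof -
    have "x \<in> kernel (relative_homology_group p ?R ?tQ) (?H ?Q) D" using that by (simp add: kernel_def)
    then have "x \<in> hom_induced p ?R {} ?R ?tQ id ` carrier (homology_group p ?R)"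
      using exact_triple_rel[of "{}" ?tQ p ?R] by (simp add: D_def hom_relboundary_empty subQ)
    then obtain y where y: "x = hom_induced p ?R {} ?R ?tQ id y" by blast
    have "x = hom_induced p ?R ?tL ?R ?tQ id (hom_induced p ?R {} ?R ?tL id y)"
      unfolding y using sLQ by (subst hom_induced_compose') auto
    moreover have "hom_induced p ?R {} ?R ?tL id y = \<one>\<^bsub>relative_homology_group p ?R ?tL\<^esub>"
      using triv hom_induced_carrier[of p ?R "{}" ?R ?tL id y] by (simp add: trivial_group_def)
    ultimately show ?thesis by (simp add: group_hom.hom_one[OF group_hom_induced])
  qed
  define F where "F = hom_induced (p - 1) ?Q {} W {} fst"
  interpret F: group_hom "?H ?Q" "?H W" F unfolding F_def by (rule group_hom_induced)
  \<comment> \<open>The map on homology of the constant section at the affine coordinate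
    \<open>z\<close>. Conjugation takes it to the section at \<open>cnj z\<close>, and
    \<open>fst\<close> undoes it.\<close>
  define s where "s = (\<lambda>z. hom_induced (p - 1) W {} ?Q {} (\<lambda>w. (w, affine_line z)))"
  have s_hom: "group_hom (?H W) (?H ?Q) (s z)" for z unfolding s_def by (rule group_hom_induced)
  have cs: "continuous_map W ?Q (\<lambda>w. (w, affine_line z))" if "z \<in> upper_cone \<union> lower_cone" for z
    using that affine_line_in_cone[OF that] affine_line_in_proj_space by (intro continuous_map_pairedI) auto
  define C where "C = hom_induced (p - 1) ?Q {} ?Q {} conj_cyl"
  interpret C: group_hom "?H ?Q" "?H ?Q" C unfolding C_def by (rule group_hom_induced)
  have conjQ: "conj_line L \<in> cone_lines (upper_cone \<union> lower_cone)"
    if "L \<in> cone_lines (upper_cone \<union> lower_cone)" for L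
    using that positive_cones(6) by (rule conj_cone_lines) auto
  have conjR: "conj_line L \<in> cone_lines right_cone" if "L \<in> cone_lines right_cone" for L
    using that positive_cones(3) by (rule conj_cone_lines) auto
  have Cs: "C (s z a) = s (cnj z) a" if "z \<in> upper_cone \<union> lower_cone" for z a
    unfolding C_def s_def using hom_induced_compose'[OF cs[OF that] _ continuous_map_conj_cyl[OF conjQ], of "{}" "{}" "{}" "p - 1" a]
    by (simp add: o_def conj_affine_line)
  have Fs: "F (s z a) = a" if "z \<in> upper_cone \<union> lower_cone" "a \<in> carrier (?H W)" for z a
    unfolding F_def s_def
    using hom_induced_compose'[OF cs[OF that(1)] _ continuous_map_fst, of "{}" "{}" "{}" "p - 1" a] hom_induced_id[OF that(2)]
    by (simp add: o_def id_def)
  \<comment> \<open>By additivity \<open>d\<close> is a sum of a class on each quadrant, and both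
    come from \<open>W\<close> through the sections at 1 + i and 1 - i. Vanishing in
    \<open>W\<close> makes the two classes of \<open>W\<close> inverse to each other.\<close>
  have CD: "C d = inv\<^bsub>?H ?Q\<^esub> d" if d: "d \<in> carrier (?H ?Q)" "F d = \<one>\<^bsub>?H W\<^esub>" for d
  proof -
    have "openin ?Q (topspace W \<times> cone_lines upper_cone)" "openin ?Q ?tL"
      using sUQ sLQ openin_cone_lines[OF open_cones(4)] openin_cone_lines[OF open_cones(5)]
      by (auto simp: openin_prod_Times_iff openin_subtopology_alt)
    moreover have "disjnt (topspace W \<times> cone_lines upper_cone) ?tL"
    proof -
      have "cone_lines {} = {}" by (auto simp: cone_lines_def lines_of_def)
      then have "cone_lines lower_cone \<inter> cone_lines upper_cone = {}"
        unfolding cone_lines_Int[OF positive_cones(5,4)] cone_sets .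
      then show ?thesis by (auto simp: disjnt_def)
    qed
    moreover have "topspace W \<times> cone_lines upper_cone \<union> ?tL = topspace ?Q"
    proof -
      have "cone_lines (upper_cone \<union> lower_cone) \<subseteq> topspace proj_space"
        unfolding cone_lines_def by (rule lines_of_subset)
      then show ?thesis by (auto simp flip: cone_lines_Un)
    qed
    moreover have "subtopology ?Q (topspace W \<times> cone_lines upper_cone) = ?U" "subtopology ?Q ?tL = ?L"
      using sUQ sLQ by (simp_all add: subtopology_cyl Int_absorb1)
    ultimately have "(\<lambda>(a, b). hom_induced (p - 1) ?U {} ?Q {} id a \<otimes>\<^bsub>?H ?Q\<^esub> hom_induced (p - 1) ?L {} ?Q {} id b)
        ` (carrier (?H ?U) \<times> carrier (?H ?L)) = carrier (?H ?Q)"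
      using homology_additivity_explicit[of ?Q "topspace W \<times> cone_lines upper_cone" ?tL "p - 1"]
      by (simp add: iso_def bij_betw_def)
    with d(1) have "d \<in> (\<lambda>(a, b). hom_induced (p - 1) ?U {} ?Q {} id a \<otimes>\<^bsub>?H ?Q\<^esub> hom_induced (p - 1) ?L {} ?Q {} id b)
        ` (carrier (?H ?U) \<times> carrier (?H ?L))" by simp
    then obtain a b where ab: "a \<in> carrier (?H ?U)" "b \<in> carrier (?H ?L)"
      "d = hom_induced (p - 1) ?U {} ?Q {} id a \<otimes>\<^bsub>?H ?Q\<^esub> hom_induced (p - 1) ?L {} ?Q {} id b"
      by (elim imageE SigmaE) simp
    define a' where "a' = hom_induced (p - 1) ?U {} W {} fst a"
    define b' where "b' = hom_induced (p - 1) ?L {} W {} fst b"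
    have ca: "a' \<in> carrier (?H W)" "b' \<in> carrier (?H W)" by (simp_all add: a'_def b'_def hom_induced_carrier)
    have "a = hom_induced (p - 1) W {} ?U {} (\<lambda>w. (w, affine_line (Complex 1 1))) a'"
      using upper_fst_iso[where W = W and q = "p - 1"] ab(1) unfolding a'_def group_isomorphisms_def by simp
    moreover have "continuous_map W ?U (\<lambda>w. (w, affine_line (Complex 1 1)))"
      using affine_line_in_cone[of "Complex 1 1" upper_cone] affine_line_in_proj_space by (intro continuous_map_pairedI) auto
    ultimately have a: "hom_induced (p - 1) ?U {} ?Q {} id a = s (Complex 1 1) a'"
      by (simp add: s_def hom_induced_compose'[of W ?U _ "{}" "{}" ?Q id "{}"] continuous_map_id_cyl[OF sUQ, of W])
    have "b = hom_induced (p - 1) W {} ?L {} (\<lambda>w. (w, affine_line (Complex 1 (- 1)))) b'"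
      using lower_fst_iso[where W = W and q = "p - 1"] ab(2) unfolding b'_def group_isomorphisms_def by simp
    moreover have "continuous_map W ?L (\<lambda>w. (w, affine_line (Complex 1 (- 1))))"
      using affine_line_in_cone[of "Complex 1 (- 1)" lower_cone] affine_line_in_proj_space by (intro continuous_map_pairedI) auto
    ultimately have b: "hom_induced (p - 1) ?L {} ?Q {} id b = s (Complex 1 (- 1)) b'"
      by (simp add: s_def hom_induced_compose'[of W ?L _ "{}" "{}" ?Q id "{}"] continuous_map_id_cyl[OF sLQ, of W])
    have d': "d = s (Complex 1 1) a' \<otimes>\<^bsub>?H ?Q\<^esub> s (Complex 1 (- 1)) b'" using ab(3) a b by simp
    have cl: "s z a \<in> carrier (?H ?Q)" if "a \<in> carrier (?H W)" for z a
      using group_hom.hom_closed[OF s_hom that] .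
    have "a' \<otimes>\<^bsub>?H W\<^esub> b' = \<one>\<^bsub>?H W\<^esub>" using d(2) ca cl by (simp add: d' Fs)
    then have b': "b' = inv\<^bsub>?H W\<^esub> a'" using ca by (metis HW.inv_equality HW.m_comm)
    have d'': "d = s (Complex 1 1) a' \<otimes>\<^bsub>?H ?Q\<^esub> inv\<^bsub>?H ?Q\<^esub> s (Complex 1 (- 1)) a'"
      using ca by (simp add: d' b' group_hom.hom_inv[OF s_hom])
    have cc: "cnj (Complex 1 1) = Complex 1 (- 1)" "cnj (Complex 1 (- 1)) = Complex 1 1" by (auto simp: complex_eq_iff)
    have "C d = s (Complex 1 (- 1)) a' \<otimes>\<^bsub>?H ?Q\<^esub> inv\<^bsub>?H ?Q\<^esub> s (Complex 1 1) a'"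
      using ca cl by (simp add: d'' Cs cc)
    then show ?thesis using ca cl by (simp add: d'' HQ.inv_mult_group)
  qed
  fix x assume x: "x \<in> carrier (relative_homology_group p ?R ?tQ)"
  define x' where "x' = hom_induced p ?R ?tQ ?R ?tQ conj_cyl x"
  have x': "x' \<in> carrier (relative_homology_group p ?R ?tQ)" by (simp add: x'_def hom_induced_carrier)
  have Dx: "D x \<in> carrier (?H ?Q)" using x by simp
  \<comment> \<open>A boundary dies in \<open>?R\<close>, and the projection from \<open>?Q\<close>
    to \<open>W\<close> factors through \<open>?R\<close>.\<close>
  have "hom_induced (p - 1) ?Q {} ?R {} id (D x) = \<one>\<^bsub>?H ?R\<^esub>"
  proof -
    have "D x \<in> kernel (?H ?Q) (?H ?R) (hom_induced (p - 1) ?Q {} ?R {} id)"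
      using exact_triple_sub[of "{}" ?tQ p ?R] x by (simp add: D_def hom_relboundary_empty subQ)
    then show ?thesis by (simp add: kernel_def)
  qed
  moreover have "F (D x) = hom_induced (p - 1) ?R {} W {} fst (hom_induced (p - 1) ?Q {} ?R {} id (D x))"
    unfolding F_def by (subst hom_induced_compose') (auto simp: continuous_map_id_cyl[OF sQR] continuous_map_fst)
  ultimately have "F (D x) = \<one>\<^bsub>?H W\<^esub>" by (simp add: group_hom.hom_one[OF group_hom_induced])
  from CD[OF Dx this] have "C (D x) = inv\<^bsub>?H ?Q\<^esub> D x" .
  moreover have "D x' = C (D x)"
    using hom_relboundary_conj_comm[OF empty_subsetI sQR conjR conjQ, of p W x]
    by (simp add: D_def C_def x'_def hom_relboundary_empty)
  ultimately have "D (x' \<otimes>\<^bsub>relative_homology_group p ?R ?tQ\<^esub> x) = \<one>\<^bsub>?H ?Q\<^esub>"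
    using HQ.l_inv[OF Dx] by (simp only: D.hom_mult[OF x' x])
  from D_inj[OF RQ.m_closed[OF x' x] this]
  show "x' = inv\<^bsub>relative_homology_group p ?R ?tQ\<^esub> x" using RQ.inv_equality[OF _ x x'] by simp
qed

end

lemma conj_inverts_iso_id:
  assumes iso: "hom_induced p (cyl W Z) (topspace W \<times> A) (cyl W Z') (topspace W \<times> A') id
      \<in> iso (relative_homology_group p (cyl W Z) (topspace W \<times> A)) (relative_homology_group p (cyl W Z') (topspace W \<times> A'))"
    and sub: "Z \<subseteq> Z'" "A \<subseteq> A'"
    and c: "\<And>L. L \<in> Z \<Longrightarrow> conj_line L \<in> Z" "\<And>L. L \<in> Z' \<Longrightarrow> conj_line L \<in> Z'"
      "\<And>L. L \<in> A \<Longrightarrow> conj_line L \<in> A" "\<And>L. L \<in> A' \<Longrightarrow> conj_line L \<in> A'"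
  shows "conj_inverts p W Z A \<longleftrightarrow> conj_inverts p W Z' A'"
  by (rule inv_action_iso[where s = "hom_induced p (cyl W Z) (topspace W \<times> A) (cyl W Z) (topspace W \<times> A) conj_cyl"
        and t = "hom_induced p (cyl W Z') (topspace W \<times> A') (cyl W Z') (topspace W \<times> A') conj_cyl",
        OF group_relative_homology_group group_relative_homology_group iso hom_induced_carrier
        hom_induced_conj_comm[OF sub c]])

lemma conj_cones:
  "L \<in> cone_lines slit_cone \<Longrightarrow> conj_line L \<in> cone_lines slit_cone"
  "L \<in> cone_lines punctured_cone \<Longrightarrow> conj_line L \<in> cone_lines punctured_cone"
  "L \<in> cone_lines right_cone \<Longrightarrow> conj_line L \<in> cone_lines right_cone"
  "L \<in> cone_lines (upper_cone \<union> lower_cone) \<Longrightarrow> conj_line L \<in> cone_lines (upper_cone \<union> lower_cone)"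
  by (erule conj_cone_lines; use positive_cones in auto)+

lemma conj_topspace: "L \<in> topspace proj_space \<Longrightarrow> conj_line L \<in> topspace proj_space"
  by (elim complex_linesE) (simp add: conj_line_span)

lemma conj_base_line: "L \<in> {affine_line (- 1)} \<Longrightarrow> conj_line L \<in> {affine_line (- 1)}"
  by (simp add: conj_affine_line)

lemma base_line_subset: "{affine_line (- 1)} \<subseteq> chart_lines (2::2)" "{affine_line (- 1)} \<subseteq> cone_lines slit_cone"
  using base_line_in_punctured punctured_chart by (auto intro: affine_line_in_cone)

text \<open>All sets in the chain from the right half-plane to CP^1 modulo the base point are stable
  under conjugation, so each isomorphism commutes with it and transports the sign. The boundary
  isomorphism of the chart accounts for the start in degree \<open>p - 1\<close>.\<close>

lemma conj_inverts_proj_base: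
  "conj_inverts p W (topspace (proj_space :: (complex ^ 2) set topology)) {affine_line (- 1)}"
proof -
  have 1: "cone_lines right_cone \<subseteq> cone_lines punctured_cone"
    "cone_lines (upper_cone \<union> lower_cone) \<subseteq> cone_lines slit_cone"
    by (rule cone_lines_mono; auto)+
  have "conj_inverts (p - 1) W (cone_lines punctured_cone) (cone_lines slit_cone)"
    using conj_inverts_iso_id[where p = "p - 1" and W = W, OF punctured_cone_excision 1 conj_cones(3,2,4,1)]
      conj_inverts_right[where p = "p - 1" and W = W]
    by (simp only:)
  then have "conj_inverts (p - 1) W (cone_lines punctured_cone) {affine_line (- 1)}"
    using conj_inverts_iso_id[where p = "p - 1" and W = W, OF punctured_cone_base_iso order_refl base_line_subset(2) conj_cones(2,2) conj_base_line conj_cones(1)]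
    by (simp only:)
  moreover have "conj_inverts p W (chart_lines (1::2)) (cone_lines punctured_cone) \<longleftrightarrow>
      conj_inverts (p - 1) W (cone_lines punctured_cone) {affine_line (- 1)}"
    by (rule inv_action_iso[where s = "hom_induced p (cyl W (chart_lines (1::2))) (topspace W \<times> cone_lines punctured_cone)
          (cyl W (chart_lines (1::2))) (topspace W \<times> cone_lines punctured_cone) conj_cyl"
        and t = "hom_induced (p - 1) (cyl W (cone_lines punctured_cone)) (topspace W \<times> {affine_line (- 1)})
          (cyl W (cone_lines punctured_cone)) (topspace W \<times> {affine_line (- 1)}) conj_cyl",
        OF group_relative_homology_group group_relative_homology_group chart_relboundary_iso hom_induced_carrier
        hom_relboundary_conj_comm[OF base_line_in_punctured punctured_chart(1) conj_chart_lines conj_cones(2) conj_base_line]])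
  ultimately have "conj_inverts p W (chart_lines (1::2)) (cone_lines punctured_cone)"
    by (simp only:)
  then have "conj_inverts p W (topspace (proj_space :: (complex ^ 2) set topology)) (chart_lines 2)"
    using conj_inverts_iso_id[where p = p and W = W, OF chart_excision lines_of_subset punctured_chart(2) conj_chart_lines conj_topspace conj_cones(2) conj_chart_lines]
    by (simp only:)
  then show ?thesis
    using conj_inverts_iso_id[where p = p and W = W, OF proj_base_iso order_refl base_line_subset(1) conj_topspace conj_topspace conj_base_line conj_chart_lines]
    by (simp only:)
qed

section \<open>Absolute homology of W x CP^1\<close>

lemma subtopology_prod_point:
  assumes "L0 \<in> topspace Y"
  shows "topspace W \<times> {L0} retract_of_space prod_topology W Y"
    and "homeomorphic_maps (subtopology (prod_topology W Y) (topspace W \<times> {L0})) W fst (\<lambda>w. (w, L0))"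
proof -
  have c: "continuous_map W (prod_topology W Y) (\<lambda>w. (w, L0))"
    using assms by (intro continuous_map_pairedI) auto
  have "continuous_map (prod_topology W Y) (prod_topology W Y) ((\<lambda>w. (w, L0)) \<circ> fst)"
    by (rule continuous_map_compose[OF continuous_map_fst c])
  then show "topspace W \<times> {L0} retract_of_space prod_topology W Y"
    using assms unfolding retract_of_space_def
    by (auto simp: continuous_map_in_subtopology o_def intro!: exI[of _ "\<lambda>z. (fst z, L0)"])
  show "homeomorphic_maps (subtopology (prod_topology W Y) (topspace W \<times> {L0})) W fst (\<lambda>w. (w, L0))"
    using c by (auto simp: homeomorphic_maps_def continuous_map_in_subtopology continuous_map_fst intro: continuous_map_from_subtopology)
qed

text \<open>A class that vanishes relative to the section comes from the section, and there
  \<open>fst\<close> is an isomorphism. Thus the projection and the relative class together detect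
  everything.\<close>

lemma kernel_fst_inj_relative:
  assumes L0: "L0 \<in> topspace Y" and x: "x \<in> carrier (homology_group p (prod_topology W Y))"
    and fst: "hom_induced p (prod_topology W Y) {} W {} fst x = \<one>\<^bsub>homology_group p W\<^esub>"
    and rel: "hom_induced p (prod_topology W Y) {} (prod_topology W Y) (topspace W \<times> {L0}) id x =
      \<one>\<^bsub>relative_homology_group p (prod_topology W Y) (topspace W \<times> {L0})\<^esub>"
  shows "x = \<one>\<^bsub>homology_group p (prod_topology W Y)\<^esub>"
proof -
  let ?X = "prod_topology W Y" and ?S = "topspace W \<times> {L0}"
  have "x \<in> kernel (homology_group p ?X) (relative_homology_group p ?X ?S) (hom_induced p ?X {} ?X ?S id)"
    using x rel by (simp add: kernel_def)
  then obtain y where y: "y \<in> carrier (homology_group p (subtopology ?X ?S))"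
    "x = hom_induced p (subtopology ?X ?S) {} ?X {} id y"
    using exact_triple_mid[of "{}" ?S p ?X] by auto
  have "hom_induced p (subtopology ?X ?S) {} W {} fst \<in> iso (homology_group p (subtopology ?X ?S)) (homology_group p W)"
    using subtopology_prod_point(2)[OF L0, of W] homeomorphic_map_homology_iso homeomorphic_maps_map by blast
  moreover have "hom_induced p (subtopology ?X ?S) {} W {} fst y = \<one>\<^bsub>homology_group p W\<^esub>"
    using fst unfolding y(2)
    by (subst (asm) hom_induced_compose') (auto simp: continuous_map_fst continuous_map_from_subtopology)
  ultimately have "y = \<one>\<^bsub>homology_group p (subtopology ?X ?S)\<^esub>"
    using y(1) group_hom.iso_iff[OF group_hom_induced] by blast
  then show ?thesis by (simp add: y(2) group_hom.hom_one[OF group_hom_induced])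
qed

text \<open>The sum of \<open>x\<close> and its conjugate vanishes relative to the section by
  \<open>conj_inverts_proj_base\<close>. Conjugation commutes with \<open>fst\<close>, so the sum
  also vanishes in \<open>W\<close>, and \<open>kernel_fst_inj_relative\<close> applies to
  it.\<close>

lemma conj_inverts_kernel_fst:
  fixes W :: "'w topology"
  defines "X \<equiv> prod_topology W (proj_space :: (complex ^ 2) set topology)"
  assumes x: "x \<in> carrier (homology_group p X)" and fst: "hom_induced p X {} W {} fst x = \<one>\<^bsub>homology_group p W\<^esub>"
  shows "hom_induced p X {} X {} conj_cyl x = inv\<^bsub>homology_group p X\<^esub> x"
proof -
  let ?S = "topspace W \<times> {affine_line (- 1)}"
  let ?i = "hom_induced p X {} X ?S id"
  interpret X: comm_group "homology_group p X" by simp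
  interpret R: comm_group "relative_homology_group p X ?S" by simp
  interpret i: group_hom "homology_group p X" "relative_homology_group p X ?S" ?i by (rule group_hom_induced)
  interpret f: group_hom "homology_group p X" "homology_group p W" "hom_induced p X {} W {} fst" by (rule group_hom_induced)
  have cont: "continuous_map X X conj_cyl"
    using continuous_map_conj_cyl[where W = W and Z = "topspace proj_space", OF conj_topspace] by (simp add: X_def)
  define x' where "x' = hom_induced p X {} X {} conj_cyl x"
  have x': "x' \<in> carrier (homology_group p X)" by (simp add: x'_def hom_induced_carrier)
  have "?i x' = hom_induced p X ?S X ?S conj_cyl (?i x)"
    unfolding x'_def using cont conj_base_line
    by (subst hom_induced_compose'; (subst hom_induced_compose')?) (auto simp: conj_affine_line)
  also have "\<dots> = inv\<^bsub>relative_homology_group p X ?S\<^esub> (?i x)"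
    using conj_inverts_proj_base[of p W] i.hom_closed[OF x] by (simp add: X_def)
  finally have "?i (x' \<otimes>\<^bsub>homology_group p X\<^esub> x) = \<one>\<^bsub>relative_homology_group p X ?S\<^esub>"
    using i.hom_mult[OF x' x] R.l_inv[OF i.hom_closed[OF x]] by simp
  moreover have "hom_induced p X {} W {} fst x' = hom_induced p X {} W {} fst x"
    unfolding x'_def using cont
    by (subst hom_induced_compose') (auto simp: X_def continuous_map_fst o_def case_prod_unfold)
  then have "hom_induced p X {} W {} fst (x' \<otimes>\<^bsub>homology_group p X\<^esub> x) = \<one>\<^bsub>homology_group p W\<^esub>"
    using x x' fst by simp
  ultimately have "x' \<otimes>\<^bsub>homology_group p X\<^esub> x = \<one>\<^bsub>homology_group p X\<^esub>"
    using kernel_fst_inj_relative[OF affine_line_in_proj_space, of "x' \<otimes>\<^bsub>homology_group p X\<^esub> x" p W "- 1"] X.m_closed[OF x' x]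
    by (simp add: X_def)
  then show ?thesis using X.inv_equality[OF _ x x'] by (simp add: x'_def)
qed

text \<open>The section over the base point is a retract and splits off the homology of
  \<open>W\<close>. The complementary relative group is led through the excisions to a single
  quadrant; the degree drops by one at each of the two boundary isomorphisms.\<close>

lemma abelian_rank_homology_prod_proj_line:
  "abelian_rank (homology_group p (prod_topology W (proj_space :: (complex ^ 2) set topology))) =
    abelian_rank (homology_group p W) + abelian_rank (homology_group (p - 2) W)"
proof -
  let ?X = "prod_topology W (proj_space :: (complex ^ 2) set topology)"
  let ?S = "topspace W \<times> {affine_line (- 1)}"
  have cyl: "cyl W (topspace proj_space) = ?X" by simp
  have iso: "abelian_rank (relative_homology_group p X S) = abelian_rank (relative_homology_group q Y T)"
    if "f \<in> iso (relative_homology_group p X S) (relative_homology_group q Y T)"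
    for p q f and X :: "'b topology" and Y :: "'c topology" and S T
    using that by (intro abelian_rank_iso) (auto simp: is_iso_def)
  have "abelian_rank (homology_group p ?X) =
      abelian_rank (homology_group p (subtopology ?X ?S) \<times>\<times> relative_homology_group p ?X ?S)"
    using subtopology_prod_point(1)[OF affine_line_in_proj_space, of W "- 1"] isomorphic_group_homology_group_prod_retract[of ?S ?X p]
    by (intro abelian_rank_iso comm_group_DirProd) auto
  also have "\<dots> = abelian_rank (homology_group p (subtopology ?X ?S)) + abelian_rank (relative_homology_group p ?X ?S)"
    by (intro abelian_rank_DirProd) auto
  also have "abelian_rank (homology_group p (subtopology ?X ?S)) = abelian_rank (homology_group p W)"
    using subtopology_prod_point(2)[OF affine_line_in_proj_space, of W "- 1"]
    by (intro iso[OF homeomorphic_map_homology_iso[where f = fst]]) (simp add: homeomorphic_maps_map)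
  also have "abelian_rank (relative_homology_group p ?X ?S) = abelian_rank (relative_homology_group p ?X (topspace W \<times> chart_lines 2))"
    using iso[OF proj_base_iso, of p W] by simp
  also have "\<dots> = abelian_rank (relative_homology_group p (cyl W (chart_lines (1::2))) (topspace W \<times> cone_lines punctured_cone))"
    using iso[OF chart_excision, of p W] by simp
  also have "\<dots> = abelian_rank (relative_homology_group (p - 1) (cyl W (cone_lines punctured_cone)) ?S)"
    by (rule iso[OF chart_relboundary_iso])
  also have "\<dots> = abelian_rank (relative_homology_group (p - 1) (cyl W (cone_lines punctured_cone)) (topspace W \<times> cone_lines slit_cone))"
    by (rule iso[OF punctured_cone_base_iso])
  also have "\<dots> = abelian_rank (relative_homology_group (p - 1) (cyl W (cone_lines right_cone)) (topspace W \<times> cone_lines (upper_cone \<union> lower_cone)))"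
    by (rule iso[OF punctured_cone_excision, symmetric])
  also have "\<dots> = abelian_rank (relative_homology_group (p - 1 - 1) (cyl W (cone_lines (upper_cone \<union> lower_cone))) (topspace W \<times> cone_lines lower_cone))"
    by (rule iso[OF right_relboundary_iso])
  also have "\<dots> = abelian_rank (homology_group (p - 1 - 1) (cyl W (cone_lines upper_cone)))"
    by (rule iso[OF upper_excision, symmetric])
  also have "\<dots> = abelian_rank (homology_group (p - 1 - 1) W)"
    by (rule iso, rule group_isomorphisms_imp_iso[OF upper_fst_iso]) auto
  finally show ?thesis by simp
qed

section \<open>The product with the projective plane\<close>

lemma id_action_iso:
  assumes \<phi>: "\<phi> \<in> iso G H"
    and s: "\<And>c. c \<in> carrier G \<Longrightarrow> s c \<in> carrier G"
    and comm: "\<And>c. c \<in> carrier G \<Longrightarrow> \<phi> (s c) = t (\<phi> c)"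
  shows "(\<forall>c \<in> carrier G. s c = c) \<longleftrightarrow> (\<forall>d \<in> carrier H. t d = d)"
proof -
  have im: "carrier H = \<phi> ` carrier G" and inj: "inj_on \<phi> (carrier G)"
    using \<phi> by (auto simp: iso_def bij_betw_def)
  have "(\<forall>d \<in> carrier H. t d = d) \<longleftrightarrow> (\<forall>c \<in> carrier G. \<phi> (s c) = \<phi> c)"
    unfolding im using comm by auto
  also have "\<dots> \<longleftrightarrow> (\<forall>c \<in> carrier G. s c = c)"
    by (intro ball_cong refl inj_on_eq_iff[OF inj] s)
  finally show ?thesis by simp
qed

abbreviation conj_fixes :: "int \<Rightarrow> 'w topology \<Rightarrow> (complex ^ 'n) set set \<Rightarrow> (complex ^ 'n) set set \<Rightarrow> bool" where
  "conj_fixes p W Z A \<equiv> (\<forall>x \<in> carrier (relative_homology_group p (cyl W Z) (topspace W \<times> A)).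
     hom_induced p (cyl W Z) (topspace W \<times> A) (cyl W Z) (topspace W \<times> A) conj_cyl x = x)"

lemma conj_fixes_iso_id:
  assumes iso: "hom_induced p (cyl W Z) (topspace W \<times> A) (cyl W Z') (topspace W \<times> A') id
      \<in> iso (relative_homology_group p (cyl W Z) (topspace W \<times> A)) (relative_homology_group p (cyl W Z') (topspace W \<times> A'))"
    and sub: "Z \<subseteq> Z'" "A \<subseteq> A'"
    and c: "\<And>L. L \<in> Z \<Longrightarrow> conj_line L \<in> Z" "\<And>L. L \<in> Z' \<Longrightarrow> conj_line L \<in> Z'"
      "\<And>L. L \<in> A \<Longrightarrow> conj_line L \<in> A" "\<And>L. L \<in> A' \<Longrightarrow> conj_line L \<in> A'"
  shows "conj_fixes p W Z A \<longleftrightarrow> conj_fixes p W Z' A'"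
  by (rule id_action_iso[where s = "hom_induced p (cyl W Z) (topspace W \<times> A) (cyl W Z) (topspace W \<times> A) conj_cyl"
        and t = "hom_induced p (cyl W Z') (topspace W \<times> A') (cyl W Z') (topspace W \<times> A') conj_cyl",
        OF iso hom_induced_carrier hom_induced_conj_comm[OF sub c]])

text \<open>Keeps the coordinate indices symbolic, so that the three charts of CP^2 are handled by
  one argument.\<close>

lemma forall_3_distinct:
  fixes i j k :: 3
  assumes "distinct [i, j, k]"
  shows "(\<forall>m. P m) \<longleftrightarrow> P i \<and> P j \<and> P k"
proof -
  have "m = i \<or> m = j \<or> m = k" for m
    using assms exhaust_3[of m] exhaust_3[of i] exhaust_3[of j] exhaust_3[of k] by auto
  then show ?thesis by metis
qed

definition embed_coords :: "'n \<Rightarrow> 'n \<Rightarrow> complex ^ 2 \<Rightarrow> complex ^ 'n" where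
  "embed_coords j k y = (\<chi> m. if m = j then y $ 1 else if m = k then y $ 2 else 0)"

definition proj_coords :: "'n \<Rightarrow> 'n \<Rightarrow> complex ^ 'n \<Rightarrow> complex ^ 2" where
  "proj_coords j k v = (\<chi> m. if m = 1 then v $ j else v $ k)"

lemma embed_coords_nth: "embed_coords j k y $ m = (if m = j then y $ 1 else if m = k then y $ 2 else 0)"
  by (simp add: embed_coords_def)

lemma proj_coords_nth: "proj_coords j k v $ 1 = v $ j" "proj_coords j k v $ 2 = v $ k"
  by (simp_all add: proj_coords_def)

lemma proj_embed_coords: "j \<noteq> k \<Longrightarrow> proj_coords j k (embed_coords j k y) = y"
  by (simp add: vec_eq_iff forall_2 proj_coords_nth embed_coords_nth)

lemma continuous_on_embed_coords: "continuous_on S (embed_coords j k)"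
  unfolding embed_coords_def
proof (rule continuous_on_vec_lambda)
  show "continuous_on S (\<lambda>y :: complex ^ 2. if m = j then y $ 1 else if m = k then y $ 2 else 0)" for m
    by (cases "m = j"; cases "m = k") (auto intro!: continuous_intros)
qed

lemma continuous_on_proj_coords: "continuous_on S (proj_coords j k)"
  unfolding proj_coords_def
proof (rule continuous_on_vec_lambda)
  show "continuous_on S (\<lambda>v :: complex ^ 'a. if m = 1 then v $ j else v $ k)" for m :: 2
    by (cases "m = 1") (auto intro!: continuous_intros)
qed

lemma line_preserving_embed_coords: "line_preserving (embed_coords j k)"
  by (intro line_preserving_if_linear) (simp add: vec_eq_iff embed_coords_nth)

lemma line_preserving_proj_coords: "line_preserving (proj_coords j k)"
  by (intro line_preserving_if_linear) (simp add: vec_eq_iff forall_2 proj_coords_nth)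

lemma embed_coords_neq_0: "j \<noteq> k \<Longrightarrow> y \<noteq> 0 \<Longrightarrow> embed_coords j k y \<noteq> 0"
  using proj_embed_coords[of j k y] by (auto simp: vec_eq_iff forall_2 proj_coords_nth) metis+

lemma conj_embed_coords: "conj_vec (embed_coords j k y) = embed_coords j k (conj_vec y)"
  by (simp add: vec_eq_iff embed_coords_nth)

abbreviation plane_lines :: "'n \<Rightarrow> (complex ^ 'n) set set" where
  "plane_lines i \<equiv> lines_of {v. v $ i = 0}"

text \<open>With \<open>i\<close> the third index, this is CP^2 without the \<open>i\<close>-th
  coordinate axis, the centre of \<open>chart_lines i\<close>.\<close>

definition off_axis_lines :: "'n \<Rightarrow> 'n \<Rightarrow> (complex ^ 'n) set set" where
  "off_axis_lines j k = lines_of {v. v $ j \<noteq> 0 \<or> v $ k \<noteq> 0}"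

lemma span_in_plane_lines: "vec.span {x} \<in> plane_lines i \<longleftrightarrow> x \<noteq> 0 \<and> x $ i = 0"
  by (subst span_in_lines_of) (auto simp: scale_invariant_def)

lemma span_in_off_axis_lines: "vec.span {x} \<in> off_axis_lines j k \<longleftrightarrow> x $ j \<noteq> 0 \<or> x $ k \<noteq> 0"
  unfolding off_axis_lines_def by (subst span_in_lines_of) (auto simp: scale_invariant_def)

lemma openin_off_axis_lines: "openin proj_space (off_axis_lines j k)"
  unfolding off_axis_lines_def
  by (intro openin_lines_of open_Collect_disj open_Collect_neq continuous_intros)

lemma lines_subset_iff:
  assumes "A \<subseteq> topspace proj_space"
  shows "A \<subseteq> B \<longleftrightarrow> (\<forall>x. x \<noteq> 0 \<longrightarrow> vec.span {x} \<in> A \<longrightarrow> vec.span {x} \<in> B)"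
  using assms complex_linesE by (metis subset_iff)

lemma plane_subset_off_axis:
  fixes i j k :: 3
  assumes "distinct [i, j, k]"
  shows "plane_lines i \<subseteq> off_axis_lines j k"
  unfolding lines_subset_iff[OF lines_of_subset] span_in_plane_lines span_in_off_axis_lines
  using forall_3_distinct[OF assms] by (auto simp: vec_eq_iff)

lemma off_axis_Un_chart:
  fixes i j k :: 3
  assumes "distinct [i, j, k]"
  shows "off_axis_lines j k \<union> chart_lines i = topspace proj_space"
proof (rule antisym)
  show "topspace proj_space \<subseteq> off_axis_lines j k \<union> chart_lines i"
    unfolding lines_subset_iff[OF order_refl] Un_iff span_in_off_axis_lines span_in_chart_lines
    using forall_3_distinct[OF assms] by (auto simp: vec_eq_iff)
qed (use lines_of_subset in \<open>auto simp: off_axis_lines_def\<close>)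

lemma conj_off_axis_lines: "L \<in> off_axis_lines j k \<Longrightarrow> conj_line L \<in> off_axis_lines j k"
  unfolding off_axis_lines_def lines_of_def by (auto simp: conj_line_span)

lemma conj_plane_lines: "L \<in> plane_lines i \<Longrightarrow> conj_line L \<in> plane_lines i"
  unfolding lines_of_def by (auto simp: conj_line_span)

text \<open>On the chart \<open>v\<^sub>i \<noteq> 0\<close> with affine coordinates \<open>u = v / v\<^sub>i\<close>, conjugation is joined to the
  identity by rotating the imaginary part \<open>(Im u\<^sub>j, Im u\<^sub>k)\<close> through a half turn. The formula is
  multiplied by \<open>\<bar>v\<^sub>i\<bar>\<^sup>2\<close>.\<close>

definition chart_rotation :: "3 \<Rightarrow> 3 \<Rightarrow> 3 \<Rightarrow> real \<Rightarrow> complex ^ 3 \<Rightarrow> complex ^ 3" where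
  "chart_rotation i j k t v = (\<chi> m.
     if m = i then v $ i * cnj (v $ i)
     else if m = j then Complex (Re (v $ j * cnj (v $ i)))
       (cos (pi * t) * Im (v $ j * cnj (v $ i)) - sin (pi * t) * Im (v $ k * cnj (v $ i)))
     else Complex (Re (v $ k * cnj (v $ i)))
       (sin (pi * t) * Im (v $ j * cnj (v $ i)) + cos (pi * t) * Im (v $ k * cnj (v $ i))))"

lemma chart_rotation_nth:
  assumes "distinct [i, j, k]"
  shows "chart_rotation i j k t v $ i = v $ i * cnj (v $ i)"
    and "chart_rotation i j k t v $ j = Complex (Re (v $ j * cnj (v $ i)))
       (cos (pi * t) * Im (v $ j * cnj (v $ i)) - sin (pi * t) * Im (v $ k * cnj (v $ i)))"
    and "chart_rotation i j k t v $ k = Complex (Re (v $ k * cnj (v $ i)))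
       (sin (pi * t) * Im (v $ j * cnj (v $ i)) + cos (pi * t) * Im (v $ k * cnj (v $ i)))"
  using assms by (auto simp: chart_rotation_def)

lemma continuous_on_chart_rotation: "continuous_on S (\<lambda>(t, v). chart_rotation i j k t v)"
  unfolding chart_rotation_def case_prod_unfold
proof (rule continuous_on_vec_lambda)
  fix m :: 3
  show "continuous_on S (\<lambda>x. if m = i then snd x $ i * cnj (snd x $ i)
     else if m = j then Complex (Re (snd x $ j * cnj (snd x $ i)))
       (cos (pi * fst x) * Im (snd x $ j * cnj (snd x $ i)) - sin (pi * fst x) * Im (snd x $ k * cnj (snd x $ i)))
     else Complex (Re (snd x $ k * cnj (snd x $ i)))
       (sin (pi * fst x) * Im (snd x $ j * cnj (snd x $ i)) + cos (pi * fst x) * Im (snd x $ k * cnj (snd x $ i))))"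
    by (cases "m = i"; cases "m = j") (auto intro!: continuous_intros)
qed

lemma line_preserving_chart_rotation:
  assumes "distinct [i, j, k]"
  shows "line_preserving (chart_rotation i j k t)"
  unfolding line_preserving_def vec.span_singleton
proof (intro allI)
  fix c :: complex and v :: "complex ^ 3"
  define r where "r = (cmod c)\<^sup>2"
  have r: "(c * z) * cnj (c * z') = of_real r * (z * cnj z')" for z z'
    unfolding r_def complex_norm_square by simp
  have "chart_rotation i j k t (c *s v) = of_real r *s chart_rotation i j k t v"
    unfolding vec_eq_iff forall_3_distinct[OF assms] vector_smult_component
      chart_rotation_nth[OF assms] r
    by (auto simp: complex_eq_iff algebra_simps)
  then show "chart_rotation i j k t (c *s v) \<in> range (\<lambda>c. c *s chart_rotation i j k t v)" by (rule range_eqI)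
qed

lemma chart_rotation_0:
  assumes "distinct [i, j, k]"
  shows "chart_rotation i j k 0 v = cnj (v $ i) *s v"
  unfolding vec_eq_iff forall_3_distinct[OF assms] vector_smult_component chart_rotation_nth[OF assms]
  by (simp add: complex_eq_iff algebra_simps)

lemma chart_rotation_1:
  assumes "distinct [i, j, k]"
  shows "chart_rotation i j k 1 v = v $ i *s conj_vec v"
  unfolding vec_eq_iff forall_3_distinct[OF assms] vector_smult_component chart_rotation_nth[OF assms]
  by (simp add: complex_eq_iff algebra_simps)

text \<open>The inverse rotation recovers \<open>a\<close> and \<open>b\<close>.\<close>

lemma rotation_eq_0:
  fixes a b c s :: real
  assumes "c\<^sup>2 + s\<^sup>2 = 1" "c * a - s * b = 0" "s * a + c * b = 0"
  shows "a = 0 \<and> b = 0"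
proof -
  have "a = c * (c * a - s * b) + s * (s * a + c * b) + (1 - (c\<^sup>2 + s\<^sup>2)) * a"
    by (simp add: algebra_simps power2_eq_square)
  also have "\<dots> = 0" unfolding assms by simp
  finally have "a = 0" .
  have "b = c * (s * a + c * b) - s * (c * a - s * b) + (1 - (c\<^sup>2 + s\<^sup>2)) * b"
    by (simp add: algebra_simps power2_eq_square)
  also have "\<dots> = 0" unfolding assms by simp
  finally show ?thesis using \<open>a = 0\<close> by simp
qed

lemma chart_rotation_off_axis:
  assumes "distinct [i, j, k]" "v $ i \<noteq> 0" "v $ j \<noteq> 0 \<or> v $ k \<noteq> 0"
  shows "chart_rotation i j k t v $ j \<noteq> 0 \<or> chart_rotation i j k t v $ k \<noteq> 0"
proof (rule ccontr)
  assume "\<not> ?thesis"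
  then have *: "Re (v $ j * cnj (v $ i)) = 0" "Re (v $ k * cnj (v $ i)) = 0"
    "cos (pi * t) * Im (v $ j * cnj (v $ i)) - sin (pi * t) * Im (v $ k * cnj (v $ i)) = 0"
    "sin (pi * t) * Im (v $ j * cnj (v $ i)) + cos (pi * t) * Im (v $ k * cnj (v $ i)) = 0"
    unfolding chart_rotation_nth[OF assms(1)] by (auto simp: complex_eq_iff)
  from rotation_eq_0[OF _ *(3,4)] have "Im (v $ j * cnj (v $ i)) = 0 \<and> Im (v $ k * cnj (v $ i)) = 0" by simp
  then have "v $ j * cnj (v $ i) = 0" "v $ k * cnj (v $ i) = 0" using * by (simp_all only: complex_eq_iff) auto
  then show False using assms by simp
qed

text \<open>At times 0 and 1 the rotation is a scalar multiple of the identity and of conjugation,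
  so on lines it joins the two, without leaving the chart or meeting its centre. It exists because
  the imaginary part of the affine coordinates has two real dimensions, where -1 is a half turn; in
  the chart of CP^1 there is only one, and the sign is opposite.\<close>

lemma conj_fixes_chart:
  fixes i j k :: 3
  assumes ijk: "distinct [i, j, k]"
  shows "conj_fixes p W (chart_lines i) (off_axis_lines j k \<inter> chart_lines i)"
proof
  let ?D = "cyl W (chart_lines i)" and ?A = "topspace W \<times> (off_axis_lines j k \<inter> chart_lines i)"
  fix x assume x: "x \<in> carrier (relative_homology_group p ?D ?A)"
  let ?m = "\<lambda>t. \<lambda>(w, L). (w, line_map (chart_rotation i j k t) L)"
  have nz: "chart_rotation i j k t v \<noteq> 0 \<and> vec.span {chart_rotation i j k t v} \<in> chart_lines i"
    if "vec.span {v} \<in> chart_lines i" for t v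
    using that chart_rotation_nth(1)[OF ijk, of t v]
    by (auto simp: span_in_chart_lines)
  have "homotopic_with (\<lambda>h. h \<in> ?A \<rightarrow> ?A) ?D ?D (?m 0) (?m 1)"
  proof (intro homotopic_line_maps continuous_map_snd_proj)
    show "vec.span {chart_rotation i j k t v} \<in> off_axis_lines j k \<inter> chart_lines i"
      if "vec.span {v} \<in> off_axis_lines j k \<inter> chart_lines i" for t v
      using that nz[of v t] chart_rotation_off_axis[OF ijk, of v t]
      by (simp add: span_in_off_axis_lines span_in_chart_lines)
  qed (use nz ijk in \<open>auto simp: openin_chart_lines continuous_on_chart_rotation line_preserving_chart_rotation
        simp del: distinct.simps\<close>)
  then have "hom_induced p ?D ?A ?D ?A (?m 0) = hom_induced p ?D ?A ?D ?A (?m 1)"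
    by (rule homology_homotopy_axiom)
  moreover have span: "vec.span {c *s v} = vec.span {v}" if "c \<noteq> 0" "v \<noteq> 0" for c and v :: "complex ^ 3"
    using that span_singleton_eq_iff by blast
  have ex: "\<exists>v. L = vec.span {v} \<and> v $ i \<noteq> 0 \<and> v \<noteq> 0" if "L \<in> chart_lines i" for L
    using that unfolding lines_of_def by blast
  have "?m 0 z = id z" if z: "z \<in> topspace ?D" for z
  proof -
    obtain w L where L: "z = (w, L)" "L \<in> chart_lines i" using z by (cases z) auto
    from ex[OF L(2)] L(1) obtain v where "z = (w, vec.span {v})" "v $ i \<noteq> 0" "v \<noteq> 0" by auto
    then show ?thesis using span[of "cnj (v $ i)" v]
      by (auto simp: line_map_span line_preserving_chart_rotation[OF ijk] chart_rotation_0[OF ijk])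
  qed
  then have "hom_induced p ?D ?A ?D ?A (?m 0) = hom_induced p ?D ?A ?D ?A id" by (rule hom_induced_eq)
  moreover have "?m 1 z = conj_cyl z" if z: "z \<in> topspace ?D" for z
  proof -
    obtain w L where L: "z = (w, L)" "L \<in> chart_lines i" using z by (cases z) auto
    from ex[OF L(2)] L(1) obtain v where "z = (w, vec.span {v})" "v $ i \<noteq> 0" "v \<noteq> 0" by auto
    then show ?thesis using span[of "v $ i" "conj_vec v"]
      by (auto simp: line_map_span line_preserving_chart_rotation[OF ijk] chart_rotation_1[OF ijk] conj_line_span)
  qed
  then have "hom_induced p ?D ?A ?D ?A (?m 1) = hom_induced p ?D ?A ?D ?A conj_cyl" by (rule hom_induced_eq)
  ultimately show "hom_induced p ?D ?A ?D ?A conj_cyl x = x" using hom_induced_id[OF x] by simp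
qed

text \<open>The plane without the centre of the chart deforms onto the coordinate line v_i = 0.
  Excision then replaces CP^2 modulo that line by the chart modulo the chart without its centre,
  where \<open>conj_fixes_chart\<close> applies.\<close>

lemma conj_fixes_plane:
  fixes i :: 3
  assumes ijk: "distinct [i, j, k]"
  shows "conj_fixes p W (topspace proj_space) (plane_lines i)"
proof -
  \<comment> \<open>Shrinks the \<open>i\<close>-th coordinate to 0. The other two do not move, so a
    line off the axis stays off the axis.\<close>
  define T where "T = (\<lambda>(t::real) v :: complex ^ 3. \<chi> m. if m = i then of_real t * v $ i else v $ m)"
  have T: "T t v $ i = of_real t * v $ i" "T t v $ j = v $ j" "T t v $ k = v $ k" for t v
    using ijk by (auto simp: T_def)
  have contT: "continuous_on S (\<lambda>(t, v). T t v)" for S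
    unfolding T_def case_prod_unfold
  proof (rule continuous_on_vec_lambda)
    show "continuous_on S (\<lambda>x. if m = i then of_real (fst x) * snd x $ i else snd x $ m)" for m
      by (cases "m = i") (auto intro!: continuous_intros)
  qed
  have "trivial_group (relative_homology_group p (cyl W (off_axis_lines j k)) (topspace W \<times> plane_lines i))" for p
  proof (rule trivial_cyl_pair[OF openin_off_axis_lines plane_subset_off_axis[OF ijk] contT])
    show "line_preserving (T t)" for t
      by (intro line_preserving_if_linear) (simp add: vec_eq_iff T_def)
    show "T t x \<noteq> 0 \<and> vec.span {T t x} \<in> off_axis_lines j k" if "vec.span {x} \<in> off_axis_lines j k" for t x
      using that T[of t x] by (auto simp: span_in_off_axis_lines)
    show "vec.span {T t x} \<in> plane_lines i" if "vec.span {x} \<in> plane_lines i" for t x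
    proof -
      have "T t x = x" using that by (auto simp: span_in_plane_lines T_def vec_eq_iff)
      then show ?thesis using that by simp
    qed
    show "T 1 x = x" for x by (simp add: T_def vec_eq_iff)
    show "vec.span {T 0 x} \<in> plane_lines i" if "vec.span {x} \<in> off_axis_lines j k" for x
      using that T[of 0 x] by (auto simp: span_in_off_axis_lines span_in_plane_lines)
  qed
  then have iso1: "hom_induced p (cyl W (topspace proj_space)) (topspace W \<times> plane_lines i) (cyl W (topspace proj_space)) (topspace W \<times> off_axis_lines j k) id
    \<in> iso (relative_homology_group p (cyl W (topspace proj_space)) (topspace W \<times> plane_lines i))
      (relative_homology_group p (cyl W (topspace proj_space)) (topspace W \<times> off_axis_lines j k))"
    using plane_subset_off_axis[OF ijk] lines_of_subset
    by (intro cyl_iso_if_trivial_sub_pair) (auto simp: off_axis_lines_def)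
  have iso2: "hom_induced p (cyl W (chart_lines i)) (topspace W \<times> (off_axis_lines j k \<inter> chart_lines i))
      (cyl W (topspace proj_space)) (topspace W \<times> off_axis_lines j k) id
    \<in> iso (relative_homology_group p (cyl W (chart_lines i)) (topspace W \<times> (off_axis_lines j k \<inter> chart_lines i)))
      (relative_homology_group p (cyl W (topspace proj_space)) (topspace W \<times> off_axis_lines j k))"
    using cyl_excision[OF openin_off_axis_lines[of j k] openin_chart_lines[of i], of p W]
    unfolding off_axis_Un_chart[OF ijk] .
  have cc: "conj_line L \<in> off_axis_lines j k \<inter> chart_lines i" if "L \<in> off_axis_lines j k \<inter> chart_lines i" for L
    using that conj_chart_lines conj_off_axis_lines by blast
  have "conj_fixes p W (topspace proj_space) (off_axis_lines j k)"
    using conj_fixes_chart[OF ijk, of p W]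
      conj_fixes_iso_id[where p = p and W = W, OF iso2 lines_of_subset inf_le1 conj_chart_lines conj_topspace cc conj_off_axis_lines]
    by (simp only:)
  then show ?thesis
    using conj_fixes_iso_id[where p = p and W = W, OF iso1 order_refl plane_subset_off_axis[OF ijk] conj_topspace conj_topspace conj_plane_lines conj_off_axis_lines]
    by (simp only:)
qed

lemma lines_ofE:
  assumes "L \<in> lines_of S"
  obtains v where "v \<noteq> 0" "v \<in> S" "L = vec.span {v}"
  using assms unfolding lines_of_def by (elim imageE) auto

section \<open>The endomorphism 2 r + 1 - s\<close>

definition real_line :: "(complex ^ 'n) set" where
  "real_line = vec.span {(\<chi> m. 1) :: complex ^ 'n}"

lemma real_line_in_proj_space: "real_line \<in> topspace proj_space"
  by (simp add: real_line_def vec_eq_iff)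

lemma conj_real_line: "conj_line real_line = real_line"
proof -
  have "conj_vec ((\<chi> m. 1) :: complex ^ 'a) = (\<chi> m. 1)" by (simp add: vec_eq_iff)
  then show ?thesis by (simp add: real_line_def conj_line_span)
qed

lemma conj_line_conj_line: "(L :: (complex ^ 'n) set) \<in> topspace proj_space \<Longrightarrow> conj_line (conj_line L) = L"
proof (elim complex_linesE)
  fix x :: "complex ^ 'n" assume "L = vec.span {x}"
  moreover have "conj_vec (conj_vec x) = x" by (simp add: vec_eq_iff)
  ultimately show "conj_line (conj_line L) = L" by (simp add: conj_line_span)
qed

abbreviation base_cyl :: "'w \<times> (complex ^ 'n) set \<Rightarrow> 'w \<times> (complex ^ 'n) set" where
  "base_cyl \<equiv> (\<lambda>(w, L). (w, real_line))"

text \<open>What makes both self-maps act on the homology of the pair. The last condition puts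
  actual lines in the second component, so that conjugating twice is the identity.\<close>

definition conj_pair :: "('w \<times> (complex ^ 'n) set) topology \<Rightarrow> ('w \<times> (complex ^ 'n) set) set \<Rightarrow> bool" where
  "conj_pair X S \<longleftrightarrow> continuous_map X X conj_cyl \<and> continuous_map X X base_cyl \<and>
     conj_cyl \<in> S \<rightarrow> S \<and> base_cyl \<in> S \<rightarrow> S \<and> snd ` topspace X \<subseteq> topspace proj_space"

text \<open>On the homology of \<open>W \<times> CP\<^sup>2\<close>, conjugation acts by \<open>1, -1, 1\<close> on the summands \<open>H\<^sub>p(W)\<close>,
  \<open>H\<^sub>p\<^sub>-\<^sub>2(W)\<close>, \<open>H\<^sub>p\<^sub>-\<^sub>4(W)\<close>, and retraction to a base point is the projection to the first. Hence
  \<open>2 r + 1 - s\<close>, which satisfies \<open>\<epsilon>\<^sup>2 = 2 \<epsilon>\<close>, is twice the projection to the first two.\<close>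

definition low_part :: "int \<Rightarrow> ('w \<times> (complex ^ 'n) set) topology \<Rightarrow> ('w \<times> (complex ^ 'n) set) set
    \<Rightarrow> ('w \<times> (complex ^ 'n) set) chain set \<Rightarrow> ('w \<times> (complex ^ 'n) set) chain set" where
  "low_part p X S y = (hom_induced p X S X S base_cyl y [^]\<^bsub>relative_homology_group p X S\<^esub> (2::nat)
     \<otimes>\<^bsub>relative_homology_group p X S\<^esub> y)
     \<otimes>\<^bsub>relative_homology_group p X S\<^esub> inv\<^bsub>relative_homology_group p X S\<^esub> (hom_induced p X S X S conj_cyl y)"

lemma low_part_hom: "low_part p X S \<in> hom (relative_homology_group p X S) (relative_homology_group p X S)"
proof -
  interpret comm_group "relative_homology_group p X S" by simp
  interpret r: group_hom "relative_homology_group p X S" "relative_homology_group p X S" "hom_induced p X S X S base_cyl"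
    by (rule group_hom_induced)
  interpret s: group_hom "relative_homology_group p X S" "relative_homology_group p X S" "hom_induced p X S X S conj_cyl"
    by (rule group_hom_induced)
  show ?thesis
    unfolding hom_def low_part_def
    by (auto simp: nat_pow_distrib inv_mult hom_induced_carrier m_ac)
qed

lemma low_part_natural:
  assumes "group_hom (relative_homology_group p X S) (relative_homology_group q Y T) f"
    and y: "y \<in> carrier (relative_homology_group p X S)"
    and r: "f (hom_induced p X S X S base_cyl y) = hom_induced q Y T Y T base_cyl (f y)"
    and s: "f (hom_induced p X S X S conj_cyl y) = hom_induced q Y T Y T conj_cyl (f y)"
  shows "f (low_part p X S y) = low_part q Y T (f y)"
proof -
  interpret f: group_hom "relative_homology_group p X S" "relative_homology_group q Y T" f by fact
  show ?thesis
    unfolding low_part_def using y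
    by (simp add: f.hom_nat_pow hom_induced_carrier r s)
qed

lemma low_part_induced_id:
  assumes "conj_pair X S" "conj_pair Y T" "continuous_map X Y id" "S \<subseteq> T"
    and y: "y \<in> carrier (relative_homology_group p X S)"
  shows "hom_induced p X S Y T id (low_part p X S y) = low_part p Y T (hom_induced p X S Y T id y)"
proof -
  have *: "hom_induced p X S Y T id (hom_induced p X S X S g y) = hom_induced p Y T Y T g (hom_induced p X S Y T id y)"
    if "continuous_map X X g" "continuous_map Y Y g" "g \<in> S \<rightarrow> S" "g \<in> T \<rightarrow> T" for g
  proof -
    have "id \<in> S \<rightarrow> T" using assms by auto
    then show ?thesis
      using hom_induced_compose'[where p = p and x = y, OF that(1,3) assms(3)]
        hom_induced_compose'[where p = p and x = y, OF assms(3) _ that(2,4)]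
      by simp
  qed
  show ?thesis
    using assms by (intro low_part_natural group_hom_induced *) (auto simp: conj_pair_def)
qed

lemma low_part_relboundary:
  assumes "conj_pair X S" "conj_pair X T" "T \<subseteq> S"
    and y: "y \<in> carrier (relative_homology_group p X S)"
  shows "hom_relboundary p X S T (low_part p X S y) =
    low_part (p - 1) (subtopology X S) T (hom_relboundary p X S T y)"
proof -
  have *: "hom_relboundary p X S T (hom_induced p X S X S g y) =
      hom_induced (p - 1) (subtopology X S) T (subtopology X S) T g (hom_relboundary p X S T y)"
    if "continuous_map X X g" "g \<in> S \<rightarrow> S" "g \<in> T \<rightarrow> T" for g
    using fun_cong[OF naturality_hom_induced_relboundary[OF that], of p y] by simp
  show ?thesis
    using assms by (intro low_part_natural group_hom_relboundary *) (auto simp: conj_pair_def)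
qed

text \<open>With r r = r, r s = s r = r and s s = 1, expanding (2 r + 1 - s)^2 gives 4 r + 2 - 2 s,
  written additively.\<close>

lemma low_part_low_part:
  assumes "conj_pair X S" and y: "y \<in> carrier (relative_homology_group p X S)"
  shows "low_part p X S (low_part p X S y) = low_part p X S y [^]\<^bsub>relative_homology_group p X S\<^esub> (2::nat)"
proof -
  let ?G = "relative_homology_group p X S"
  interpret comm_group ?G by simp
  let ?r = "hom_induced p X S X S base_cyl" and ?s = "hom_induced p X S X S conj_cyl"
  interpret r: group_hom ?G ?G ?r by (rule group_hom_induced)
  interpret s: group_hom ?G ?G ?s by (rule group_hom_induced)
  have c: "continuous_map X X conj_cyl" "continuous_map X X base_cyl" "conj_cyl \<in> S \<rightarrow> S" "base_cyl \<in> S \<rightarrow> S"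
    and sub: "snd ` topspace X \<subseteq> topspace proj_space"
    using assms(1) by (auto simp: conj_pair_def)
  have rr: "?r (?r y) = ?r y" and rs: "?r (?s y) = ?r y" and sr: "?s (?r y) = ?r y"
    using c by (simp_all add: hom_induced_compose' o_def case_prod_unfold conj_real_line)
  have ss: "?s (?s y) = y"
  proof -
    have "?s (?s y) = hom_induced p X S X S (conj_cyl \<circ> conj_cyl) y" using c by (simp add: hom_induced_compose')
    also have "\<dots> = hom_induced p X S X S id y"
      using sub by (intro fun_cong[OF hom_induced_eq]) (auto simp: conj_line_conj_line image_subset_iff)
    finally show ?thesis using hom_induced_id[OF y] by simp
  qed
  have cl: "?r y \<in> carrier ?G" "?s y \<in> carrier ?G" by (rule hom_induced_carrier)+
  have l: "low_part p X S z = (?r z [^]\<^bsub>?G\<^esub> (2::nat) \<otimes>\<^bsub>?G\<^esub> z) \<otimes>\<^bsub>?G\<^esub> inv\<^bsub>?G\<^esub> (?s z)" for z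
    by (simp add: low_part_def)
  define a where "a = ?r y" define b where "b = ?s y"
  have ab: "a \<in> carrier ?G" "b \<in> carrier ?G" using cl by (simp_all add: a_def b_def)
  have act: "?r a = a" "?r b = a" "?r y = a" "?s a = a" "?s b = y" "?s y = b"
    using rr rs sr ss by (simp_all add: a_def b_def)
  have 1: "?r (low_part p X S y) = a [^]\<^bsub>?G\<^esub> (2::nat)"
    using y ab by (simp add: l act r.hom_nat_pow m_assoc)
  have 2: "?s (low_part p X S y) = (a [^]\<^bsub>?G\<^esub> (2::nat) \<otimes>\<^bsub>?G\<^esub> b) \<otimes>\<^bsub>?G\<^esub> inv\<^bsub>?G\<^esub> y"
    using y ab by (simp add: l act s.hom_nat_pow)
  have 3: "low_part p X S y = (a [^]\<^bsub>?G\<^esub> (2::nat) \<otimes>\<^bsub>?G\<^esub> y) \<otimes>\<^bsub>?G\<^esub> inv\<^bsub>?G\<^esub> b"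
    by (simp add: l a_def b_def)
  define c where "c = a [^]\<^bsub>?G\<^esub> (2::nat)"
  have cc: "c \<in> carrier ?G" using ab by (simp add: c_def)
  have 4: "low_part p X S y = (c \<otimes>\<^bsub>?G\<^esub> y) \<otimes>\<^bsub>?G\<^esub> inv\<^bsub>?G\<^esub> b" using 3 by (simp only: c_def)
  have "low_part p X S (low_part p X S y) =
      (c [^]\<^bsub>?G\<^esub> (2::nat) \<otimes>\<^bsub>?G\<^esub> low_part p X S y) \<otimes>\<^bsub>?G\<^esub> inv\<^bsub>?G\<^esub> ((c \<otimes>\<^bsub>?G\<^esub> b) \<otimes>\<^bsub>?G\<^esub> inv\<^bsub>?G\<^esub> y)"
    using l[of "low_part p X S y"] by (simp only: 1 2 c_def)
  also have "\<dots> = ((c \<otimes>\<^bsub>?G\<^esub> y) \<otimes>\<^bsub>?G\<^esub> inv\<^bsub>?G\<^esub> b) [^]\<^bsub>?G\<^esub> (2::nat)"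
  proof -
    \<comment> \<open>The part 1 - s of the sum. The class is then c + u, its
      conjugation-and-inversion contributes - c + u, and only commutative bookkeeping
      remains.\<close>
    define u where "u = y \<otimes>\<^bsub>?G\<^esub> inv\<^bsub>?G\<^esub> b"
    have u: "u \<in> carrier ?G" using y ab by (simp add: u_def)
    have 5: "(c \<otimes>\<^bsub>?G\<^esub> y) \<otimes>\<^bsub>?G\<^esub> inv\<^bsub>?G\<^esub> b = c \<otimes>\<^bsub>?G\<^esub> u" using cc y ab by (simp add: u_def m_assoc)
    have 6: "inv\<^bsub>?G\<^esub> ((c \<otimes>\<^bsub>?G\<^esub> b) \<otimes>\<^bsub>?G\<^esub> inv\<^bsub>?G\<^esub> y) = inv\<^bsub>?G\<^esub> c \<otimes>\<^bsub>?G\<^esub> u"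
      using cc y ab by (simp add: u_def inv_mult m_ac)
    have 7: "c \<otimes>\<^bsub>?G\<^esub> (inv\<^bsub>?G\<^esub> c \<otimes>\<^bsub>?G\<^esub> u) = u" using cc u by (simp flip: m_assoc)
    have "(c [^]\<^bsub>?G\<^esub> (2::nat) \<otimes>\<^bsub>?G\<^esub> (c \<otimes>\<^bsub>?G\<^esub> u)) \<otimes>\<^bsub>?G\<^esub> (inv\<^bsub>?G\<^esub> c \<otimes>\<^bsub>?G\<^esub> u)
        = (c \<otimes>\<^bsub>?G\<^esub> u) \<otimes>\<^bsub>?G\<^esub> (c \<otimes>\<^bsub>?G\<^esub> (c \<otimes>\<^bsub>?G\<^esub> (inv\<^bsub>?G\<^esub> c \<otimes>\<^bsub>?G\<^esub> u)))"
      using cc u by (simp add: numeral_2_eq_2 m_ac)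
    then show ?thesis unfolding 4 5 6 using cc u by (simp add: 7 numeral_2_eq_2)
  qed
  finally show ?thesis unfolding 4 .
qed

lemma conj_pair_cyl:
  "conj_pair (subtopology (prod_topology W (proj_space :: (complex ^ 'n) set topology)) (U \<times> topspace proj_space)) (A \<times> topspace proj_space)"
proof -
  let ?X = "prod_topology W (proj_space :: (complex ^ 'n) set topology)"
  have "continuous_map ?X ?X conj_cyl"
    using continuous_map_conj_cyl[where W = W and Z = "topspace proj_space", OF conj_topspace] by simp
  moreover have "continuous_map ?X ?X base_cyl"
    unfolding case_prod_unfold using real_line_in_proj_space
    by (intro continuous_map_pairedI continuous_map_fst) auto
  ultimately have c: "continuous_map (subtopology ?X U') ?X conj_cyl" "continuous_map (subtopology ?X U') ?X base_cyl" for U'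
    by (auto intro: continuous_map_from_subtopology)
  have i: "conj_cyl \<in> B \<times> topspace (proj_space :: (complex ^ 'n) set topology) \<rightarrow> B \<times> topspace proj_space"
    "base_cyl \<in> B \<times> topspace (proj_space :: (complex ^ 'n) set topology) \<rightarrow> B \<times> topspace proj_space" for B :: "'a set"
    using conj_topspace real_line_in_proj_space by auto
  show ?thesis
    unfolding conj_pair_def continuous_map_in_subtopology
    using c i[of U] i[of A] by (intro conjI) (auto simp: Pi_iff real_line_in_proj_space conj_topspace)
qed

lemma conj_pair_prod: "conj_pair (prod_topology W proj_space) {}"
proof -
  have "conj_pair (subtopology (prod_topology W proj_space) (topspace (prod_topology W proj_space))) ({} \<times> topspace proj_space)"
    unfolding topspace_prod_topology by (rule conj_pair_cyl)
  then show ?thesis by (simp only: subtopology_topspace Sigma_empty1)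
qed

section \<open>Comparison of W x CP^1 with W x CP^2\<close>

lemma homeomorphic_maps_embed_coords:
  fixes i j k :: 3
  assumes ijk: "distinct [i, j, k]"
  shows "homeomorphic_maps (prod_topology W proj_space) (cyl W (plane_lines i))
    (\<lambda>(w, L). (w, line_map (embed_coords j k) L)) (\<lambda>(w, L). (w, line_map (proj_coords j k) L))"
proof -
  have jk: "j \<noteq> k" "i \<noteq> j" "i \<noteq> k" using ijk by auto
  have e: "line_map (embed_coords j k) (vec.span {y}) = vec.span {embed_coords j k y}" for y
    by (rule line_map_span[OF line_preserving_embed_coords])
  have p: "line_map (proj_coords j k) (vec.span {v}) = vec.span {proj_coords j k v}" for v
    by (rule line_map_span[OF line_preserving_proj_coords])
  have plane: "\<exists>y. y \<noteq> 0 \<and> L = vec.span {embed_coords j k y}" if "L \<in> plane_lines i" for L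
  proof -
    from that obtain v where v: "v \<noteq> 0" "v $ i = 0" "L = vec.span {v}" by (rule lines_ofE) simp
    have eq: "embed_coords j k (proj_coords j k v) = v"
      using v jk unfolding vec_eq_iff forall_3_distinct[OF ijk] by (simp add: embed_coords_nth proj_coords_nth)
    have "proj_coords j k v \<noteq> 0"
    proof
      assume "proj_coords j k v = 0"
      then have "v $ j = 0 \<and> v $ k = 0" using proj_coords_nth[of j k v] by simp
      then show False using v unfolding vec_eq_iff forall_3_distinct[OF ijk] by simp
    qed
    then show ?thesis using v(3) eq by (intro exI[of _ "proj_coords j k v"]) simp
  qed
  have 1: "continuous_map proj_space proj_space (line_map (embed_coords j k))"
  proof -
    have "continuous_map (subtopology proj_space (topspace proj_space)) proj_space (line_map (embed_coords j k))"
      by (rule continuous_map_line_map_single[OF openin_topspace continuous_on_embed_coords line_preserving_embed_coords])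
        (rule embed_coords_neq_0[OF jk(1)])
    then show ?thesis by simp
  qed
  have "continuous_map (subtopology proj_space (off_axis_lines j k)) proj_space (line_map (proj_coords j k))"
    using continuous_map_line_map_single[OF openin_off_axis_lines continuous_on_proj_coords line_preserving_proj_coords]
    by (simp add: span_in_off_axis_lines vec_eq_iff forall_2 proj_coords_nth)
  then have 2: "continuous_map (subtopology proj_space (plane_lines i)) proj_space (line_map (proj_coords j k))"
    using plane_subset_off_axis[OF ijk] by (rule continuous_map_from_subtopology_mono)
  have 3: "line_map (embed_coords j k) L \<in> plane_lines i" if "L \<in> topspace proj_space" for L
    using that jk by (elim complex_linesE) (simp add: e span_in_plane_lines embed_coords_neq_0 embed_coords_nth)
  have emb: "continuous_map proj_space (subtopology proj_space (plane_lines i)) (line_map (embed_coords j k))"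
    using 1 3 by (auto simp: continuous_map_in_subtopology)
  show ?thesis
    unfolding homeomorphic_maps_def
  proof (intro conjI ballI)
    show "continuous_map (prod_topology W proj_space) (cyl W (plane_lines i)) (\<lambda>(w, L). (w, line_map (embed_coords j k) L))"
      using emb by (simp add: continuous_map_prod_top)
    show "continuous_map (cyl W (plane_lines i)) (prod_topology W proj_space) (\<lambda>(w, L). (w, line_map (proj_coords j k) L))"
      using 2 by (simp add: continuous_map_prod_top)
  next
    fix z assume "z \<in> topspace (prod_topology W (proj_space :: (complex ^ 2) set topology))"
    then obtain w L where z: "z = (w, L)" "L \<in> topspace proj_space" by auto
    then obtain x where "L = vec.span {x}" using complex_linesE by blast
    then show "(case case z of (w, L) \<Rightarrow> (w, line_map (embed_coords j k) L) of (w, L) \<Rightarrow> (w, line_map (proj_coords j k) L)) = z"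
      by (simp add: z e p proj_embed_coords jk)
  next
    fix z assume "z \<in> topspace (cyl W (plane_lines i))"
    then obtain w L where z: "z = (w, L)" "L \<in> plane_lines i" by (cases z) auto
    then obtain y where "L = vec.span {embed_coords j k y}" using plane by blast
    then show "(case case z of (w, L) \<Rightarrow> (w, line_map (proj_coords j k) L) of (w, L) \<Rightarrow> (w, line_map (embed_coords j k) L)) = z"
      by (simp add: z e p proj_embed_coords jk)
  qed
qed

text \<open>Two opposite signs are played against each other. On the classes of W x CP^1 that vanish
  in \<open>W\<close>, conjugation is -1; on the groups of W x CP^2 relative to W x CP^1 it is 1.
  Anything subject to both is killed by 2, and this controls both the kernel of the embedding and
  the classes that fail to come from W x CP^1.\<close>

lemma mod_torsion_onto_prod:
  fixes W :: "'w topology" and i j k :: 3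
  assumes ijk: "distinct [i, j, k]"
  defines "X1 \<equiv> prod_topology W (proj_space :: (complex ^ 2) set topology)"
    and "X2 \<equiv> prod_topology W (proj_space :: (complex ^ 3) set topology)"
    and "emb \<equiv> (\<lambda>(w :: 'w, L). (w, line_map (embed_coords j k :: complex ^ 2 \<Rightarrow> complex ^ 3) L))"
  shows "mod_torsion_onto (homology_group p X1) (homology_group p X2)
    (low_part p X2 {} \<circ> hom_induced p X1 {} X2 {} emb) (low_part p X2 {})"
proof -
  let ?H1 = "homology_group p X1" and ?H2 = "homology_group p X2" and ?HW = "homology_group p W"
  let ?S = "topspace W \<times> plane_lines i"
  let ?HR = "relative_homology_group p X2 ?S"
  interpret H1: comm_group ?H1 by simp
  interpret H2: comm_group ?H2 by simp
  interpret HW: comm_group ?HW by simp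
  interpret HR: comm_group ?HR by simp
  define \<kappa> where "\<kappa> = hom_induced p X1 {} X2 {} emb"
  define F1 where "F1 = hom_induced p X1 {} W {} fst"
  define F2 where "F2 = hom_induced p X2 {} W {} fst"
  define c where "c = hom_induced p W {} X2 {} (\<lambda>w. (w, real_line))"
  define t where "t = hom_induced p W {} X1 {} (\<lambda>w. (w, real_line))"
  define s1 where "s1 = hom_induced p X1 {} X1 {} conj_cyl"
  define s2 where "s2 = hom_induced p X2 {} X2 {} conj_cyl"
  define q where "q = hom_induced p X2 {} X2 ?S id"
  interpret \<kappa>: group_hom ?H1 ?H2 \<kappa> unfolding \<kappa>_def by (rule group_hom_induced)
  interpret F1: group_hom ?H1 ?HW F1 unfolding F1_def by (rule group_hom_induced)
  interpret F2: group_hom ?H2 ?HW F2 unfolding F2_def by (rule group_hom_induced)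
  interpret c: group_hom ?HW ?H2 c unfolding c_def by (rule group_hom_induced)
  interpret t: group_hom ?HW ?H1 t unfolding t_def by (rule group_hom_induced)
  interpret s1: group_hom ?H1 ?H1 s1 unfolding s1_def by (rule group_hom_induced)
  interpret s2: group_hom ?H2 ?H2 s2 unfolding s2_def by (rule group_hom_induced)
  interpret q: group_hom ?H2 ?HR q unfolding q_def by (rule group_hom_induced)
  have cont_f: "continuous_map X1 W fst" "continuous_map X2 W fst"
    by (simp_all add: X1_def X2_def continuous_map_fst)
  have cont_s: "continuous_map X1 X1 conj_cyl" "continuous_map X2 X2 conj_cyl" "continuous_map X2 X2 base_cyl"
    using conj_pair_prod[of W] by (auto simp: X1_def X2_def conj_pair_def)
  have cont_t: "continuous_map W X1 (\<lambda>w. (w, real_line))" "continuous_map W X2 (\<lambda>w. (w, real_line))"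
    using real_line_in_proj_space by (auto simp: X1_def X2_def intro!: continuous_map_pairedI)
  have embed: "homeomorphic_maps X1 (cyl W (plane_lines i)) emb (\<lambda>(w, L). (w, line_map (proj_coords j k) L))"
    using homeomorphic_maps_embed_coords[OF ijk, of W] by (simp add: X1_def emb_def)
  have sub: "subtopology X2 ?S = cyl W (plane_lines i)"
    by (simp add: X2_def prod_topology_subtopology(2))
  have cont_e': "continuous_map X1 (cyl W (plane_lines i)) emb"
    using embed by (simp add: homeomorphic_maps_def)
  have cont_i: "continuous_map (cyl W (plane_lines i)) X2 id"
    using continuous_map_id_cyl[OF lines_of_subset, of W "{v. v $ i = 0}"] by (simp add: X2_def)
  from cont_e' have cont_e: "continuous_map X1 X2 emb"
    using sub continuous_map_in_subtopology by metis
  have emb_conj: "emb (conj_cyl z) = conj_cyl (emb z)" if "z \<in> topspace X1" for z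
  proof -
    obtain w L where z: "z = (w, L)" "L \<in> topspace proj_space" using \<open>z \<in> topspace X1\<close> by (auto simp: X1_def)
    then obtain x where "L = vec.span {x}" using complex_linesE by blast
    then show ?thesis
      by (simp add: z emb_def conj_line_span line_map_span[OF line_preserving_embed_coords] conj_embed_coords)
  qed
  \<comment> \<open>The retraction to the base point factors through \<open>W\<close>, which turns
    \<open>low_part\<close> into the explicit formula \<open>eps\<close>.\<close>
  have r: "hom_induced p X2 {} X2 {} base_cyl y = c (F2 y)" for y
    unfolding c_def F2_def using cont_f cont_t
    by (subst hom_induced_compose') (auto simp: o_def case_prod_unfold)
  have F2c: "F2 (c a) = a" if "a \<in> carrier ?HW" for a
    unfolding c_def F2_def using cont_f cont_t hom_induced_id[OF that]
    by (subst hom_induced_compose') (auto simp: o_def id_def)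
  have F1t: "F1 (t a) = a" if "a \<in> carrier ?HW" for a
    unfolding t_def F1_def using cont_f cont_t hom_induced_id[OF that]
    by (subst hom_induced_compose') (auto simp: o_def id_def)
  have F2s: "F2 (s2 y) = F2 y" for y
    unfolding s2_def F2_def using cont_f cont_s
    by (subst hom_induced_compose') (auto simp: o_def case_prod_unfold)
  have F2\<kappa>: "F2 (\<kappa> x) = F1 x" for x
    unfolding \<kappa>_def F2_def F1_def using cont_f cont_e
    by (subst hom_induced_compose') (auto simp: o_def case_prod_unfold emb_def)
  have s1t: "s1 (t a) = t a" for a
    unfolding s1_def t_def using cont_s cont_t
    by (subst hom_induced_compose') (auto simp: o_def conj_real_line)
  have \<kappa>s: "\<kappa> (s1 x) = s2 (\<kappa> x)" for x
  proof -
    have "\<kappa> (s1 x) = hom_induced p X1 {} X2 {} (emb \<circ> conj_cyl) x"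
      unfolding s1_def \<kappa>_def using cont_s cont_e by (subst hom_induced_compose') auto
    also have "\<dots> = hom_induced p X1 {} X2 {} (conj_cyl \<circ> emb) x"
      using emb_conj by (intro fun_cong[OF hom_induced_eq]) simp
    also have "\<dots> = s2 (\<kappa> x)"
      unfolding s2_def \<kappa>_def using cont_s cont_e by (subst hom_induced_compose') auto
    finally show ?thesis .
  qed
  have s2s2: "s2 (s2 y) = y" if y: "y \<in> carrier ?H2" for y
  proof -
    have "s2 (s2 y) = hom_induced p X2 {} X2 {} (conj_cyl \<circ> conj_cyl) y"
      unfolding s2_def using cont_s by (subst hom_induced_compose') auto
    also have "\<dots> = hom_induced p X2 {} X2 {} id y"
      by (intro fun_cong[OF hom_induced_eq]) (auto simp: X2_def conj_line_conj_line)
    finally show ?thesis using hom_induced_id[OF y] by simp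
  qed
  have eps: "low_part p X2 {} y = (c (F2 y) [^]\<^bsub>?H2\<^esub> (2::nat) \<otimes>\<^bsub>?H2\<^esub> y) \<otimes>\<^bsub>?H2\<^esub> inv\<^bsub>?H2\<^esub> (s2 y)" for y
    by (simp add: low_part_def r s2_def)
  have s1_inv: "s1 x = inv\<^bsub>?H1\<^esub> x" if "x \<in> carrier ?H1" "F1 x = \<one>\<^bsub>?HW\<^esub>" for x
    using conj_inverts_kernel_fst[of x p W] that by (simp add: s1_def F1_def X1_def)
  have fixes_rel: "hom_induced q' X2 ?S X2 ?S conj_cyl x = x" if "x \<in> carrier (relative_homology_group q' X2 ?S)" for q' x
    using conj_fixes_plane[OF ijk, of q' W] that by (simp add: X2_def)
  have conj_S: "conj_cyl \<in> ?S \<rightarrow> ?S" using conj_plane_lines by auto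
  text \<open>The pair sequence of \<open>(X2, ?S)\<close>, rewritten along the homeomorphism of \<open>X1\<close> with \<open>?S\<close>.\<close>
  have \<kappa>_ker: "s1 x = x" if x: "x \<in> carrier ?H1" and \<kappa>x: "\<kappa> x = \<one>\<^bsub>?H2\<^esub>" for x
  proof -
    let ?e = "hom_induced p X1 {} (subtopology X2 ?S) {} emb"
    have iso: "?e \<in> iso ?H1 (homology_group p (subtopology X2 ?S))"
      using embed homeomorphic_maps_map unfolding sub by (intro homeomorphic_map_homology_iso) blast
    have "hom_induced p (subtopology X2 ?S) {} X2 {} id (?e x) = \<kappa> x"
      unfolding \<kappa>_def using cont_e' by (subst hom_induced_compose') (auto simp: sub cont_i)
    then have "?e x \<in> kernel (homology_group p (subtopology X2 ?S)) ?H2 (hom_induced p (subtopology X2 ?S) {} X2 {} id)"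
      using \<kappa>x by (simp add: kernel_def hom_induced_carrier)
    then obtain w where w: "w \<in> carrier (relative_homology_group (p + 1) X2 ?S)" "?e x = hom_boundary (p + 1) X2 ?S w"
      using exact_triple_sub[of "{}" ?S "p + 1" X2] by (auto simp: hom_relboundary_empty)
    let ?sS = "hom_induced p (subtopology X2 ?S) {} (subtopology X2 ?S) {} conj_cyl"
    have "?sS (?e x) = hom_boundary (p + 1) X2 ?S (hom_induced (p + 1) X2 ?S X2 ?S conj_cyl w)"
      using fun_cong[OF naturality_hom_induced[OF cont_s(2) conj_S], of "p + 1" w] by (simp add: w(2))
    then have "?sS (?e x) = ?e x" using fixes_rel[OF w(1)] w(2) by simp
    moreover have "?sS (?e x) = ?e (s1 x)"
    proof -
      have cS: "continuous_map (subtopology X2 ?S) (subtopology X2 ?S) conj_cyl"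
        unfolding sub by (rule continuous_map_conj_cyl[OF conj_plane_lines])
      have "?sS (?e x) = hom_induced p X1 {} (subtopology X2 ?S) {} (conj_cyl \<circ> emb) x"
        using cS cont_e' by (subst hom_induced_compose') (auto simp: sub)
      also have "\<dots> = hom_induced p X1 {} (subtopology X2 ?S) {} (emb \<circ> conj_cyl) x"
        using emb_conj by (intro fun_cong[OF hom_induced_eq]) simp
      also have "\<dots> = ?e (s1 x)"
        unfolding s1_def using cont_s cont_e' by (subst hom_induced_compose') (auto simp: sub)
      finally show ?thesis .
    qed
    ultimately show ?thesis
      using iso x s1.hom_closed[OF x] unfolding iso_def bij_betw_def by (metis (no_types, lifting) IntD1 IntD2 inj_onD mem_Collect_eq)
  qed
  have \<kappa>_range: "\<exists>x \<in> carrier ?H1. y = \<kappa> x" if y: "y \<in> carrier ?H2" "q y = \<one>\<^bsub>?HR\<^esub>" for y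
  proof -
    let ?e = "hom_induced p X1 {} (subtopology X2 ?S) {} emb"
    have iso: "?e ` carrier ?H1 = carrier (homology_group p (subtopology X2 ?S))"
      using homeomorphic_map_homology_iso[of X1 "subtopology X2 ?S" emb p] embed homeomorphic_maps_map
      unfolding sub iso_def bij_betw_def by blast
    have "y \<in> kernel ?H2 ?HR q" using y by (simp add: kernel_def)
    then obtain z where z: "z \<in> carrier (homology_group p (subtopology X2 ?S))" "y = hom_induced p (subtopology X2 ?S) {} X2 {} id z"
      using exact_triple_mid[of "{}" ?S p X2] by (auto simp: q_def)
    then obtain x where x: "x \<in> carrier ?H1" "z = ?e x" unfolding iso[symmetric] by blast
    have "y = \<kappa> x" unfolding z(2) x(2) \<kappa>_def
      using cont_e' by (subst hom_induced_compose') (auto simp: sub cont_i)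
    then show ?thesis using x by blast
  qed
  show ?thesis
    unfolding mod_torsion_onto_def \<kappa>_def[symmetric]
  proof (intro conjI ballI impI)
    fix x assume x: "x \<in> carrier ?H1" and "(low_part p X2 {} \<circ> \<kappa>) x = \<one>\<^bsub>?H2\<^esub>"
    then have phi: "(c (F1 x) [^]\<^bsub>?H2\<^esub> (2::nat) \<otimes>\<^bsub>?H2\<^esub> \<kappa> x) \<otimes>\<^bsub>?H2\<^esub> inv\<^bsub>?H2\<^esub> (\<kappa> (s1 x)) = \<one>\<^bsub>?H2\<^esub>"
      by (simp add: eps F2\<kappa> \<kappa>s)
    have Fx: "F1 x \<in> carrier ?HW" using x by simp
    \<comment> \<open>Projecting to \<open>W\<close> isolates the first summand: conjugation does
      not change it, so the last two terms cancel and twice \<open>F1 x\<close> remains.\<close>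
    have "\<one>\<^bsub>?HW\<^esub> = F2 ((c (F1 x) [^]\<^bsub>?H2\<^esub> (2::nat) \<otimes>\<^bsub>?H2\<^esub> \<kappa> x) \<otimes>\<^bsub>?H2\<^esub> inv\<^bsub>?H2\<^esub> (\<kappa> (s1 x)))"
      unfolding phi by simp
    also have "\<dots> = F1 x [^]\<^bsub>?HW\<^esub> (2::nat)"
      using x Fx by (simp add: F2.hom_nat_pow F2c F2\<kappa> \<kappa>s F2s HW.m_assoc)
    finally have F2x: "F1 x [^]\<^bsub>?HW\<^esub> (2::nat) = \<one>\<^bsub>?HW\<^esub>" by simp
    \<comment> \<open>Doubling \<open>x\<close> moves it into the kernel of \<open>F1\<close>, where
      conjugation is known to invert.\<close>
    define z where "z = x [^]\<^bsub>?H1\<^esub> (2::nat)"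
    have z: "z \<in> carrier ?H1" using x by (simp add: z_def)
    have Fz: "F1 z = \<one>\<^bsub>?HW\<^esub>" using x F2x by (simp add: z_def F1.hom_nat_pow)
    have "\<one>\<^bsub>?H2\<^esub> = ((c (F1 x) [^]\<^bsub>?H2\<^esub> (2::nat) \<otimes>\<^bsub>?H2\<^esub> \<kappa> x) \<otimes>\<^bsub>?H2\<^esub> inv\<^bsub>?H2\<^esub> (\<kappa> (s1 x))) [^]\<^bsub>?H2\<^esub> (2::nat)"
      unfolding phi by simp
    also have "\<dots> = c (F1 z) [^]\<^bsub>?H2\<^esub> (2::nat) \<otimes>\<^bsub>?H2\<^esub> \<kappa> z \<otimes>\<^bsub>?H2\<^esub> inv\<^bsub>?H2\<^esub> (\<kappa> (s1 z))"
      using x by (simp add: z_def H2.nat_pow_distrib H2.nat_pow_inv F1.hom_nat_pow c.hom_nat_pow \<kappa>.hom_nat_pow s1.hom_nat_pow)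
    also have "\<dots> = \<kappa> z \<otimes>\<^bsub>?H2\<^esub> \<kappa> z" using z by (simp add: Fz s1_inv)
    also have "\<dots> = \<kappa> (z \<otimes>\<^bsub>?H1\<^esub> z)" using z by simp
    finally have kz: "\<kappa> (z \<otimes>\<^bsub>?H1\<^esub> z) = \<one>\<^bsub>?H2\<^esub>" by simp
    have zz: "z \<otimes>\<^bsub>?H1\<^esub> z \<in> carrier ?H1" using z by simp
    \<comment> \<open>Twice \<open>z\<close> is fixed by conjugation, since \<open>\<kappa>\<close>
      kills it, and inverted, since \<open>F1\<close> kills it. Hence 4 \<open>z\<close>, which is 8
      \<open>x\<close> in additive notation, vanishes.\<close>
    have "z \<otimes>\<^bsub>?H1\<^esub> z = s1 (z \<otimes>\<^bsub>?H1\<^esub> z)" using \<kappa>_ker[OF zz kz] by simp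
    also have "\<dots> = inv\<^bsub>?H1\<^esub> (z \<otimes>\<^bsub>?H1\<^esub> z)" using z Fz by (intro s1_inv zz) simp
    finally have "(z \<otimes>\<^bsub>?H1\<^esub> z) \<otimes>\<^bsub>?H1\<^esub> (z \<otimes>\<^bsub>?H1\<^esub> z) = \<one>\<^bsub>?H1\<^esub>" using H1.r_inv[OF zz] by simp
    moreover have "x [^]\<^bsub>?H1\<^esub> (8::nat) = (z \<otimes>\<^bsub>?H1\<^esub> z) \<otimes>\<^bsub>?H1\<^esub> (z \<otimes>\<^bsub>?H1\<^esub> z)"
      using x by (simp add: z_def H1.nat_pow_mult)
    ultimately show "\<exists>k::nat>0. x [^]\<^bsub>?H1\<^esub> k = \<one>\<^bsub>?H1\<^esub>" by (intro exI[of _ 8]) simp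
  next
    fix y assume y: "y \<in> carrier ?H2"
    \<comment> \<open>The part of \<open>low_part p X2 {} y\<close> other than the retraction.
      Conjugation inverts it.\<close>
    define y' where "y' = y \<otimes>\<^bsub>?H2\<^esub> inv\<^bsub>?H2\<^esub> (s2 y)"
    have y': "y' \<in> carrier ?H2" using y by (simp add: y'_def)
    have sy': "s2 y' = inv\<^bsub>?H2\<^esub> y'" using y by (simp add: y'_def s2s2 H2.inv_mult H2.m_comm)
    have Fy': "F2 y' = \<one>\<^bsub>?HW\<^esub>" using y by (simp add: y'_def F2s)
    have "q (s2 y') = hom_induced p X2 ?S X2 ?S conj_cyl (q y')"
    proof -
      have "q (s2 y') = hom_induced p X2 {} X2 ?S (id \<circ> conj_cyl) y'"
        unfolding q_def s2_def using cont_s by (subst hom_induced_compose') auto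
      also have "\<dots> = hom_induced p X2 {} X2 ?S (conj_cyl \<circ> id) y'" by simp
      also have "\<dots> = hom_induced p X2 ?S X2 ?S conj_cyl (q y')"
        unfolding q_def using cont_s conj_S by (subst hom_induced_compose') auto
      finally show ?thesis .
    qed
    \<comment> \<open>Relative to \<open>?S\<close> conjugation is the identity, so there
      \<open>y'\<close> equals its own inverse; therefore twice \<open>y'\<close> comes from
      \<open>X1\<close>.\<close>
    then have "inv\<^bsub>?HR\<^esub> (q y') = q y'" using fixes_rel[OF q.hom_closed[OF y']] y' by (simp add: sy')
    then have "q (y' \<otimes>\<^bsub>?H2\<^esub> y') = \<one>\<^bsub>?HR\<^esub>" using y' HR.r_inv[OF q.hom_closed[OF y']] by simp
    then obtain x1 where x1: "x1 \<in> carrier ?H1" "y' \<otimes>\<^bsub>?H2\<^esub> y' = \<kappa> x1" using \<kappa>_range y' by (metis H2.m_closed)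
    \<comment> \<open>The constant section of \<open>X1\<close> realises the first summand. It
      suffices that its projection to \<open>W\<close> is right, because \<open>low_part\<close>
      retains only the projection of a class fixed by conjugation.\<close>
    define x2 where "x2 = t (F2 y)"
    have x2: "x2 \<in> carrier ?H1" using y by (simp add: x2_def)
    have phi1: "low_part p X2 {} (\<kappa> x1) = (y' \<otimes>\<^bsub>?H2\<^esub> y') \<otimes>\<^bsub>?H2\<^esub> (y' \<otimes>\<^bsub>?H2\<^esub> y')"
      unfolding x1(2)[symmetric] eps using y' by (simp add: Fy' sy' H2.inv_mult)
    have phi2: "low_part p X2 {} (\<kappa> x2) = c (F2 y) [^]\<^bsub>?H2\<^esub> (2::nat)"
    proof -
      have "s2 (\<kappa> x2) = \<kappa> x2" by (simp add: x2_def s1t flip: \<kappa>s)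
      then show ?thesis using x2 y by (simp add: eps F2\<kappa> H2.m_assoc) (simp add: x2_def F1t)
    qed
    interpret e: group_hom ?H2 ?H2 "low_part p X2 {}"
      by (simp add: group_hom_def group_hom_axioms_def low_part_hom)
    have ey: "low_part p X2 {} y = c (F2 y) [^]\<^bsub>?H2\<^esub> (2::nat) \<otimes>\<^bsub>?H2\<^esub> y'"
      using y by (simp add: eps y'_def H2.m_assoc)
    have y4: "y' [^]\<^bsub>?H2\<^esub> (4::nat) = (y' \<otimes>\<^bsub>?H2\<^esub> y') \<otimes>\<^bsub>?H2\<^esub> (y' \<otimes>\<^bsub>?H2\<^esub> y')"
      using y' by (simp add: numeral_eq_Suc H2.m_assoc)
    \<comment> \<open>In additive notation \<open>low_part\<close> sends \<open>\<kappa> x1\<close>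
      to 4 \<open>y'\<close>, once 2 from the choice of \<open>x1\<close> and once 2 from 1 - s on
      an inverted class. The remaining summand of \<open>low_part p X2 {} y\<close> is hit by
      \<open>x2\<close>, so 4 is a common multiple.\<close>
    have "low_part p X2 {} y [^]\<^bsub>?H2\<^esub> (4::nat) =
        low_part p X2 {} (\<kappa> x2) [^]\<^bsub>?H2\<^esub> (4::nat) \<otimes>\<^bsub>?H2\<^esub> low_part p X2 {} (\<kappa> x1)"
      unfolding ey phi2 phi1 y4[symmetric] using y y' by (intro H2.nat_pow_distrib) simp_all
    also have "\<dots> = (low_part p X2 {} \<circ> \<kappa>) (x2 [^]\<^bsub>?H1\<^esub> (4::nat) \<otimes>\<^bsub>?H1\<^esub> x1)"
      using x1 x2 by (simp add: \<kappa>.hom_nat_pow e.hom_nat_pow)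
    finally show "\<exists>x \<in> carrier ?H1. \<exists>k::nat>0. low_part p X2 {} y [^]\<^bsub>?H2\<^esub> k = (low_part p X2 {} \<circ> \<kappa>) x"
      using x1 x2 by (intro bexI[of _ "x2 [^]\<^bsub>?H1\<^esub> (4::nat) \<otimes>\<^bsub>?H1\<^esub> x1"] exI[of _ 4]) auto
  qed
qed

section \<open>Gluing over open sets\<close>

text \<open>\<open>E\<close> stays the same set while \<open>X\<close> varies, so that restriction
  to a smaller open part of the base only changes \<open>X\<close>. With \<open>S\<close> nonempty
  the statement concerns pairs, as the five lemma requires.\<close>

definition low_part_onto :: "int \<Rightarrow> ('w \<times> (complex ^ 'n) set) topology \<Rightarrow> ('w \<times> (complex ^ 'n) set) set
    \<Rightarrow> ('w \<times> (complex ^ 'n) set) set \<Rightarrow> bool" where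
  "low_part_onto p X E S \<longleftrightarrow>
     mod_torsion_onto (relative_homology_group p (subtopology X E) (E \<inter> S)) (relative_homology_group p X S)
       (low_part p X S \<circ> hom_induced p (subtopology X E) (E \<inter> S) X S id) (low_part p X S)"

lemma low_part_comp_hom:
  "low_part p X S \<circ> hom_induced p Y T X S f \<in> hom (relative_homology_group p Y T) (relative_homology_group p X S)"
  using hom_induced_hom low_part_hom by (rule hom_compose)

lemma low_part_comp_low_part:
  assumes "conj_pair X S"
  shows "low_part p X S ((low_part p X S \<circ> hom_induced p Y T X S f) x) =
    (low_part p X S \<circ> hom_induced p Y T X S f) x [^]\<^bsub>relative_homology_group p X S\<^esub> (2::nat)"
  using low_part_low_part[OF assms hom_induced_carrier] by simp

lemma low_part_square_id:
  assumes "conj_pair X S" "conj_pair Y T" "continuous_map X Y id" "S \<subseteq> T"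
    "continuous_map X' X id" "S' \<subseteq> S" "continuous_map Y' Y id" "T' \<subseteq> T" "continuous_map X' Y' id" "S' \<subseteq> T'"
  shows "hom_induced p X S Y T id ((low_part p X S \<circ> hom_induced p X' S' X S id) x) =
    (low_part p Y T \<circ> hom_induced p Y' T' Y T id) (hom_induced p X' S' Y' T' id x)"
proof -
  have sub: "id \<in> S' \<rightarrow> S" "id \<in> S \<rightarrow> T" "id \<in> S' \<rightarrow> T'" "id \<in> T' \<rightarrow> T" using assms by auto
  have "hom_induced p X S Y T id (hom_induced p X' S' X S id x) = hom_induced p Y' T' Y T id (hom_induced p X' S' Y' T' id x)"
    by (simp add: hom_induced_compose'[OF assms(5) sub(1) assms(3) sub(2)] hom_induced_compose'[OF assms(9) sub(3) assms(7) sub(4)])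
  then show ?thesis
    using low_part_induced_id[OF assms(1-4) hom_induced_carrier, of p X' S' id x] by simp
qed

text \<open>Naturality of the boundary under the inclusion of \<open>E\<close>, followed by
  naturality of \<open>low_part\<close> under the boundary.\<close>

lemma low_part_square_boundary:
  assumes "conj_pair X S" "conj_pair X {}"
  shows "hom_boundary p X S ((low_part p X S \<circ> hom_induced p (subtopology X E) (E \<inter> S) X S id) x) =
    (low_part (p - 1) (subtopology X S) {} \<circ> hom_induced (p - 1) (subtopology (subtopology X S) E) {} (subtopology X S) {} id)
      (hom_boundary p (subtopology X E) (E \<inter> S) x)"
proof -
  have "subtopology (subtopology X E) (E \<inter> S) = subtopology (subtopology X S) E"
    by (simp add: subtopology_subtopology inf_commute inf_left_commute)
  moreover have "continuous_map (subtopology X E) X id" "id \<in> E \<inter> S \<rightarrow> S"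
    by (auto simp: continuous_map_from_subtopology)
  from fun_cong[OF naturality_hom_induced[OF this], of p x]
  have "hom_boundary p X S (hom_induced p (subtopology X E) (E \<inter> S) X S id x) =
    hom_induced (p - 1) (subtopology (subtopology X E) (E \<inter> S)) {} (subtopology X S) {} id (hom_boundary p (subtopology X E) (E \<inter> S) x)"
    by simp
  ultimately show ?thesis
    using low_part_relboundary[OF assms empty_subsetI hom_induced_carrier, of p "subtopology X E" "E \<inter> S" id x]
    by (simp add: hom_relboundary_empty)
qed

lemma hom_boundary_low_part:
  assumes "conj_pair X S" "conj_pair X {}" "y \<in> carrier (relative_homology_group p X S)"
  shows "hom_boundary p X S (low_part p X S y) = low_part (p - 1) (subtopology X S) {} (hom_boundary p X S y)"
  using low_part_relboundary[OF assms(1,2) empty_subsetI assms(3)] by (simp add: hom_relboundary_empty)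

lemma exact_pair:
  shows exact_pair_abs: "kernel (homology_group p X) (relative_homology_group p X S) (hom_induced p X {} X S id)
      = hom_induced p (subtopology X S) {} X {} id ` carrier (homology_group p (subtopology X S))"
    and exact_pair_rel: "kernel (relative_homology_group p X S) (homology_group (p - 1) (subtopology X S)) (hom_boundary p X S)
      = hom_induced p X {} X S id ` carrier (homology_group p X)"
    and exact_pair_sub: "kernel (homology_group (p - 1) (subtopology X S)) (homology_group (p - 1) X)
          (hom_induced (p - 1) (subtopology X S) {} X {} id)
      = hom_boundary p X S ` carrier (relative_homology_group p X S)"
  using exact_triple[of "{}" S p X] by (simp_all add: hom_relboundary_empty)

text \<open>The five lemma on the pair sequences with the relative group in the middle: absolute
  groups of degree \<open>p\<close> on its left and of degree \<open>p - 1\<close> on its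
  right.\<close>

lemma low_part_onto_relative:
  assumes c: "conj_pair X S" "conj_pair X {}" "conj_pair (subtopology X S) {}"
    and P: "low_part_onto p (subtopology X S) E {}" "low_part_onto p X E {}"
      "low_part_onto (p - 1) (subtopology X S) E {}" "low_part_onto (p - 1) X E {}"
  shows "low_part_onto p X E S"
proof -
  have sub: "subtopology (subtopology X E) (E \<inter> S) = subtopology (subtopology X S) E"
    by (simp add: subtopology_subtopology inf_commute inf_left_commute)
  have id: "continuous_map (subtopology X E) X id" "continuous_map (subtopology X S) X id"
    "continuous_map (subtopology (subtopology X S) E) (subtopology X E) id"
    "continuous_map (subtopology (subtopology X S) E) (subtopology X S) id"
    by (auto simp: continuous_map_from_subtopology continuous_map_in_subtopology)
  show ?thesis
    unfolding low_part_onto_def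
  proof (rule mod_torsion_onto_five)
    show "kernel (homology_group p (subtopology X E)) (relative_homology_group p (subtopology X E) (E \<inter> S))
        (hom_induced p (subtopology X E) {} (subtopology X E) (E \<inter> S) id)
      = hom_induced p (subtopology (subtopology X S) E) {} (subtopology X E) {} id ` carrier (homology_group p (subtopology (subtopology X S) E))"
      using exact_pair_abs[of p "subtopology X E" "E \<inter> S"] by (simp add: sub)
    show "kernel (relative_homology_group p (subtopology X E) (E \<inter> S)) (homology_group (p - 1) (subtopology (subtopology X S) E)) (hom_boundary p (subtopology X E) (E \<inter> S))
      = hom_induced p (subtopology X E) {} (subtopology X E) (E \<inter> S) id ` carrier (homology_group p (subtopology X E))"
      using exact_pair_rel[of p "subtopology X E" "E \<inter> S"] by (simp add: sub)
    show "kernel (homology_group (p - 1) (subtopology (subtopology X S) E)) (homology_group (p - 1) (subtopology X E))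
          (hom_induced (p - 1) (subtopology (subtopology X S) E) {} (subtopology X E) {} id)
      = hom_boundary p (subtopology X E) (E \<inter> S) ` carrier (relative_homology_group p (subtopology X E) (E \<inter> S))"
      using exact_pair_sub[of p "subtopology X E" "E \<inter> S"] by (simp add: sub)
    show "kernel (homology_group p X) (relative_homology_group p X S) (hom_induced p X {} X S id)
      = hom_induced p (subtopology X S) {} X {} id ` carrier (homology_group p (subtopology X S))"
      "kernel (relative_homology_group p X S) (homology_group (p - 1) (subtopology X S)) (hom_boundary p X S)
      = hom_induced p X {} X S id ` carrier (homology_group p X)"
      "kernel (homology_group (p - 1) (subtopology X S)) (homology_group (p - 1) X)
          (hom_induced (p - 1) (subtopology X S) {} X {} id)
      = hom_boundary p X S ` carrier (relative_homology_group p X S)"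
      by (rule exact_pair)+
    show "mod_torsion_onto (homology_group p (subtopology (subtopology X S) E)) (homology_group p (subtopology X S))
        (low_part p (subtopology X S) {} \<circ> hom_induced p (subtopology (subtopology X S) E) {} (subtopology X S) {} id) (low_part p (subtopology X S) {})"
      "mod_torsion_onto (homology_group p (subtopology X E)) (homology_group p X)
        (low_part p X {} \<circ> hom_induced p (subtopology X E) {} X {} id) (low_part p X {})"
      "mod_torsion_onto (homology_group (p - 1) (subtopology (subtopology X S) E)) (homology_group (p - 1) (subtopology X S))
        (low_part (p - 1) (subtopology X S) {} \<circ> hom_induced (p - 1) (subtopology (subtopology X S) E) {} (subtopology X S) {} id) (low_part (p - 1) (subtopology X S) {})"
      "mod_torsion_onto (homology_group (p - 1) (subtopology X E)) (homology_group (p - 1) X)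
        (low_part (p - 1) X {} \<circ> hom_induced (p - 1) (subtopology X E) {} X {} id) (low_part (p - 1) X {})"
      using P by (simp_all add: low_part_onto_def)
    show "hom_boundary p (subtopology X E) (E \<inter> S) \<in> hom (relative_homology_group p (subtopology X E) (E \<inter> S)) (homology_group (p - 1) (subtopology (subtopology X S) E))"
      using hom_boundary_hom[of p "subtopology X E" "E \<inter> S"] by (simp add: sub)
    fix x
    show "hom_induced p (subtopology X S) {} X {} id ((low_part p (subtopology X S) {} \<circ> hom_induced p (subtopology (subtopology X S) E) {} (subtopology X S) {} id) x)
      = (low_part p X {} \<circ> hom_induced p (subtopology X E) {} X {} id) (hom_induced p (subtopology (subtopology X S) E) {} (subtopology X E) {} id x)"
      "hom_induced p X {} X S id ((low_part p X {} \<circ> hom_induced p (subtopology X E) {} X {} id) x)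
      = (low_part p X S \<circ> hom_induced p (subtopology X E) (E \<inter> S) X S id) (hom_induced p (subtopology X E) {} (subtopology X E) (E \<inter> S) id x)"
      "hom_induced (p - 1) (subtopology X S) {} X {} id ((low_part (p - 1) (subtopology X S) {} \<circ> hom_induced (p - 1) (subtopology (subtopology X S) E) {} (subtopology X S) {} id) x)
      = (low_part (p - 1) X {} \<circ> hom_induced (p - 1) (subtopology X E) {} X {} id) (hom_induced (p - 1) (subtopology (subtopology X S) E) {} (subtopology X E) {} id x)"
      using c id by (intro low_part_square_id; simp)+
    show "hom_boundary p X S ((low_part p X S \<circ> hom_induced p (subtopology X E) (E \<inter> S) X S id) x) =
      (low_part (p - 1) (subtopology X S) {} \<circ> hom_induced (p - 1) (subtopology (subtopology X S) E) {} (subtopology X S) {} id)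
        (hom_boundary p (subtopology X E) (E \<inter> S) x)"
      by (rule low_part_square_boundary[OF c(1,2)])
  next
    fix y assume "y \<in> carrier (homology_group p (subtopology X S))"
    then show "hom_induced p (subtopology X S) {} X {} id (low_part p (subtopology X S) {} y) = low_part p X {} (hom_induced p (subtopology X S) {} X {} id y)"
      using c id by (intro low_part_induced_id) auto
  next
    fix y assume "y \<in> carrier (homology_group p X)"
    then show "hom_induced p X {} X S id (low_part p X {} y) = low_part p X S (hom_induced p X {} X S id y)"
      using c by (intro low_part_induced_id) auto
  next
    fix y assume "y \<in> carrier (relative_homology_group p X S)"
    then show "hom_boundary p X S (low_part p X S y) = low_part (p - 1) (subtopology X S) {} (hom_boundary p X S y)"
      by (rule hom_boundary_low_part[OF c(1,2)])
  qed (use c in \<open>auto simp: hom_induced_hom hom_boundary_hom low_part_hom low_part_comp_hom low_part_comp_low_part low_part_low_part simp del: o_apply\<close>)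
qed

text \<open>The same sequences moved by one place, with the absolute group of \<open>X\<close> in
  the middle. The relative group at the far left has degree \<open>p + 1\<close>.\<close>

lemma low_part_onto_absolute:
  assumes c: "conj_pair X S" "conj_pair X {}" "conj_pair (subtopology X S) {}"
    and P: "low_part_onto (p + 1) X E S" "low_part_onto p (subtopology X S) E {}"
      "low_part_onto p X E S" "low_part_onto (p - 1) (subtopology X S) E {}"
  shows "low_part_onto p X E {}"
proof -
  have sub: "subtopology (subtopology X E) (E \<inter> S) = subtopology (subtopology X S) E"
    by (simp add: subtopology_subtopology inf_commute inf_left_commute)
  have id: "continuous_map (subtopology X E) X id" "continuous_map (subtopology X S) X id"
    "continuous_map (subtopology (subtopology X S) E) (subtopology X E) id"
    "continuous_map (subtopology (subtopology X S) E) (subtopology X S) id"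
    by (auto simp: continuous_map_from_subtopology continuous_map_in_subtopology)
  have "mod_torsion_onto (homology_group p (subtopology X E)) (homology_group p X)
      (low_part p X {} \<circ> hom_induced p (subtopology X E) {} X {} id) (low_part p X {})"
  proof (rule mod_torsion_onto_five)
    show "kernel (homology_group p (subtopology (subtopology X S) E)) (homology_group p (subtopology X E))
          (hom_induced p (subtopology (subtopology X S) E) {} (subtopology X E) {} id)
      = hom_boundary (p + 1) (subtopology X E) (E \<inter> S) ` carrier (relative_homology_group (p + 1) (subtopology X E) (E \<inter> S))"
      using exact_pair_sub[of "p + 1" "subtopology X E" "E \<inter> S"] by (simp add: sub)
    show "kernel (homology_group p (subtopology X E)) (relative_homology_group p (subtopology X E) (E \<inter> S))
        (hom_induced p (subtopology X E) {} (subtopology X E) (E \<inter> S) id)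
      = hom_induced p (subtopology (subtopology X S) E) {} (subtopology X E) {} id ` carrier (homology_group p (subtopology (subtopology X S) E))"
      using exact_pair_abs[of p "subtopology X E" "E \<inter> S"] by (simp add: sub)
    show "kernel (relative_homology_group p (subtopology X E) (E \<inter> S)) (homology_group (p - 1) (subtopology (subtopology X S) E)) (hom_boundary p (subtopology X E) (E \<inter> S))
      = hom_induced p (subtopology X E) {} (subtopology X E) (E \<inter> S) id ` carrier (homology_group p (subtopology X E))"
      using exact_pair_rel[of p "subtopology X E" "E \<inter> S"] by (simp add: sub)
    show "kernel (homology_group p (subtopology X S)) (homology_group p X) (hom_induced p (subtopology X S) {} X {} id)
      = hom_boundary (p + 1) X S ` carrier (relative_homology_group (p + 1) X S)"
      using exact_pair_sub[of "p + 1" X S] by simp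
    show "kernel (homology_group p X) (relative_homology_group p X S) (hom_induced p X {} X S id)
      = hom_induced p (subtopology X S) {} X {} id ` carrier (homology_group p (subtopology X S))"
      "kernel (relative_homology_group p X S) (homology_group (p - 1) (subtopology X S)) (hom_boundary p X S)
      = hom_induced p X {} X S id ` carrier (homology_group p X)"
      by (rule exact_pair)+
    show "mod_torsion_onto (relative_homology_group (p + 1) (subtopology X E) (E \<inter> S)) (relative_homology_group (p + 1) X S)
        (low_part (p + 1) X S \<circ> hom_induced (p + 1) (subtopology X E) (E \<inter> S) X S id) (low_part (p + 1) X S)"
      "mod_torsion_onto (homology_group p (subtopology (subtopology X S) E)) (homology_group p (subtopology X S))
        (low_part p (subtopology X S) {} \<circ> hom_induced p (subtopology (subtopology X S) E) {} (subtopology X S) {} id) (low_part p (subtopology X S) {})"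
      "mod_torsion_onto (relative_homology_group p (subtopology X E) (E \<inter> S)) (relative_homology_group p X S)
        (low_part p X S \<circ> hom_induced p (subtopology X E) (E \<inter> S) X S id) (low_part p X S)"
      "mod_torsion_onto (homology_group (p - 1) (subtopology (subtopology X S) E)) (homology_group (p - 1) (subtopology X S))
        (low_part (p - 1) (subtopology X S) {} \<circ> hom_induced (p - 1) (subtopology (subtopology X S) E) {} (subtopology X S) {} id) (low_part (p - 1) (subtopology X S) {})"
      using P by (simp_all add: low_part_onto_def)
    show "hom_boundary (p + 1) (subtopology X E) (E \<inter> S) \<in> hom (relative_homology_group (p + 1) (subtopology X E) (E \<inter> S)) (homology_group p (subtopology (subtopology X S) E))"
      using hom_boundary_hom[of "p + 1" "subtopology X E" "E \<inter> S"] by (simp add: sub)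
    show "hom_boundary (p + 1) X S \<in> hom (relative_homology_group (p + 1) X S) (homology_group p (subtopology X S))"
      using hom_boundary_hom[of "p + 1" X S] by simp
    show "hom_boundary p (subtopology X E) (E \<inter> S) \<in> hom (relative_homology_group p (subtopology X E) (E \<inter> S)) (homology_group (p - 1) (subtopology (subtopology X S) E))"
      using hom_boundary_hom[of p "subtopology X E" "E \<inter> S"] by (simp add: sub)
    fix x
    show "hom_induced p (subtopology X S) {} X {} id ((low_part p (subtopology X S) {} \<circ> hom_induced p (subtopology (subtopology X S) E) {} (subtopology X S) {} id) x)
      = (low_part p X {} \<circ> hom_induced p (subtopology X E) {} X {} id) (hom_induced p (subtopology (subtopology X S) E) {} (subtopology X E) {} id x)"
      "hom_induced p X {} X S id ((low_part p X {} \<circ> hom_induced p (subtopology X E) {} X {} id) x)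
      = (low_part p X S \<circ> hom_induced p (subtopology X E) (E \<inter> S) X S id) (hom_induced p (subtopology X E) {} (subtopology X E) (E \<inter> S) id x)"
      using c id by (intro low_part_square_id; simp)+
    show "hom_boundary p X S ((low_part p X S \<circ> hom_induced p (subtopology X E) (E \<inter> S) X S id) x) =
      (low_part (p - 1) (subtopology X S) {} \<circ> hom_induced (p - 1) (subtopology (subtopology X S) E) {} (subtopology X S) {} id)
        (hom_boundary p (subtopology X E) (E \<inter> S) x)"
      by (rule low_part_square_boundary[OF c(1,2)])
    show "hom_boundary (p + 1) X S ((low_part (p + 1) X S \<circ> hom_induced (p + 1) (subtopology X E) (E \<inter> S) X S id) x) =
      (low_part p (subtopology X S) {} \<circ> hom_induced p (subtopology (subtopology X S) E) {} (subtopology X S) {} id)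
        (hom_boundary (p + 1) (subtopology X E) (E \<inter> S) x)"
      using low_part_square_boundary[OF c(1,2), of "p + 1" E x] by simp
  next
    fix y assume "y \<in> carrier (homology_group p (subtopology X S))"
    then show "hom_induced p (subtopology X S) {} X {} id (low_part p (subtopology X S) {} y) = low_part p X {} (hom_induced p (subtopology X S) {} X {} id y)"
      using c id by (intro low_part_induced_id) auto
  next
    fix y assume "y \<in> carrier (homology_group p X)"
    then show "hom_induced p X {} X S id (low_part p X {} y) = low_part p X S (hom_induced p X {} X S id y)"
      using c by (intro low_part_induced_id) auto
  next
    fix y assume "y \<in> carrier (relative_homology_group (p + 1) X S)"
    then show "hom_boundary (p + 1) X S (low_part (p + 1) X S y) = low_part p (subtopology X S) {} (hom_boundary (p + 1) X S y)"
      using hom_boundary_low_part[OF c(1,2), of y "p + 1"] by simp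
  qed (use c in \<open>auto simp: hom_induced_hom hom_boundary_hom low_part_hom low_part_comp_hom low_part_comp_low_part low_part_low_part simp del: o_apply\<close>)
  then show ?thesis by (simp add: low_part_onto_def)
qed

text \<open>Excision is an isomorphism both inside \<open>E\<close> and in the ambient space, and
  \<open>low_part\<close> is natural for the inclusions.\<close>

lemma low_part_onto_excision:
  assumes UV: "openin X U" "openin X V"
    and c: "conj_pair (subtopology X V) (U \<inter> V)" "conj_pair (subtopology X (U \<union> V)) U"
    and P: "low_part_onto p (subtopology X V) E (U \<inter> V)"
  shows "low_part_onto p (subtopology X (U \<union> V)) E U"
proof -
  have opE: "openin (subtopology X E) (E \<inter> U)" "openin (subtopology X E) (E \<inter> V)"
    using UV by (auto simp: openin_subtopology_Int2)
  have eqs: "subtopology (subtopology X E) (E \<inter> V) = subtopology (subtopology X V) E"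
    "subtopology (subtopology X E) (E \<inter> U \<union> E \<inter> V) = subtopology (subtopology X (U \<union> V)) E"
    "(E \<inter> U) \<inter> (E \<inter> V) = E \<inter> (U \<inter> V)"
    by (auto simp: subtopology_subtopology intro!: arg_cong[of _ _ "subtopology X"])
  have id: "continuous_map (subtopology X V) (subtopology X (U \<union> V)) id"
    "continuous_map (subtopology (subtopology X V) E) (subtopology X V) id"
    "continuous_map (subtopology (subtopology X (U \<union> V)) E) (subtopology X (U \<union> V)) id"
    "continuous_map (subtopology (subtopology X V) E) (subtopology (subtopology X (U \<union> V)) E) id"
    by (auto simp: continuous_map_from_subtopology continuous_map_in_subtopology)
  show ?thesis
    unfolding low_part_onto_def
  proof (rule mod_torsion_onto_cong_iso)
    show "hom_induced p (subtopology (subtopology X V) E) (E \<inter> (U \<inter> V)) (subtopology (subtopology X (U \<union> V)) E) (E \<inter> U) id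
      \<in> iso (relative_homology_group p (subtopology (subtopology X V) E) (E \<inter> (U \<inter> V)))
        (relative_homology_group p (subtopology (subtopology X (U \<union> V)) E) (E \<inter> U))"
      using homology_excision_open_Un[OF opE, of p] unfolding eqs .
    show "hom_induced p (subtopology X V) (U \<inter> V) (subtopology X (U \<union> V)) U id
      \<in> iso (relative_homology_group p (subtopology X V) (U \<inter> V)) (relative_homology_group p (subtopology X (U \<union> V)) U)"
      by (rule homology_excision_open_Un[OF UV])
    show "mod_torsion_onto (relative_homology_group p (subtopology (subtopology X V) E) (E \<inter> (U \<inter> V))) (relative_homology_group p (subtopology X V) (U \<inter> V))
       (low_part p (subtopology X V) (U \<inter> V) \<circ> hom_induced p (subtopology (subtopology X V) E) (E \<inter> (U \<inter> V)) (subtopology X V) (U \<inter> V) id) (low_part p (subtopology X V) (U \<inter> V))"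
      using P by (simp add: low_part_onto_def)
    fix x
    show "hom_induced p (subtopology X V) (U \<inter> V) (subtopology X (U \<union> V)) U id ((low_part p (subtopology X V) (U \<inter> V) \<circ>
          hom_induced p (subtopology (subtopology X V) E) (E \<inter> (U \<inter> V)) (subtopology X V) (U \<inter> V) id) x) =
      (low_part p (subtopology X (U \<union> V)) U \<circ> hom_induced p (subtopology (subtopology X (U \<union> V)) E) (E \<inter> U) (subtopology X (U \<union> V)) U id)
        (hom_induced p (subtopology (subtopology X V) E) (E \<inter> (U \<inter> V)) (subtopology (subtopology X (U \<union> V)) E) (E \<inter> U) id x)"
      by (intro low_part_square_id c id) auto
  next
    fix y assume "y \<in> carrier (relative_homology_group p (subtopology X V) (U \<inter> V))"
    then show "hom_induced p (subtopology X V) (U \<inter> V) (subtopology X (U \<union> V)) U id (low_part p (subtopology X V) (U \<inter> V) y) =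
      low_part p (subtopology X (U \<union> V)) U (hom_induced p (subtopology X V) (U \<inter> V) (subtopology X (U \<union> V)) U id y)"
      by (intro low_part_induced_id c id) auto
  qed (auto simp: low_part_hom low_part_comp_hom)
qed

text \<open>Takes the place of a Mayer-Vietoris sequence: from \<open>V\<close> and the intersection
  to the pair of the two, by excision to the pair of the union and \<open>U\<close>, and from there
  to the union itself. The five lemma mixes neighbouring degrees, so the hypotheses are for all
  \<open>p\<close>.\<close>

lemma low_part_onto_Un:
  assumes UV: "openin W U" "openin W V"
    and P: "\<And>p. low_part_onto p (subtopology (prod_topology W proj_space) (U \<times> topspace proj_space)) E {}"
      "\<And>p. low_part_onto p (subtopology (prod_topology W proj_space) (V \<times> topspace proj_space)) E {}"
      "\<And>p. low_part_onto p (subtopology (prod_topology W proj_space) ((U \<inter> V) \<times> topspace proj_space)) E {}"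
  shows "low_part_onto p (subtopology (prod_topology W proj_space) ((U \<union> V) \<times> topspace proj_space)) E {}"
proof -
  let ?X = "prod_topology W proj_space"
  have c: "conj_pair (subtopology ?X (U \<times> topspace proj_space)) (A \<times> topspace proj_space)" for U A by (rule conj_pair_cyl)
  have c0: "conj_pair (subtopology ?X (U \<times> topspace proj_space)) {}" for U using c[of U "{}"] by simp
  have sVU: "subtopology (subtopology ?X (V \<times> topspace proj_space)) ((U \<inter> V) \<times> topspace proj_space) = subtopology ?X ((U \<inter> V) \<times> topspace proj_space)"
    and sUVU: "subtopology (subtopology ?X ((U \<union> V) \<times> topspace proj_space)) (U \<times> topspace proj_space) = subtopology ?X (U \<times> topspace proj_space)"
    by (auto simp: subtopology_subtopology Times_Int_Times intro!: arg_cong[of _ _ "subtopology ?X"])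
  have rel: "low_part_onto p (subtopology ?X (V \<times> topspace proj_space)) E ((U \<inter> V) \<times> topspace proj_space)" for p
    by (rule low_part_onto_relative[OF c c0]; (unfold sVU)?; rule c0 P)
  have rel_Un: "low_part_onto p (subtopology ?X ((U \<union> V) \<times> topspace proj_space)) E (U \<times> topspace proj_space)" for p
  proof -
    have open_UV: "openin ?X (U \<times> topspace proj_space)" "openin ?X (V \<times> topspace proj_space)"
      using UV by (auto simp: openin_prod_Times_iff)
    have Int: "U \<times> topspace proj_space \<inter> V \<times> topspace proj_space = (U \<inter> V) \<times> topspace (proj_space :: (complex ^ 'b) set topology)"
      and Un: "U \<times> topspace proj_space \<union> V \<times> topspace proj_space = (U \<union> V) \<times> topspace (proj_space :: (complex ^ 'b) set topology)"
      by auto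
    show ?thesis
      using low_part_onto_excision[OF open_UV, where p = p and E = E] rel[of p] c unfolding Int Un by blast
  qed
  show ?thesis
    by (rule low_part_onto_absolute[where S = "U \<times> topspace proj_space", OF c c0]; (unfold sUVU)?; rule c0 P rel_Un)
qed

section \<open>Lines orthogonal to a family of lines\<close>

text \<open>The spanning vector normalised at coordinate \<open>i\<close>. It depends continuously
  on the line within the chart and turns a family of lines into a family of vectors there.\<close>

definition chart_rep :: "'n \<Rightarrow> (complex ^ 'n) set \<Rightarrow> complex ^ 'n" where
  "chart_rep i L = (THE v. v \<in> L \<and> v $ i = 1)"

lemma chart_rep_span:
  assumes "x $ i \<noteq> 0"
  shows "chart_rep i (vec.span {x}) = inverse (x $ i) *s x"
  unfolding chart_rep_def
proof (rule the_equality)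
  show "inverse (x $ i) *s x \<in> vec.span {x} \<and> (inverse (x $ i) *s x) $ i = 1"
    using assms by (auto simp: vec.span_singleton)
  fix v assume v: "v \<in> vec.span {x} \<and> v $ i = 1"
  then obtain k where "v = k *s x" unfolding vec.span_singleton by blast
  then show "v = inverse (x $ i) *s x" using v assms by (simp add: field_simps)
qed

lemma chart_rep:
  assumes "L \<in> chart_lines i"
  shows "chart_rep i L $ i = 1" "L = vec.span {chart_rep i L}"
proof -
  from assms obtain x where x: "x \<noteq> 0" "x $ i \<noteq> 0" "L = vec.span {x}" by (rule lines_ofE) simp
  then show "chart_rep i L $ i = 1" by (simp add: chart_rep_span)
  have "vec.span {x} = vec.span {inverse (x $ i) *s x}"
    using x span_singleton_eq_iff[of x] by (metis inverse_nonzero_iff_nonzero)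
  then show "L = vec.span {chart_rep i L}" using x by (simp add: chart_rep_span)
qed

lemma continuous_map_chart_rep:
  "continuous_map (subtopology proj_space (chart_lines i)) euclidean (chart_rep i :: _ \<Rightarrow> complex ^ 'n)"
proof -
  let ?U = "{x \<in> topspace (nonzero_vecs :: (complex ^ 'n) topology). vec.span {x} \<in> chart_lines i}"
  have q: "quotient_map (subtopology nonzero_vecs ?U) (subtopology proj_space (chart_lines i)) (\<lambda>x :: complex ^ 'n. vec.span {x})"
    by (intro quotient_map_restriction quotient_map_proj_space refl disjI1 openin_chart_lines)
  have U: "?U = {x. x $ i \<noteq> 0}" by (auto simp: span_in_chart_lines)
  have "continuous_on ({x. x $ i \<noteq> 0}) (\<lambda>x :: complex ^ 'n. inverse (x $ i) *s x)"
    by (intro continuous_intros) auto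
  moreover have "subtopology nonzero_vecs ?U = top_of_set {x :: complex ^ 'n. x $ i \<noteq> 0}"
    unfolding U by (auto simp: subtopology_subtopology intro!: arg_cong[of _ _ "subtopology euclidean"])
  ultimately have "continuous_map (subtopology nonzero_vecs ?U) euclidean (\<lambda>x :: complex ^ 'n. inverse (x $ i) *s x)"
    by simp
  then have "continuous_map (subtopology nonzero_vecs ?U) euclidean (chart_rep i \<circ> (\<lambda>x :: complex ^ 'n. vec.span {x}))"
    by (rule continuous_map_eq) (use U in \<open>auto simp: chart_rep_span span_in_chart_lines\<close>)
  then show ?thesis using continuous_compose_quotient_map_eq[OF q] by blast
qed

lemma orthogonal_lines_span:
  "orthogonal_lines (vec.span {x}) (vec.span {y}) \<longleftrightarrow> hermitian_inner x y = 0"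
proof
  assume "orthogonal_lines (vec.span {x}) (vec.span {y})"
  then show "hermitian_inner x y = 0" by (simp add: orthogonal_lines_def vec.span_base)
next
  assume "hermitian_inner x y = 0"
  then have "hermitian_inner (k *s x) (l *s y) = 0" for k l
    unfolding hermitian_inner_def
    by (simp add: sum_distrib_left[symmetric] mult.assoc mult.left_commute[of _ "cnj l"])
  then show "orthogonal_lines (vec.span {x}) (vec.span {y})"
    by (auto simp: orthogonal_lines_def vec.span_singleton)
qed

lemma hermitian_inner_3:
  fixes x y :: "complex ^ 3"
  assumes "distinct [i, j, k]"
  shows "hermitian_inner x y = x $ i * cnj (y $ i) + x $ j * cnj (y $ j) + x $ k * cnj (y $ k)"
proof -
  have U: "UNIV = {i, j, k}" using forall_3_distinct[OF assms, of "\<lambda>m. m \<in> {i, j, k}"] by auto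
  show ?thesis unfolding hermitian_inner_def U using assms by (simp add: add.assoc)
qed

text \<open>For \<open>t = 1\<close> and \<open>m\<^sub>i = 1\<close> this is the inverse of the coordinate projection on the
  orthogonal complement of \<open>m\<close>; for \<open>t = 0\<close> it is the embedding of the coordinate plane.\<close>

definition graph_map :: "'n \<Rightarrow> 'n \<Rightarrow> complex ^ 'n \<Rightarrow> real \<Rightarrow> complex ^ 2 \<Rightarrow> complex ^ 'n" where
  "graph_map j k m t y = (\<chi> l. if l = j then y $ 1 else if l = k then y $ 2
     else - of_real t * (y $ 1 * cnj (m $ j) + y $ 2 * cnj (m $ k)))"

lemma graph_map_nth:
  assumes "distinct [i, j, k]"
  shows "graph_map j k m t y $ j = y $ 1" "graph_map j k m t y $ k = y $ 2"
    "graph_map j k m t y $ i = - of_real t * (y $ 1 * cnj (m $ j) + y $ 2 * cnj (m $ k))"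
  using assms by (auto simp: graph_map_def)

lemma line_preserving_graph_map: "line_preserving (graph_map j k m t)"
  by (intro line_preserving_if_linear) (simp add: vec_eq_iff graph_map_def algebra_simps)

lemma proj_graph_map: "j \<noteq> k \<Longrightarrow> proj_coords j k (graph_map j k m t y) = y"
  by (simp add: vec_eq_iff forall_2 proj_coords_nth graph_map_def)

lemma graph_map_neq_0: "j \<noteq> k \<Longrightarrow> y \<noteq> 0 \<Longrightarrow> graph_map j k m t y \<noteq> 0"
proof
  assume "j \<noteq> k" "y \<noteq> 0" "graph_map j k m t y = 0"
  then show False using proj_graph_map[of j k m t y] by (auto simp: vec_eq_iff forall_2 proj_coords_nth)
qed

lemma graph_map_0: "distinct [i, j, k] \<Longrightarrow> graph_map j k m 0 = embed_coords j k"
  by (auto simp: fun_eq_iff vec_eq_iff graph_map_def embed_coords_nth)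

text \<open>The bundle sees a decoration of the collapsed graph only through its line at the joined
  edge, so the topology is done for a continuous family of lines over a base
  \<open>W\<close>.\<close>

locale line_family =
  fixes W :: "'w topology" and f :: "'w \<Rightarrow> (complex ^ 3) set"
  assumes cont_f: "continuous_map W proj_space f"
begin

definition orth_bundle :: "('w \<times> (complex ^ 3) set) set" where
  "orth_bundle = {(w, L). orthogonal_lines L (f w)}"

definition chart_base :: "3 \<Rightarrow> 'w set" where
  "chart_base i = {w \<in> topspace W. f w \<in> chart_lines i}"

abbreviation "total_space \<equiv> prod_topology W (proj_space :: (complex ^ 3) set topology)"

lemma openin_chart_base: "openin W (chart_base i)"
  unfolding chart_base_def by (rule openin_continuous_map_preimage[OF cont_f openin_chart_lines])

lemma chart_base_cover: "topspace W = chart_base 1 \<union> chart_base 2 \<union> chart_base 3"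
proof
  show "topspace W \<subseteq> chart_base 1 \<union> chart_base 2 \<union> chart_base 3"
  proof
    fix w assume w: "w \<in> topspace W"
    then have "f w \<in> topspace proj_space" using cont_f by (auto simp: continuous_map_def)
    then obtain x where "x \<noteq> 0" "f w = vec.span {x}" by (rule complex_linesE)
    then show "w \<in> chart_base 1 \<union> chart_base 2 \<union> chart_base 3"
      using w by (auto simp: chart_base_def span_in_chart_lines vec_eq_iff forall_3)
  qed
qed (auto simp: chart_base_def)

text \<open>Scaling the \<open>i\<close>-th coordinate of the graph by \<open>t\<close> tilts the
  coordinate plane v_i = 0 into the orthogonal complement of \<open>f w\<close>. Coordinates
  \<open>j\<close> and \<open>k\<close> do not move, which keeps nonzero vectors nonzero.\<close>

lemma homotopic_graph_maps:
  assumes ijk: "distinct [i, j, k]" and V: "V \<subseteq> chart_base i"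
  shows "homotopic_with (\<lambda>h. True) (prod_topology (subtopology W V) proj_space) (prod_topology (subtopology W V) proj_space)
    (\<lambda>(w, L). (w, line_map (embed_coords j k) L)) (\<lambda>(w, L). (w, line_map (graph_map j k (chart_rep i (f w)) 1) L))"
proof -
  have jk: "j \<noteq> k" using ijk by simp
  let ?V = "subtopology W V"
  have rep: "continuous_map ?V euclidean (\<lambda>w. chart_rep i (f w))"
  proof -
    have "continuous_map ?V (subtopology proj_space (chart_lines i)) f"
      using cont_f V by (auto simp: continuous_map_in_subtopology chart_base_def intro: continuous_map_from_subtopology)
    from continuous_map_compose[OF this continuous_map_chart_rep] show ?thesis by (simp add: o_def)
  qed
  have "continuous_map (prod_topology (prod_topology (top_of_set {0..1::real}) ?V) euclidean)
      (prod_topology (prod_topology euclidean euclidean) euclidean)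
      (\<lambda>((t, w), y :: complex ^ 2). ((t, chart_rep i (f w)), y))"
    unfolding case_prod_unfold
  proof (intro continuous_map_pairedI)
    let ?P = "prod_topology (prod_topology (top_of_set {0..1::real}) ?V) (euclidean :: (complex ^ 2) topology)"
    have 1: "continuous_map ?P (top_of_set {0..1}) (fst \<circ> fst)" "continuous_map ?P ?V (snd \<circ> fst)"
      by (rule continuous_map_compose[OF continuous_map_fst continuous_map_fst] continuous_map_compose[OF continuous_map_fst continuous_map_snd])+
    show "continuous_map ?P euclidean (\<lambda>x. fst (fst x))"
      using continuous_map_into_fulltopology[OF 1(1)] by (simp add: o_def)
    show "continuous_map ?P euclidean (\<lambda>x. chart_rep i (f (snd (fst x))))"
      using continuous_map_compose[OF 1(2) rep] by (simp add: o_def)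
  qed (rule continuous_map_snd)
  moreover have "continuous_map (prod_topology (prod_topology euclidean euclidean) euclidean) euclidean
      (\<lambda>((t, m), y). graph_map j k m t y)"
  proof -
    have "continuous_on UNIV (\<lambda>x :: (real \<times> (complex ^ 3)) \<times> (complex ^ 2). graph_map j k (snd (fst x)) (fst (fst x)) (snd x))"
      unfolding graph_map_def
    proof (rule continuous_on_vec_lambda)
      fix l
      show "continuous_on UNIV (\<lambda>x :: (real \<times> (complex ^ 3)) \<times> (complex ^ 2). if l = j then snd x $ 1 else if l = k then snd x $ 2
          else - of_real (fst (fst x)) * (snd x $ 1 * cnj (snd (fst x) $ j) + snd x $ 2 * cnj (snd (fst x) $ k)))"
        by (cases "l = j"; cases "l = k") (auto intro!: continuous_intros)
    qed
    then show ?thesis by (simp add: case_prod_unfold)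
  qed
  ultimately have "continuous_map (prod_topology (prod_topology (top_of_set {0..1::real}) ?V) euclidean) euclidean
      ((\<lambda>((t, m), y). graph_map j k m t y) \<circ> (\<lambda>((t, w), y :: complex ^ 2). ((t, chart_rep i (f w)), y)))"
    by (rule continuous_map_compose)
  then have cont: "continuous_map (prod_topology (prod_topology (top_of_set {0..1::real}) ?V) euclidean) euclidean
      (\<lambda>((t, w), y). graph_map j k (chart_rep i (f w)) t y)"
    by (simp add: o_def case_prod_unfold)
  have "homotopic_with (\<lambda>h. h \<in> topspace ?V \<times> {} \<rightarrow> topspace ?V \<times> {}) (cyl ?V (topspace proj_space)) (cyl ?V (topspace proj_space))
    (\<lambda>(w, L). (w, line_map (graph_map j k (chart_rep i (f w)) 0) L)) (\<lambda>(w, L). (w, line_map (graph_map j k (chart_rep i (f w)) 1) L))"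
    by (rule homotopic_line_maps[OF openin_topspace _ cont])
      (auto simp: line_preserving_graph_map graph_map_neq_0 jk)
  then show ?thesis
    by (simp add: graph_map_0[OF ijk])
qed

text \<open>Where the representative of \<open>f w\<close> has \<open>i\<close>-th coordinate 1,
  orthogonality is an equation that solves for x_i in terms of x_j and x_k. The projection to these
  two coordinates therefore identifies the orthogonal complement with C^2.\<close>

lemma homeomorphic_maps_chart:
  assumes ijk: "distinct [i, j, k]" and V: "V \<subseteq> chart_base i"
  shows "homeomorphic_maps (subtopology total_space (orth_bundle \<inter> V \<times> topspace proj_space))
    (prod_topology (subtopology W V) proj_space)
    (\<lambda>(w, L). (w, line_map (proj_coords j k) L)) (\<lambda>(w, L). (w, line_map (graph_map j k (chart_rep i (f w)) 1) L))"
proof -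
  have jk: "j \<noteq> k" using ijk by simp
  let ?E = "subtopology total_space (orth_bundle \<inter> V \<times> topspace proj_space)"
  let ?B = "prod_topology (subtopology W V) (proj_space :: (complex ^ 2) set topology)"
  let ?h = "\<lambda>(w, L). (w, line_map (proj_coords j k) L)"
  let ?g = "\<lambda>(w, L). (w, line_map (graph_map j k (chart_rep i (f w)) 1) L)"
  have V': "V \<subseteq> topspace W" using V by (auto simp: chart_base_def)
  have g: "line_map (graph_map j k m t) (vec.span {y}) = vec.span {graph_map j k m t y}" for m t y
    by (rule line_map_span[OF line_preserving_graph_map])
  have p: "line_map (proj_coords j k) (vec.span {v}) = vec.span {proj_coords j k v}" for v :: "complex ^ 3"
    by (rule line_map_span[OF line_preserving_proj_coords])
  have orth: "orthogonal_lines (vec.span {x}) (f w) \<longleftrightarrow>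
      x $ i = - (x $ j * cnj (chart_rep i (f w) $ j) + x $ k * cnj (chart_rep i (f w) $ k))" if w: "w \<in> V" for x w
  proof -
    have fw: "f w \<in> chart_lines i" using w V by (auto simp: chart_base_def)
    have "orthogonal_lines (vec.span {x}) (f w) \<longleftrightarrow> hermitian_inner x (chart_rep i (f w)) = 0"
      using chart_rep(2)[OF fw] orthogonal_lines_span by metis
    also have "\<dots> \<longleftrightarrow> x $ i + (x $ j * cnj (chart_rep i (f w) $ j) + x $ k * cnj (chart_rep i (f w) $ k)) = 0"
      by (simp add: hermitian_inner_3[OF ijk] chart_rep(1)[OF fw] add.assoc)
    finally show ?thesis unfolding eq_neg_iff_add_eq_0 .
  qed
  have E: "\<exists>x. x \<noteq> 0 \<and> (x $ j \<noteq> 0 \<or> x $ k \<noteq> 0) \<and> L = vec.span {x} \<and> graph_map j k (chart_rep i (f w)) 1 (proj_coords j k x) = x"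
    if "w \<in> V" "L \<in> topspace proj_space" "orthogonal_lines L (f w)" for w L
  proof -
    obtain x where x: "x \<noteq> 0" "L = vec.span {x}" using \<open>L \<in> topspace proj_space\<close> by (rule complex_linesE)
    then have xi: "x $ i = - (x $ j * cnj (chart_rep i (f w) $ j) + x $ k * cnj (chart_rep i (f w) $ k))"
      using that orth by simp
    \<comment> \<open>If both vanished, the equation would force x_i = 0 as well; so the projection
      of a nonzero orthogonal vector is nonzero.\<close>
    have "x $ j \<noteq> 0 \<or> x $ k \<noteq> 0"
    proof (rule ccontr)
      assume "\<not> ?thesis"
      then have "x = 0" using xi unfolding vec_eq_iff forall_3_distinct[OF ijk] by simp
      then show False using x by simp
    qed
    moreover have "graph_map j k (chart_rep i (f w)) 1 (proj_coords j k x) = x"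
      unfolding vec_eq_iff forall_3_distinct[OF ijk] graph_map_nth[OF ijk] proj_coords_nth using xi by simp
    ultimately show ?thesis using x by (intro exI[of _ x]) simp
  qed
  show ?thesis
    unfolding homeomorphic_maps_def
  proof (intro conjI ballI)
    have "continuous_map ?E (subtopology proj_space (off_axis_lines j k)) snd"
      unfolding continuous_map_in_subtopology
    proof
      show "continuous_map ?E proj_space snd" by (rule continuous_map_subtopology_snd)
      show "snd \<in> topspace ?E \<rightarrow> off_axis_lines j k"
      proof
        fix z assume "z \<in> topspace ?E"
        then obtain w L where z: "z = (w, L)" "w \<in> V" "L \<in> topspace proj_space" "orthogonal_lines L (f w)"
          by (auto simp: orth_bundle_def)
        from E[OF z(2-4)] obtain x where "x $ j \<noteq> 0 \<or> x $ k \<noteq> 0" "L = vec.span {x}" by blast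
        then show "snd z \<in> off_axis_lines j k" using z(1) by (simp add: span_in_off_axis_lines)
      qed
    qed
    moreover have "continuous_map (subtopology proj_space (off_axis_lines j k)) proj_space (line_map (proj_coords j k))"
      using continuous_map_line_map_single[OF openin_off_axis_lines continuous_on_proj_coords line_preserving_proj_coords]
      by (simp add: span_in_off_axis_lines vec_eq_iff forall_2 proj_coords_nth)
    ultimately have "continuous_map ?E proj_space (line_map (proj_coords j k) \<circ> snd)"
      by (rule continuous_map_compose)
    moreover have "continuous_map ?E (subtopology W V) fst"
      by (auto simp: continuous_map_in_subtopology continuous_map_subtopology_fst)
    ultimately show "continuous_map ?E ?B ?h"
      unfolding case_prod_unfold by (intro continuous_map_pairedI) (simp_all add: o_def)
  next
    have "continuous_map ?B (prod_topology (subtopology W V) proj_space) ?g"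
      using homotopic_with_imp_continuous_maps[OF homotopic_graph_maps[OF assms]] by blast
    moreover have "prod_topology (subtopology W V) proj_space = subtopology total_space (V \<times> topspace proj_space)"
      by (simp add: prod_topology_subtopology(1))
    ultimately have "continuous_map ?B total_space ?g" "?g \<in> topspace ?B \<rightarrow> V \<times> topspace proj_space"
      by (simp_all add: continuous_map_in_subtopology)
    moreover have "?g \<in> topspace ?B \<rightarrow> orth_bundle"
    proof
      fix z assume "z \<in> topspace ?B"
      then obtain w L where z: "z = (w, L)" "w \<in> V" "L \<in> topspace proj_space" by auto
      then obtain y where y: "L = vec.span {y}" using complex_linesE by blast
      show "?g z \<in> orth_bundle"
        using z(2) by (simp add: z(1) y g orth_bundle_def orth graph_map_nth[OF ijk])
    qed
    ultimately show "continuous_map ?B ?E ?g"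
      unfolding continuous_map_in_subtopology by blast
  next
    fix z assume "z \<in> topspace ?E"
    then obtain w L where z: "z = (w, L)" "w \<in> V" "L \<in> topspace proj_space" "orthogonal_lines L (f w)"
      by (auto simp: orth_bundle_def)
    from E[OF z(2-4)] obtain x where "L = vec.span {x}" "graph_map j k (chart_rep i (f w)) 1 (proj_coords j k x) = x" by blast
    then show "?g (?h z) = z" by (simp add: z(1) g p)
  next
    fix z assume "z \<in> topspace ?B"
    then obtain w L where z: "z = (w, L)" "L \<in> topspace proj_space" by auto
    then obtain y where y: "L = vec.span {y}" using complex_linesE by blast
    show "?h (?g z) = z" by (simp add: z(1) y g p proj_graph_map jk)
  qed
qed

end

lemma ex_distinct_3: "\<exists>j k. distinct [i :: 3, j, k]"
proof -
  consider "i = 1" | "i = 2" | "i = 3" using exhaust_3 by blast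
  then show ?thesis
  proof cases
    case 1
    then show ?thesis by (intro exI[of _ 2] exI[of _ 3]) simp
  next
    case 2
    then show ?thesis by (intro exI[of _ 1] exI[of _ 3]) simp
  next
    case 3
    then show ?thesis by (intro exI[of _ 1] exI[of _ 2]) simp
  qed
qed

context line_family
begin

text \<open>The inverse trivialisation followed by the inclusion into W x CP^2 is homotopic to the
  standard embedding of CP^1, so \<open>mod_torsion_onto_prod\<close> transfers along an
  isomorphism. Any subset \<open>V\<close> of a chart is allowed, so that overlaps are covered
  too.\<close>

lemma low_part_onto_chart:
  assumes V: "V \<subseteq> chart_base i"
  shows "low_part_onto p (subtopology total_space (V \<times> topspace proj_space)) orth_bundle {}"
proof -
  obtain j k where ijk: "distinct [i, j, k]" using ex_distinct_3 by blast
  let ?V = "subtopology W V"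
  let ?X1 = "prod_topology ?V (proj_space :: (complex ^ 2) set topology)"
  let ?X2 = "prod_topology ?V (proj_space :: (complex ^ 3) set topology)"
  let ?E = "subtopology ?X2 orth_bundle"
  let ?g = "\<lambda>(w, L). (w, line_map (graph_map j k (chart_rep i (f w)) 1) L)"
  let ?e = "\<lambda>(w, L). (w, line_map (embed_coords j k) L)"
  have X2: "subtopology total_space (V \<times> topspace proj_space) = ?X2"
    by (simp add: prod_topology_subtopology(1))
  have E: "subtopology total_space (orth_bundle \<inter> V \<times> topspace proj_space) = ?E"
    by (simp flip: X2 add: subtopology_subtopology Int_commute)
  have hom: "homeomorphic_maps ?E ?X1 (\<lambda>(w, L). (w, line_map (proj_coords j k) L)) ?g"
    using homeomorphic_maps_chart[OF ijk V] unfolding E .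
  have g_iso: "hom_induced p ?X1 {} ?E {} ?g \<in> iso (homology_group p ?X1) (homology_group p ?E)"
    using hom by (intro homeomorphic_map_homology_iso) (meson homeomorphic_maps_map)
  have cont_g: "continuous_map ?X1 ?E ?g" using hom by (simp add: homeomorphic_maps_def)
  have e_g: "hom_induced p ?X1 {} ?X2 {} ?e = hom_induced p ?X1 {} ?X2 {} ?g"
    by (rule homology_homotopy_empty[OF homotopic_graph_maps[OF ijk V]])
  have sq: "hom_induced p ?X1 {} ?X2 {} ?e x = hom_induced p ?E {} ?X2 {} id (hom_induced p ?X1 {} ?E {} ?g x)" for x
    unfolding e_g using cont_g by (subst hom_induced_compose') (auto simp: continuous_map_from_subtopology)
  have "mod_torsion_onto (homology_group p ?E) (homology_group p ?X2)
      (low_part p ?X2 {} \<circ> hom_induced p ?E {} ?X2 {} id) (low_part p ?X2 {})"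
  proof (rule mod_torsion_onto_cong_iso[OF _ _ _ _ g_iso id_iso])
    show "mod_torsion_onto (homology_group p ?X1) (homology_group p ?X2)
        (low_part p ?X2 {} \<circ> hom_induced p ?X1 {} ?X2 {} ?e) (low_part p ?X2 {})"
      by (rule mod_torsion_onto_prod[OF ijk])
    fix x
    show "id ((low_part p ?X2 {} \<circ> hom_induced p ?X1 {} ?X2 {} ?e) x) =
        (low_part p ?X2 {} \<circ> hom_induced p ?E {} ?X2 {} id) (hom_induced p ?X1 {} ?E {} ?g x)"
      by (simp add: sq)
  qed (auto simp: low_part_hom low_part_comp_hom)
  then show ?thesis by (simp add: low_part_onto_def X2)
qed

text \<open>Two gluing steps. The overlap of the third chart with the union of the first two is
  again a subset of one chart.\<close>

lemma low_part_onto_total: "low_part_onto p total_space orth_bundle {}"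
proof -
  have sub: "chart_base i \<inter> V \<subseteq> chart_base i" "V \<inter> chart_base i \<subseteq> chart_base i" for i V by auto
  have "low_part_onto p (subtopology total_space ((chart_base 1 \<union> chart_base 2) \<times> topspace proj_space)) orth_bundle {}" for p
    by (intro low_part_onto_Un openin_chart_base low_part_onto_chart[OF order_refl] low_part_onto_chart[OF sub(1)])
  then have "low_part_onto p (subtopology total_space ((chart_base 1 \<union> chart_base 2 \<union> chart_base 3) \<times> topspace proj_space)) orth_bundle {}"
    by (intro low_part_onto_Un openin_Un openin_chart_base low_part_onto_chart[OF order_refl] low_part_onto_chart[OF sub(2)])
  then show ?thesis
    by (simp flip: chart_base_cover topspace_prod_topology add: subtopology_topspace)
qed

text \<open>\<open>E\<close> and W x CP^1 are compared inside the same group: each is, modulo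
  torsion, the image of \<open>low_part\<close> on the homology of W x CP^2.\<close>

theorem abelian_rank_homology_orth_bundle:
  "abelian_rank (homology_group p (subtopology total_space orth_bundle)) =
     abelian_rank (homology_group p W) + abelian_rank (homology_group (p - 2) W)"
proof -
  have ijk: "distinct [1 :: 3, 2, 3]" by simp
  have "abelian_rank (homology_group p (subtopology total_space orth_bundle)) =
      abelian_rank (homology_group p (prod_topology W (proj_space :: (complex ^ 2) set topology)))"
  proof (rule abelian_rank_cong_mod_torsion_onto)
    show "mod_torsion_onto (homology_group p (subtopology total_space orth_bundle)) (homology_group p total_space)
        (low_part p total_space {} \<circ> hom_induced p (subtopology total_space orth_bundle) {} total_space {} id) (low_part p total_space {})"
      using low_part_onto_total by (simp add: low_part_onto_def)
    show "mod_torsion_onto (homology_group p (prod_topology W (proj_space :: (complex ^ 2) set topology))) (homology_group p total_space)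
        (low_part p total_space {} \<circ> hom_induced p (prod_topology W proj_space) {} total_space {}
          (\<lambda>(w, L). (w, line_map (embed_coords 2 3) L))) (low_part p total_space {})"
      by (rule mod_torsion_onto_prod[OF ijk])
  qed (auto simp: hom_induced_hom low_part_hom)
  then show ?thesis by (simp add: abelian_rank_homology_prod_proj_line)
qed

lemma fibre_bundle_orth_bundle:
  "fibre_bundle (proj_space :: (complex ^ 2) set topology) (subtopology total_space orth_bundle) W fst"
proof -
  let ?E = "subtopology total_space orth_bundle"
  have triv: "\<exists>h. homeomorphic_map (subtopology ?E {y \<in> topspace ?E. fst y \<in> chart_base i})
      (prod_topology (subtopology W (chart_base i)) (proj_space :: (complex ^ 2) set topology)) h \<and> (\<forall>y. fst (h y) = fst y)"
    and onto: "chart_base i \<subseteq> fst ` topspace ?E" for i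
  proof -
    obtain j k where ijk: "distinct [i, j, k]" using ex_distinct_3 by blast
    have *: "subtopology ?E {y \<in> topspace ?E. fst y \<in> chart_base i} =
        subtopology total_space (orth_bundle \<inter> chart_base i \<times> topspace proj_space)"
    proof -
      have "orth_bundle \<inter> {y \<in> topspace ?E. fst y \<in> chart_base i} = orth_bundle \<inter> chart_base i \<times> topspace proj_space"
        by (auto simp: chart_base_def)
      then show ?thesis by (simp add: subtopology_subtopology)
    qed
    show "\<exists>h. homeomorphic_map (subtopology ?E {y \<in> topspace ?E. fst y \<in> chart_base i})
      (prod_topology (subtopology W (chart_base i)) (proj_space :: (complex ^ 2) set topology)) h \<and> (\<forall>y. fst (h y) = fst y)"
      unfolding *
      using homeomorphic_maps_chart[OF ijk order_refl]
      by (intro exI[of _ "\<lambda>(w, L). (w, line_map (proj_coords j k) L)"]) (auto simp: homeomorphic_maps_map)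
    show "chart_base i \<subseteq> fst ` topspace ?E"
    proof
      fix w assume w: "w \<in> chart_base i"
      let ?g = "\<lambda>(w, L). (w, line_map (graph_map j k (chart_rep i (f w)) 1) L)"
      have "continuous_map (prod_topology (subtopology W (chart_base i)) proj_space)
          (subtopology total_space (orth_bundle \<inter> chart_base i \<times> topspace proj_space)) ?g"
        using homeomorphic_maps_chart[OF ijk order_refl] by (simp add: homeomorphic_maps_def)
      moreover have "(w, real_line) \<in> topspace (prod_topology (subtopology W (chart_base i)) (proj_space :: (complex ^ 2) set topology))"
        using w real_line_in_proj_space by (auto simp: chart_base_def)
      \<comment> \<open>Any point of the model fibre would do; through the trivialisation it shows
        that the fibre over \<open>w\<close> is nonempty.\<close>
      ultimately have "?g (w, real_line) \<in> topspace (subtopology total_space (orth_bundle \<inter> chart_base i \<times> topspace proj_space))"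
        using continuous_map_image_subset_topspace by blast
      then show "w \<in> fst ` topspace ?E" by (force simp: image_iff)
    qed
  qed
  show ?thesis
    unfolding fibre_bundle_def
  proof (intro conjI ballI)
    show "continuous_map ?E W fst" by (rule continuous_map_subtopology_fst)
    then have "fst ` topspace ?E \<subseteq> topspace W" by (rule continuous_map_image_subset_topspace)
    moreover have "topspace W \<subseteq> fst ` topspace ?E" unfolding chart_base_cover by (intro Un_least onto)
    ultimately show "fst ` topspace ?E = topspace W" by blast
    fix x assume "x \<in> topspace W"
    then obtain i where "x \<in> chart_base i" using chart_base_cover by auto
    then show "\<exists>U h. openin W U \<and> x \<in> U \<and>
        homeomorphic_map (subtopology ?E {y \<in> topspace ?E. fst y \<in> U})
          (prod_topology (subtopology W U) (proj_space :: (complex ^ 2) set topology)) h \<and>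
        (\<forall>y \<in> topspace ?E. fst y \<in> U \<longrightarrow> fst (h y) = fst y)"
      using openin_chart_base triv[of i] by (intro exI[of _ "chart_base i"]) auto
  qed
qed

end

section \<open>Euler characteristics\<close>

lemma abelian_rank_negative: "p < 0 \<Longrightarrow> abelian_rank (homology_group p X) = 0"
  by (intro abelian_rank_trivial_group) auto

text \<open>A shift of degree by 2 preserves the sign (-1)^n, so the two copies of the Betti numbers
  contribute the same alternating sum. Finiteness for \<open>Y\<close> and for \<open>X\<close> is
  equivalent, so the default value 0 occurs for both or for neither.\<close>

lemma euler_characteristic_double:
  assumes "\<And>p. abelian_rank (homology_group p Y) = abelian_rank (homology_group p X) + abelian_rank (homology_group (p - 2) X)"
  shows "euler_characteristic Y = 2 * euler_characteristic X"
proof -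
  have 0: "betti Y n = betti X n" if "n < 2" for n
    using assms[of "int n"] that by (simp add: betti_def abelian_rank_negative)
  have 2: "betti Y (n + 2) = betti X (n + 2) + betti X n" for n
    using assms[of "int (n + 2)"] by (simp add: betti_def)
  have inf: "(\<forall>n. betti Y n \<noteq> \<infinity>) \<longleftrightarrow> (\<forall>n. betti X n \<noteq> \<infinity>)"
  proof
    assume *: "\<forall>n. betti Y n \<noteq> \<infinity>"
    show "\<forall>n. betti X n \<noteq> \<infinity>"
    proof
      fix n
      have "betti X (n + 2) + betti X n \<noteq> \<infinity>" using * unfolding 2[symmetric] by blast
      then show "betti X n \<noteq> \<infinity>" by (cases "betti X n") auto
    qed
  next
    assume *: "\<forall>n. betti X n \<noteq> \<infinity>"
    show "\<forall>n. betti Y n \<noteq> \<infinity>"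
    proof
      fix n
      show "betti Y n \<noteq> \<infinity>"
      proof (cases "n < 2")
        case False
        then obtain m where n: "n = m + 2" by (metis add.commute le_Suc_ex not_less)
        show ?thesis unfolding n 2 plus_eq_infty_iff_enat using * by blast
      qed (use * 0 in auto)
    qed
  qed
  define S where "S = {n. betti X n \<noteq> 0}"
  have SY: "{n. betti Y n \<noteq> 0} = S \<union> (\<lambda>n. n + 2) ` S"
  proof (rule Set.set_eqI)
    fix n
    show "n \<in> {n. betti Y n \<noteq> 0} \<longleftrightarrow> n \<in> S \<union> (\<lambda>n. n + 2) ` S"
    proof (cases "n < 2")
      case False
      then obtain m where n: "n = m + 2" by (metis add.commute le_Suc_ex not_less)
      have "betti Y n \<noteq> 0 \<longleftrightarrow> n \<in> S \<or> m \<in> S" unfolding n 2 S_def by simp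
      moreover have "n \<in> (\<lambda>n. n + 2) ` S \<longleftrightarrow> m \<in> S" by (auto simp: n)
      ultimately show ?thesis by simp
    qed (auto simp: S_def 0)
  qed
  have fin: "finite {n. betti Y n \<noteq> 0} \<longleftrightarrow> finite S" unfolding SY by auto
  show ?thesis
  proof (cases "(\<forall>n. betti X n \<noteq> \<infinity>) \<and> finite S")
    case False
    then have nX: "\<not> ((\<forall>n. betti X n \<noteq> \<infinity>) \<and> finite {n. betti X n \<noteq> 0})" by (simp only: S_def simp_thms)
    have nY: "\<not> ((\<forall>n. betti Y n \<noteq> \<infinity>) \<and> finite {n. betti Y n \<noteq> 0})" using False inf fin by blast
    show ?thesis unfolding euler_characteristic_def if_not_P[OF nX] if_not_P[OF nY] by simp
  next
    case True
    define b where "b = (\<lambda>n. int (the_enat (betti X n)))"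
    \<comment> \<open>The support of the Betti numbers of \<open>Y\<close>. Each of the two sums
      over it is cut down to the support of its own copy.\<close>
    define T where "T = S \<union> (\<lambda>n. n + 2) ` S"
    have T: "finite T" using True by (simp add: T_def)
    have X: "euler_characteristic X = (\<Sum>n\<in>S. (- 1) ^ n * b n)"
      using True by (simp add: euler_characteristic_def S_def b_def)
    have b0: "b n = 0" if "n \<notin> S" for n using that by (simp add: b_def S_def zero_enat_def)
    have Y': "int (the_enat (betti Y n)) = b n + (if n < 2 then 0 else b (n - 2))" for n
    proof (cases "n < 2")
      case False
      then obtain m where m: "n = m + 2" by (metis add.commute le_Suc_ex not_less)
      obtain r s where rs: "betti X n = enat r" "betti X m = enat s" using True by (meson not_enat_eq)
      have "betti Y n = betti X n + betti X m" unfolding m by (rule 2)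
      then show ?thesis using rs m by (simp add: b_def)
    qed (simp add: b_def 0)
    have "euler_characteristic Y = (\<Sum>n\<in>T. (- 1) ^ n * int (the_enat (betti Y n)))"
      using True inf T by (simp add: euler_characteristic_def SY T_def)
    also have "\<dots> = (\<Sum>n\<in>T. (- 1) ^ n * b n) + (\<Sum>n\<in>T. (- 1) ^ n * (if n < 2 then 0 else b (n - 2)))"
      by (simp add: Y' algebra_simps sum.distrib)
    also have "(\<Sum>n\<in>T. (- 1) ^ n * b n) = (\<Sum>n\<in>S. (- 1) ^ n * b n)"
      using T b0 by (intro sum.mono_neutral_right) (auto simp: T_def)
    also have "(\<Sum>n\<in>T. (- 1) ^ n * (if n < 2 then 0 else b (n - 2))) =
        (\<Sum>n\<in>(\<lambda>n. n + 2) ` S. (- 1) ^ n * (if n < 2 then 0 else b (n - 2)))"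
    proof (intro sum.mono_neutral_right ballI T)
      fix n assume n: "n \<in> T - (\<lambda>n. n + 2) ` S"
      have "n - 2 \<notin> S" if "\<not> n < 2"
      proof
        assume "n - 2 \<in> S"
        then have "(n - 2) + 2 \<in> (\<lambda>n. n + 2) ` S" by blast
        moreover have "(n - 2) + 2 = n" using that by simp
        ultimately show False using n by (metis DiffD2)
      qed
      then show "(- 1) ^ n * (if n < 2 then 0 else b (n - 2)) = 0" using b0 by auto
    qed (auto simp: T_def)
    also have "\<dots> = (\<Sum>n\<in>S. (- 1) ^ n * b n)"
      by (subst sum.reindex) (auto simp: o_def inj_on_def)
    finally show ?thesis by (simp add: X)
  qed
qed

text \<open>CP^1 is the product with a one-point base.\<close>

lemma euler_characteristic_proj_line: "euler_characteristic (proj_space :: (complex ^ 2) set topology) = 2"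
proof -
  define pt where "pt = discrete_topology {()}"
  have 1: "abelian_rank (homology_group p (proj_space :: (complex ^ 2) set topology)) =
      abelian_rank (homology_group p (prod_topology pt (proj_space :: (complex ^ 2) set topology)))" for p
  proof (intro abelian_rank_iso homeomorphic_space_imp_isomorphic_homology_groups)
    have "subtopology pt {()} = pt" by (simp add: pt_def)
    then show "(proj_space :: (complex ^ 2) set topology) homeomorphic_space
        prod_topology pt (proj_space :: (complex ^ 2) set topology)"
      using homeomorphic_space_prod_topology_sing2[of "()" pt "proj_space :: (complex ^ 2) set topology"] by (simp add: pt_def)
  qed auto
  have "euler_characteristic (proj_space :: (complex ^ 2) set topology) = 2 * euler_characteristic pt"
    by (rule euler_characteristic_double) (simp add: 1 abelian_rank_homology_prod_proj_line)
  also have "euler_characteristic pt = 1"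
  proof -
    have b: "betti pt n = (if n = 0 then 1 else 0)" for n
    proof (cases "n = 0")
      case True
      have "abelian_rank (homology_group 0 pt) = abelian_rank integer_group"
        by (intro abelian_rank_iso homology_coefficients[of _ "()"] abelian_integer_group) (auto simp: pt_def)
      then show ?thesis using True by (simp add: betti_def abelian_rank_integer_group)
    next
      case False
      then show ?thesis
        using homology_dimension_axiom[of pt "()" "int n"] by (simp add: betti_def pt_def abelian_rank_trivial_group)
    qed
    have S: "{n. betti pt n \<noteq> 0} = {0}" and F: "\<forall>n. betti pt n \<noteq> \<infinity>"
      unfolding b by (auto simp: one_enat_def zero_enat_def)
    show ?thesis unfolding euler_characteristic_def S using F by (simp add: b one_enat_def)
  qed
  finally show ?thesis by simp
qed

section \<open>Collapsing a bigon\<close>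

text \<open>The complex conjugate of the bilinear cross product; the conjugation makes it orthogonal
  to \<open>x\<close> and \<open>y\<close> for the Hermitian inner product.\<close>

definition herm_cross :: "complex ^ 3 \<Rightarrow> complex ^ 3 \<Rightarrow> complex ^ 3" where
  "herm_cross x y = (\<chi> i. cnj (if i = 1 then x $ 2 * y $ 3 - x $ 3 * y $ 2
     else if i = 2 then x $ 3 * y $ 1 - x $ 1 * y $ 3 else x $ 1 * y $ 2 - x $ 2 * y $ 1))"

lemma herm_cross_nth:
  "herm_cross x y $ 1 = cnj (x $ 2 * y $ 3 - x $ 3 * y $ 2)"
  "herm_cross x y $ 2 = cnj (x $ 3 * y $ 1 - x $ 1 * y $ 3)"
  "herm_cross x y $ 3 = cnj (x $ 1 * y $ 2 - x $ 2 * y $ 1)"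
  by (simp_all add: herm_cross_def)

lemma hermitian_inner_sum3:
  "hermitian_inner x y = x $ 1 * cnj (y $ 1) + x $ 2 * cnj (y $ 2) + x $ 3 * cnj (y $ 3)" for x y :: "complex ^ 3"
  by (simp add: hermitian_inner_def sum_3)

lemma hermitian_inner_commute: "hermitian_inner y x = cnj (hermitian_inner x y)"
  by (simp add: hermitian_inner_def mult.commute)

lemma orthogonal_lines_sym: "orthogonal_lines L M \<longleftrightarrow> orthogonal_lines M L"
proof -
  have "hermitian_inner x y = 0 \<longleftrightarrow> hermitian_inner y x = 0" for x y :: "complex ^ 'a"
    using hermitian_inner_commute[of x y] hermitian_inner_commute[of y x] by auto
  then show ?thesis unfolding orthogonal_lines_def by blast
qed

lemma hermitian_inner_self_eq_0: "hermitian_inner x x = 0 \<longleftrightarrow> x = 0"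
proof
  assume "hermitian_inner x x = 0"
  then have "complex_of_real (\<Sum>i\<in>UNIV. (cmod (x $ i))\<^sup>2) = 0"
    by (simp only: hermitian_inner_def of_real_sum complex_norm_square)
  then have "(\<Sum>i\<in>UNIV. (cmod (x $ i))\<^sup>2) = 0" by (simp only: of_real_eq_0_iff)
  then show "x = 0" by (simp add: sum_nonneg_eq_0_iff vec_eq_iff)
qed (simp add: hermitian_inner_def)

lemma herm_cross_orthogonal: "hermitian_inner (herm_cross x y) x = 0" "hermitian_inner (herm_cross x y) y = 0"
  by (simp_all add: hermitian_inner_sum3 herm_cross_nth algebra_simps)

lemma herm_cross_neq_0:
  assumes "x \<noteq> 0" "y \<noteq> 0" "hermitian_inner x y = 0"
  shows "herm_cross x y \<noteq> 0"
proof
  assume "herm_cross x y = 0"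
  then have "cnj (herm_cross x y $ i) = 0" for i by simp
  then have w: "x $ 2 * y $ 3 - x $ 3 * y $ 2 = 0" "x $ 3 * y $ 1 - x $ 1 * y $ 3 = 0" "x $ 1 * y $ 2 - x $ 2 * y $ 1 = 0"
    unfolding herm_cross_nth[symmetric] by (metis complex_cnj_cnj herm_cross_nth)+
  have xy: "y $ 1 * cnj (x $ 1) + y $ 2 * cnj (x $ 2) + y $ 3 * cnj (x $ 3) = 0"
    using assms(3) hermitian_inner_commute[of y x] by (simp add: hermitian_inner_sum3)
  \<comment> \<open>The expansion of a double cross product: the squared norm of \<open>x\<close>
    times \<open>y\<close> is a combination of the inner product of \<open>y\<close> with
    \<open>x\<close> and the coordinates of the cross product, all of which vanish.\<close>
  have "hermitian_inner x x * y $ 1 =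
      x $ 1 * (y $ 1 * cnj (x $ 1) + y $ 2 * cnj (x $ 2) + y $ 3 * cnj (x $ 3))
      - cnj (x $ 2) * (x $ 1 * y $ 2 - x $ 2 * y $ 1) + cnj (x $ 3) * (x $ 3 * y $ 1 - x $ 1 * y $ 3)"
    "hermitian_inner x x * y $ 2 =
      x $ 2 * (y $ 1 * cnj (x $ 1) + y $ 2 * cnj (x $ 2) + y $ 3 * cnj (x $ 3))
      + cnj (x $ 1) * (x $ 1 * y $ 2 - x $ 2 * y $ 1) - cnj (x $ 3) * (x $ 2 * y $ 3 - x $ 3 * y $ 2)"
    "hermitian_inner x x * y $ 3 =
      x $ 3 * (y $ 1 * cnj (x $ 1) + y $ 2 * cnj (x $ 2) + y $ 3 * cnj (x $ 3))
      - cnj (x $ 1) * (x $ 3 * y $ 1 - x $ 1 * y $ 3) + cnj (x $ 2) * (x $ 2 * y $ 3 - x $ 3 * y $ 2)"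
    by (simp_all add: hermitian_inner_sum3 algebra_simps)
  then have "hermitian_inner x x * y $ 1 = 0 \<and> hermitian_inner x x * y $ 2 = 0 \<and> hermitian_inner x x * y $ 3 = 0"
    unfolding w xy by simp
  moreover have "hermitian_inner x x \<noteq> 0" using assms(1) by (simp add: hermitian_inner_self_eq_0)
  ultimately have "y = 0" by (simp add: vec_eq_iff forall_3)
  then show False using assms by simp
qed

lemma orthogonal_to_both:
  assumes "herm_cross x y \<noteq> 0" "hermitian_inner z x = 0" "hermitian_inner z y = 0"
  shows "z \<in> vec.span {herm_cross x y}"
proof -
  define w where "w = herm_cross x y"
  have zx: "z $ 1 * cnj (x $ 1) + z $ 2 * cnj (x $ 2) + z $ 3 * cnj (x $ 3) = 0"
    and zy: "z $ 1 * cnj (y $ 1) + z $ 2 * cnj (y $ 2) + z $ 3 * cnj (y $ 3) = 0"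
    using assms by (simp_all add: hermitian_inner_sum3)
  \<comment> \<open>The cross product of \<open>z\<close> with \<open>w\<close> is by the same
    expansion a combination of the two inner products, hence 0: \<open>z\<close> and
    \<open>w\<close> are parallel.\<close>
  have "z $ 1 * w $ 2 - z $ 2 * w $ 1 =
      cnj (x $ 3) * (z $ 1 * cnj (y $ 1) + z $ 2 * cnj (y $ 2) + z $ 3 * cnj (y $ 3))
      - cnj (y $ 3) * (z $ 1 * cnj (x $ 1) + z $ 2 * cnj (x $ 2) + z $ 3 * cnj (x $ 3))"
    "z $ 2 * w $ 3 - z $ 3 * w $ 2 =
      cnj (x $ 1) * (z $ 1 * cnj (y $ 1) + z $ 2 * cnj (y $ 2) + z $ 3 * cnj (y $ 3))
      - cnj (y $ 1) * (z $ 1 * cnj (x $ 1) + z $ 2 * cnj (x $ 2) + z $ 3 * cnj (x $ 3))"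
    "z $ 3 * w $ 1 - z $ 1 * w $ 3 =
      cnj (x $ 2) * (z $ 1 * cnj (y $ 1) + z $ 2 * cnj (y $ 2) + z $ 3 * cnj (y $ 3))
      - cnj (y $ 2) * (z $ 1 * cnj (x $ 1) + z $ 2 * cnj (x $ 2) + z $ 3 * cnj (x $ 3))"
    by (simp_all add: w_def herm_cross_nth algebra_simps)
  then have par: "z $ 1 * w $ 2 = z $ 2 * w $ 1" "z $ 2 * w $ 3 = z $ 3 * w $ 2" "z $ 3 * w $ 1 = z $ 1 * w $ 3"
    unfolding zx zy by simp_all
  have "w $ 1 \<noteq> 0 \<or> w $ 2 \<noteq> 0 \<or> w $ 3 \<noteq> 0" using assms(1) by (simp add: w_def vec_eq_iff forall_3)
  then have "\<exists>k. z = k *s w"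
  proof (elim disjE)
    assume "w $ 1 \<noteq> 0"
    then show ?thesis using par by (intro exI[of _ "z $ 1 / w $ 1"]) (simp add: vec_eq_iff forall_3 field_simps)
  next
    assume "w $ 2 \<noteq> 0"
    then show ?thesis using par by (intro exI[of _ "z $ 2 / w $ 2"]) (simp add: vec_eq_iff forall_3 field_simps)
  next
    assume "w $ 3 \<noteq> 0"
    then show ?thesis using par by (intro exI[of _ "z $ 3 / w $ 3"]) (simp add: vec_eq_iff forall_3 field_simps)
  qed
  then show ?thesis by (auto simp: w_def vec.span_singleton)
qed

text \<open>The Hermitian complement of \<open>L\<close> and \<open>M\<close> together. It refers to
  no spanning vectors, and it is a line once \<open>L\<close> and \<open>M\<close> are distinct
  lines.\<close>

definition orth_line :: "(complex ^ 3) set \<Rightarrow> (complex ^ 3) set \<Rightarrow> (complex ^ 3) set" where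
  "orth_line L M = {z. (\<forall>x \<in> L. hermitian_inner z x = 0) \<and> (\<forall>y \<in> M. hermitian_inner z y = 0)}"

lemma orth_line_span:
  assumes "herm_cross x y \<noteq> 0"
  shows "orth_line (vec.span {x}) (vec.span {y}) = vec.span {herm_cross x y}"
proof (intro antisym subsetI)
  fix z assume "z \<in> orth_line (vec.span {x}) (vec.span {y})"
  then have "hermitian_inner z x = 0" "hermitian_inner z y = 0" by (auto simp: orth_line_def vec.span_base)
  then show "z \<in> vec.span {herm_cross x y}" by (rule orthogonal_to_both[OF assms])
next
  fix z assume z: "z \<in> vec.span {herm_cross x y}"
  have "orthogonal_lines (vec.span {herm_cross x y}) (vec.span {x})" "orthogonal_lines (vec.span {herm_cross x y}) (vec.span {y})"
    by (simp_all add: orthogonal_lines_span herm_cross_orthogonal)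
  then show "z \<in> orth_line (vec.span {x}) (vec.span {y})"
    using z by (auto simp: orth_line_def orthogonal_lines_def)
qed

lemma orth_line:
  assumes "L \<in> topspace proj_space" "M \<in> topspace proj_space" "orthogonal_lines L M"
  shows orth_line_in_proj_space: "orth_line L M \<in> topspace proj_space"
    and orth_line_orthogonal: "orthogonal_lines (orth_line L M) L" "orthogonal_lines (orth_line L M) M"
    and orth_line_unique: "\<lbrakk>K \<in> topspace proj_space; orthogonal_lines K L; orthogonal_lines K M\<rbrakk> \<Longrightarrow> K = orth_line L M"
proof -
  obtain x y where xy: "x \<noteq> 0" "L = vec.span {x}" "y \<noteq> 0" "M = vec.span {y}"
    using assms complex_linesE by metis
  have nz: "herm_cross x y \<noteq> 0" using assms(3) xy by (simp add: orthogonal_lines_span herm_cross_neq_0)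
  then show "orth_line L M \<in> topspace proj_space" using xy by (simp add: orth_line_span)
  show "orthogonal_lines (orth_line L M) L" "orthogonal_lines (orth_line L M) M"
    by (auto simp: orthogonal_lines_def orth_line_def)
  assume "K \<in> topspace proj_space" and K: "orthogonal_lines K L" "orthogonal_lines K M"
  then obtain z where z: "z \<noteq> 0" "K = vec.span {z}" using complex_linesE by metis
  then have "z \<in> vec.span {herm_cross x y}"
    using K xy nz by (intro orthogonal_to_both) (simp_all add: orthogonal_lines_span)
  then obtain k where k: "z = k *s herm_cross x y" unfolding vec.span_singleton by blast
  then have "k \<noteq> 0" using z by auto
  then show "K = orth_line L M"
    using k z xy nz span_singleton_eq_iff[OF nz, of z] by (simp add: orth_line_span)
qed

text \<open>Orthogonality is not an open condition, whereas quotient maps restrict well to open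
  sets. So continuity is proved on the larger open set \<open>Z\<close> of pairs of distinct lines,
  where the cross product is nonzero, and then restricted.\<close>

lemma continuous_map_orth_line:
  "continuous_map (subtopology (prod_topology proj_space proj_space) {(L, M). orthogonal_lines L M}) proj_space (\<lambda>(L, M). orth_line L M)"
proof -
  let ?N = "nonzero_vecs :: (complex ^ 3) topology"
  let ?q = "\<lambda>(x :: complex ^ 3, y :: complex ^ 3). (vec.span {x}, vec.span {y})"
  define Om where "Om = {z \<in> topspace (prod_topology ?N ?N). (\<lambda>(x, y). herm_cross x y) z \<noteq> 0}"
  define Z where "Z = ?q ` Om"
  have cont: "continuous_on UNIV (\<lambda>(x, y). herm_cross x y)"
    unfolding case_prod_unfold herm_cross_def
  proof (rule continuous_on_vec_lambda)
    fix i :: 3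
    show "continuous_on UNIV (\<lambda>x :: (complex ^ 3) \<times> (complex ^ 3). cnj (if i = 1 then fst x $ 2 * snd x $ 3 - fst x $ 3 * snd x $ 2
        else if i = 2 then fst x $ 3 * snd x $ 1 - fst x $ 1 * snd x $ 3 else fst x $ 1 * snd x $ 2 - fst x $ 2 * snd x $ 1))"
      by (cases "i = 1"; cases "i = 2") (auto intro!: continuous_intros)
  qed
  have N2: "prod_topology ?N ?N = top_of_set ((- {0}) \<times> (- {0}))" by simp
  have openC: "openin (prod_topology ?N ?N) Om"
  proof -
    have "open {z :: (complex ^ 3) \<times> (complex ^ 3). (case z of (x, y) \<Rightarrow> herm_cross x y) \<noteq> 0}"
      by (intro open_Collect_neq cont continuous_intros)
    moreover have "Om = ((- {0}) \<times> (- {0})) \<inter> {z. (case z of (x, y) \<Rightarrow> herm_cross x y) \<noteq> 0}"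
      unfolding Om_def N2 by auto
    ultimately show ?thesis unfolding N2 by (metis openin_open_Int)
  qed
  have om: "open_map (prod_topology ?N ?N) (prod_topology proj_space proj_space) ?q"
    by (rule open_map_prod[OF open_map_proj_space open_map_proj_space])
  have quot: "quotient_map (prod_topology ?N ?N) (prod_topology proj_space proj_space) ?q"
  proof (rule continuous_open_imp_quotient_map[OF _ om])
    show "continuous_map (prod_topology ?N ?N) (prod_topology proj_space proj_space) ?q"
      unfolding continuous_map_prod_top
      using quotient_imp_continuous_map[OF quotient_map_proj_space[where 'n = 3]] by blast
    show "?q ` topspace (prod_topology ?N ?N) = topspace (prod_topology proj_space proj_space)"
      by (force simp: topspace_proj_space complex_lines_def)
  qed
  have openZ: "openin (prod_topology proj_space proj_space) Z"
    using om openC unfolding open_map_def Z_def by blast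
  \<comment> \<open>Rescaling the vectors multiplies the cross product by a nonzero factor, so
    \<open>Om\<close> is a union of full fibres of the quotient map.\<close>
  have sat: "herm_cross x' y' \<noteq> 0" if A: "x \<noteq> 0" "y \<noteq> 0" "herm_cross x y \<noteq> 0"
    "vec.span {x} = vec.span {x'}" "vec.span {y} = vec.span {y'}" for x y x' y'
  proof -
    obtain k where k: "k \<noteq> 0" "x' = k *s x" using span_singleton_eq_iff[OF A(1), of x'] A(4) by blast
    obtain l where l: "l \<noteq> 0" "y' = l *s y" using span_singleton_eq_iff[OF A(2), of y'] A(5) by blast
    note kl = k l
    have "herm_cross x' y' = cnj (k * l) *s herm_cross x y"
      by (simp add: kl vec_eq_iff forall_3 herm_cross_nth algebra_simps)
    then show ?thesis using kl A by simp
  qed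
  have preZ: "{z \<in> topspace (prod_topology ?N ?N). ?q z \<in> Z} = Om"
  proof (intro antisym subsetI)
    fix z assume "z \<in> {z \<in> topspace (prod_topology ?N ?N). ?q z \<in> Z}"
    then obtain x' y' x y where "z = (x', y')" "x' \<noteq> 0" "y' \<noteq> 0" "(x, y) \<in> Om"
      "vec.span {x'} = vec.span {x}" "vec.span {y'} = vec.span {y}"
      unfolding Z_def by auto
    moreover from this have "x \<noteq> 0" "y \<noteq> 0" "herm_cross x y \<noteq> 0" by (auto simp: Om_def)
    ultimately show "z \<in> Om" using sat[of x y x' y'] by (simp add: Om_def)
  qed (auto simp: Z_def Om_def)
  have q: "quotient_map (subtopology (prod_topology ?N ?N) Om) (subtopology (prod_topology proj_space proj_space) Z) ?q"
    by (rule quotient_map_restriction[OF quot preZ]) (simp add: openZ)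
  have "continuous_map (subtopology (prod_topology ?N ?N) Om) ?N (\<lambda>(x, y). herm_cross x y)"
    unfolding continuous_map_in_subtopology
  proof
    have "continuous_map euclidean euclidean (\<lambda>(x, y). herm_cross x y)" using cont by simp
    then show "continuous_map (subtopology (prod_topology ?N ?N) Om) euclidean (\<lambda>(x, y). herm_cross x y)"
      unfolding N2 by (intro continuous_map_from_subtopology)
  qed (auto simp: Om_def)
  then have "continuous_map (subtopology (prod_topology ?N ?N) Om) proj_space ((\<lambda>x. vec.span {x}) \<circ> (\<lambda>(x, y). herm_cross x y))"
    by (rule continuous_map_compose) (rule quotient_imp_continuous_map[OF quotient_map_proj_space])
  then have "continuous_map (subtopology (prod_topology ?N ?N) Om) proj_space ((\<lambda>(L, M). orth_line L M) \<circ> ?q)"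
    by (rule continuous_map_eq) (auto simp: Om_def orth_line_span)
  then have "continuous_map (subtopology (prod_topology proj_space proj_space) Z) proj_space (\<lambda>(L, M). orth_line L M)"
    using continuous_compose_quotient_map_eq[OF q] by blast
  moreover have "subtopology (prod_topology proj_space proj_space) {(L, M). orthogonal_lines L M} =
      subtopology (subtopology (prod_topology proj_space proj_space) Z) {(L, M). orthogonal_lines L M}"
  proof -
    have "(L, M) \<in> Z" if LM: "L \<in> topspace proj_space" "M \<in> topspace proj_space" "orthogonal_lines L M" for L M
    proof -
      obtain x y where xy: "x \<noteq> 0" "L = vec.span {x}" "y \<noteq> 0" "M = vec.span {y}"
        using LM complex_linesE by metis
      then have "(x, y) \<in> Om" using LM by (simp add: Om_def orthogonal_lines_span herm_cross_neq_0)
      then show ?thesis unfolding Z_def xy by force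
    qed
    then have "topspace (prod_topology proj_space proj_space) \<inter> {(L, M). orthogonal_lines L M} =
      topspace (prod_topology proj_space proj_space) \<inter> (Z \<inter> {(L, M). orthogonal_lines L M})"
      by auto
    then have "subtopology (prod_topology proj_space proj_space) (topspace (prod_topology proj_space proj_space) \<inter> {(L, M). orthogonal_lines L M}) =
      subtopology (prod_topology proj_space proj_space) (topspace (prod_topology proj_space proj_space) \<inter> (Z \<inter> {(L, M). orthogonal_lines L M}))"
      by (rule arg_cong)
    then show ?thesis by (simp only: subtopology_subtopology subtopology_restrict)
  qed
  ultimately show ?thesis by (simp add: continuous_map_from_subtopology)
qed

lemma fibre_bundle_homeomorphic:
  assumes fb: "fibre_bundle F E B p" and hom: "homeomorphic_maps E' E f g"
  shows "fibre_bundle F E' B (p \<circ> f)"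
  unfolding fibre_bundle_def
proof (intro conjI ballI)
  have f: "homeomorphic_map E' E f" using hom by (simp add: homeomorphic_maps_map)
  have cf: "continuous_map E' E f" using hom by (simp add: homeomorphic_maps_def)
  show "continuous_map E' B (p \<circ> f)"
    using fb cf by (intro continuous_map_compose) (auto simp: fibre_bundle_def)
  have im: "f ` topspace E' = topspace E" using f by (rule homeomorphic_imp_surjective_map)
  show "(p \<circ> f) ` topspace E' = topspace B" using fb im by (simp add: fibre_bundle_def flip: image_image)
  fix x assume "x \<in> topspace B"
  then obtain U h where U: "openin B U" "x \<in> U" and h: "homeomorphic_map (subtopology E {y \<in> topspace E. p y \<in> U}) (prod_topology (subtopology B U) F) h"
    and ph: "\<forall>y \<in> topspace E. p y \<in> U \<longrightarrow> fst (h y) = p y"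
    using fb unfolding fibre_bundle_def by blast
  let ?S = "{y \<in> topspace E'. (p \<circ> f) y \<in> U}" and ?T = "{y \<in> topspace E. p y \<in> U}"
  have "f ` (topspace E' \<inter> ?S) = topspace E \<inter> ?T" using im by auto
  then have "homeomorphic_map (subtopology E' ?S) (subtopology E ?T) f"
    by (rule homeomorphic_map_subtopologies[OF f])
  then have "homeomorphic_map (subtopology E' ?S) (prod_topology (subtopology B U) F) (h \<circ> f)"
    using h by (rule homeomorphic_map_compose)
  moreover have "\<forall>y \<in> topspace E'. (p \<circ> f) y \<in> U \<longrightarrow> fst ((h \<circ> f) y) = (p \<circ> f) y" using ph im by auto
  ultimately show "\<exists>U h. openin B U \<and> x \<in> U \<and>
      homeomorphic_map (subtopology E' {y \<in> topspace E'. (p \<circ> f) y \<in> U}) (prod_topology (subtopology B U) F) h \<and>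
      (\<forall>y \<in> topspace E'. (p \<circ> f) y \<in> U \<longrightarrow> fst (h y) = (p \<circ> f) y)"
    using U by blast
qed

section \<open>Decorations before and after the collapse\<close>

locale bigon_collapse =
  fixes G :: "('v, 'e) mgraph" and pt \<gamma> and u v :: 'v and a b c d :: 'e
  assumes trivalent: "trivalent G" and bigon: "bigon G pt \<gamma> u v c d a b"
begin

definition "G' = collapse_bigon G u v c d a b"

lemma bigon_facts:
  "u \<in> verts G" "v \<in> verts G" "u \<noteq> v" "c \<in> edges G" "d \<in> edges G" "c \<noteq> d"
  "ends G c = {#u, v#}" "ends G d = {#u, v#}" "a \<in> edges G" "b \<in> edges G"
  "a \<noteq> c" "a \<noteq> d" "b \<noteq> c" "b \<noteq> d" "u \<in># ends G a" "v \<in># ends G b"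
  using bigon by (auto simp: bigon_def)

lemma verts_G': "verts G' = verts G - {u, v}"
  by (simp add: G'_def collapse_bigon_def)

lemma edges_G': "edges G' = insert a (edges G - {b, c, d})"
  by (simp add: G'_def collapse_bigon_def)

text \<open>Three ends are exhibited, and trivalence leaves room for no other; in particular none of
  the three edges has a second end at \<open>x\<close>.\<close>

lemma edge_ends_bigon_vertex:
  assumes "x \<in> verts G" "e \<in> edges G" "c \<noteq> e" "d \<noteq> e" "x \<in># ends G c" "x \<in># ends G d" "x \<in># ends G e"
  shows "edge_ends G x = {(c, 0), (d, 0), (e, 0)}"
proof -
  have card: "card (edge_ends G x) = 3" using trivalent assms(1) by (simp add: trivalent_def)
  have "{(c, 0), (d, 0), (e, 0)} \<subseteq> edge_ends G x"
    using assms bigon_facts by (auto simp: edge_ends_def)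
  moreover have "card {(c, 0::nat), (d, 0), (e, 0)} = 3" using assms bigon_facts by auto
  moreover have "finite (edge_ends G x)" using card by (intro card_ge_0_finite) simp
  ultimately show ?thesis using card by (metis card_subset_eq)
qed

lemma edge_ends_u: "edge_ends G u = {(c, 0), (d, 0), (a, 0)}"
  and edge_ends_v: "edge_ends G v = {(c, 0), (d, 0), (b, 0)}"
  by (rule edge_ends_bigon_vertex; use bigon_facts in auto)+

text \<open>The joined edge inherits the ends of both \<open>a\<close> and \<open>b\<close> at
  \<open>x\<close>. Those of \<open>b\<close> are renumbered to follow those of \<open>a\<close>,
  which keeps them apart if the joined edge becomes a loop; if \<open>a = b\<close> there is nothing
  to renumber.\<close>

definition shift_end :: "'v \<Rightarrow> 'e \<times> nat \<Rightarrow> 'e \<times> nat" where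
  "shift_end x = (\<lambda>(e, i). if e = b \<and> a \<noteq> b then (a, i + count (ends G a) x) else (e, i))"

lemma edge_ends_G':
  assumes x: "x \<in> verts G - {u, v}"
  shows "edge_ends G' x = shift_end x ` edge_ends G x" and "inj_on (shift_end x) (edge_ends G x)"
    and "(e, i) \<in> edge_ends G x \<Longrightarrow> e \<in> edges G - {c, d}"
proof -
  have cd: "count (ends G c) x = 0" "count (ends G d) x = 0" using x bigon_facts by auto
  then show "(e, i) \<in> edge_ends G x \<Longrightarrow> e \<in> edges G - {c, d}" for e i by (auto simp: edge_ends_def)
  show "inj_on (shift_end x) (edge_ends G x)"
    by (auto simp: inj_on_def shift_end_def edge_ends_def split: if_splits)
  have ends: "count (ends G' e) x = (if e = a then if a = b then count (ends G a) x else count (ends G a) x + count (ends G b) x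
      else count (ends G e) x)" for e
  proof -
    have "u \<noteq> x" "v \<noteq> x" using x by auto
    then show ?thesis by (simp add: G'_def collapse_bigon_def)
  qed
  show "edge_ends G' x = shift_end x ` edge_ends G x"
  proof (intro Set.set_eqI iffI)
    fix h assume "h \<in> edge_ends G' x"
    then obtain e i where h: "h = (e, i)" "e \<in> edges G'" "i < count (ends G' e) x" by (auto simp: edge_ends_def)
    show "h \<in> shift_end x ` edge_ends G x"
    proof (cases "e = a \<and> a \<noteq> b \<and> \<not> i < count (ends G a) x")
      \<comment> \<open>Indices at or above the number of ends of \<open>a\<close> belong to ends
        that came from \<open>b\<close>.\<close>
      case True
      then have "(b, i - count (ends G a) x) \<in> edge_ends G x" "h = shift_end x (b, i - count (ends G a) x)"
        using h ends bigon_facts by (auto simp: edge_ends_def shift_end_def)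
      then show ?thesis by blast
    next
      case False
      then have "(e, i) \<in> edge_ends G x" "h = shift_end x (e, i)"
        using h ends bigon_facts by (auto simp: edge_ends_def shift_end_def edges_G' split: if_splits)
      then show ?thesis by blast
    qed
  next
    fix h assume "h \<in> shift_end x ` edge_ends G x"
    then obtain e i where h: "h = shift_end x (e, i)" "e \<in> edges G" "i < count (ends G e) x" by (auto simp: edge_ends_def)
    have "e \<noteq> c" "e \<noteq> d" using h cd by auto
    then show "h \<in> edge_ends G' x"
      using h ends by (auto simp: edge_ends_def shift_end_def edges_G')
  qed
qed

text \<open>Renumbering does not change the line at an end, because \<open>D b = D a\<close>.
  Injectivity of \<open>shift_end\<close> matters since the condition is about pairs of distinct
  ends, including two ends of the joined edge when it is a loop.\<close>

lemma admissible_at_collapsed: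
  assumes x: "x \<in> verts G - {u, v}" and D: "D b = D a" "\<And>e. e \<in> edges G' \<Longrightarrow> D' e = D e"
  shows "pairwise (\<lambda>h k. orthogonal_lines (D' (fst h)) (D' (fst k))) (edge_ends G' x) \<longleftrightarrow>
    pairwise (\<lambda>h k. orthogonal_lines (D (fst h)) (D (fst k))) (edge_ends G x)"
proof -
  have fst: "D' (fst (shift_end x h)) = D (fst h)" if "h \<in> edge_ends G x" for h
    using edge_ends_G'(3)[OF x, of "fst h" "snd h"] that D
    by (auto simp: shift_end_def case_prod_unfold edges_G')
  show ?thesis
    unfolding edge_ends_G'(1)[OF x] pairwise_image
    unfolding pairwise_def using fst inj_onD[OF edge_ends_G'(2)[OF x]] by metis
qed

abbreviation "collapsed_space \<equiv> moduli_space G'"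

lemma topspace_moduli:
  "D \<in> topspace (moduli_space H) \<longleftrightarrow> D \<in> (\<Pi>\<^sub>E e\<in>edges H. topspace proj_space) \<and> admissible H D"
  by (auto simp: moduli_space_def)

lemma continuous_map_moduli_edge:
  "e \<in> edges H \<Longrightarrow> continuous_map (moduli_space H) proj_space (\<lambda>D. D e)"
  unfolding moduli_space_def by (intro continuous_map_from_subtopology continuous_map_product_projection)

sublocale line_family "moduli_space G'" "\<lambda>D. D a"
  by unfold_locales (rule continuous_map_moduli_edge, simp add: edges_G')

lemma admissible_at_u:
  "pairwise (\<lambda>h k. orthogonal_lines (D (fst h)) (D (fst k))) (edge_ends G u) \<longleftrightarrow>
    orthogonal_lines (D c) (D d) \<and> orthogonal_lines (D c) (D a) \<and> orthogonal_lines (D d) (D a)"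
  unfolding edge_ends_u using bigon_facts orthogonal_lines_sym by (auto simp: pairwise_insert)

lemma admissible_at_v:
  "pairwise (\<lambda>h k. orthogonal_lines (D (fst h)) (D (fst k))) (edge_ends G v) \<longleftrightarrow>
    orthogonal_lines (D c) (D d) \<and> orthogonal_lines (D c) (D b) \<and> orthogonal_lines (D d) (D b)"
  unfolding edge_ends_v using bigon_facts orthogonal_lines_sym by (auto simp: pairwise_insert)

lemma admissible_iff:
  "admissible G D \<longleftrightarrow>
    (orthogonal_lines (D c) (D d) \<and> orthogonal_lines (D c) (D a) \<and> orthogonal_lines (D d) (D a)) \<and>
    (orthogonal_lines (D c) (D b) \<and> orthogonal_lines (D d) (D b)) \<and>
    (\<forall>x \<in> verts G - {u, v}. pairwise (\<lambda>h k. orthogonal_lines (D (fst h)) (D (fst k))) (edge_ends G x))"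
proof -
  have "verts G = insert u (insert v (verts G - {u, v}))" using bigon_facts by auto
  then have "admissible G D \<longleftrightarrow> (\<forall>x \<in> insert u (insert v (verts G - {u, v})).
      pairwise (\<lambda>h k. orthogonal_lines (D (fst h)) (D (fst k))) (edge_ends G x))"
    unfolding admissible_def by simp
  then show ?thesis using admissible_at_u[of D] admissible_at_v[of D] by auto
qed

definition collapse_dec :: "('e \<Rightarrow> (complex ^ 3) set) \<Rightarrow> ('e \<Rightarrow> (complex ^ 3) set) \<times> (complex ^ 3) set" where
  "collapse_dec D = (restrict D (edges G'), D c)"

text \<open>The line at \<open>c\<close> is free among those orthogonal to the line at
  \<open>a\<close>, and the line at \<open>d\<close> is then forced. When \<open>a = b\<close>, the
  first case returns the line at \<open>a\<close>, as it should.\<close>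

definition expand_dec :: "('e \<Rightarrow> (complex ^ 3) set) \<times> (complex ^ 3) set \<Rightarrow> 'e \<Rightarrow> (complex ^ 3) set" where
  "expand_dec z = restrict (\<lambda>e. if e = b then fst z a else if e = c then snd z
     else if e = d then orth_line (snd z) (fst z a) else fst z e) (edges G)"

lemma expand_dec_apply:
  "expand_dec z a = fst z a" "expand_dec z b = fst z a" "expand_dec z c = snd z" "expand_dec z d = orth_line (snd z) (fst z a)"
  "e \<in> edges G' \<Longrightarrow> expand_dec z e = fst z e"
  using bigon_facts by (auto simp: expand_dec_def edges_G')

lemma a_in_G': "a \<in> edges G'"
  by (simp add: edges_G')

lemma edges_G: "edges G = insert b (insert c (insert d (edges G')))"
  using bigon_facts by (auto simp: edges_G')

abbreviation "bundle_space \<equiv> subtopology total_space orth_bundle"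

text \<open>The lines at \<open>a\<close> and at \<open>b\<close> are both orthogonal to the two
  orthogonal lines at \<open>c\<close> and \<open>d\<close>, and in C^3 there is only one such
  line.\<close>

lemma moduli_edges_eq:
  assumes "D \<in> topspace (moduli_space G)"
  shows "D b = D a" "D d = orth_line (D c) (D a)"
proof -
  have top: "D e \<in> topspace proj_space" if "e \<in> edges G" for e using assms that by (auto simp: topspace_moduli)
  have adm: "orthogonal_lines (D c) (D d)" "orthogonal_lines (D c) (D a)" "orthogonal_lines (D d) (D a)"
    "orthogonal_lines (D c) (D b)" "orthogonal_lines (D d) (D b)"
    using assms by (auto simp: topspace_moduli admissible_iff)
  note sym = adm[THEN orthogonal_lines_sym[THEN iffD1]]
  have "D a = orth_line (D c) (D d)" by (rule orth_line_unique) (use adm sym bigon_facts top in auto)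
  moreover have "D b = orth_line (D c) (D d)" by (rule orth_line_unique) (use adm sym bigon_facts top in auto)
  ultimately show "D b = D a" by simp
  show "D d = orth_line (D c) (D a)" by (rule orth_line_unique) (use adm sym bigon_facts top in auto)
qed

lemma collapse_dec_in:
  assumes D: "D \<in> topspace (moduli_space G)"
  shows "collapse_dec D \<in> topspace bundle_space"
proof -
  have top: "D e \<in> topspace proj_space" if "e \<in> edges G" for e using D that by (auto simp: topspace_moduli)
  have adm: "admissible G D" using D by (simp add: topspace_moduli)
  have "admissible G' (restrict D (edges G'))"
    unfolding admissible_def verts_G'
  proof
    fix x assume x: "x \<in> verts G - {u, v}"
    show "pairwise (\<lambda>h k. orthogonal_lines (restrict D (edges G') (fst h)) (restrict D (edges G') (fst k))) (edge_ends G' x)"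
      using admissible_at_collapsed[OF x moduli_edges_eq(1)[OF D], of "restrict D (edges G')"] adm x
      by (simp add: admissible_iff)
  qed
  moreover have "orthogonal_lines (D c) (D a)" using adm by (simp add: admissible_iff)
  ultimately show ?thesis
    using top bigon_facts by (auto simp: collapse_dec_def topspace_moduli orth_bundle_def edges_G')
qed

lemma expand_dec_in:
  assumes z: "z \<in> topspace bundle_space"
  shows "expand_dec z \<in> topspace (moduli_space G)"
proof -
  obtain D L where DL: "z = (D, L)" "D \<in> topspace (moduli_space G')" "L \<in> topspace proj_space" "orthogonal_lines L (D a)"
    using z by (auto simp: orth_bundle_def)
  have top: "D e \<in> topspace proj_space" if "e \<in> edges G'" for e using DL that by (auto simp: topspace_moduli)
  note ol = orth_line_in_proj_space[OF DL(3) top[OF a_in_G'] DL(4)] orth_line_orthogonal[OF DL(3) top[OF a_in_G'] DL(4)]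
  have "expand_dec z \<in> (\<Pi>\<^sub>E e\<in>edges G. topspace proj_space)"
    using top a_in_G' DL(3) ol(1) edges_G by (auto simp: DL(1) expand_dec_def)
  moreover have "admissible G (expand_dec z)"
    unfolding admissible_iff
  proof (intro conjI ballI)
    fix x assume x: "x \<in> verts G - {u, v}"
    have "pairwise (\<lambda>h k. orthogonal_lines (D (fst h)) (D (fst k))) (edge_ends G' x)"
      using DL(2) x by (auto simp: topspace_moduli admissible_def verts_G')
    then show "pairwise (\<lambda>h k. orthogonal_lines (expand_dec z (fst h)) (expand_dec z (fst k))) (edge_ends G x)"
      using admissible_at_collapsed[OF x, of "expand_dec z" D] by (simp add: DL(1) expand_dec_apply)
  qed (use ol DL(4) orthogonal_lines_sym in \<open>auto simp: DL(1) expand_dec_apply\<close>)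
  ultimately show ?thesis by (simp add: topspace_moduli)
qed

lemma continuous_map_collapse_dec: "continuous_map (moduli_space G) bundle_space collapse_dec"
  unfolding continuous_map_in_subtopology
proof
  have "continuous_map (moduli_space G) (product_topology (\<lambda>_. proj_space) (edges G')) (\<lambda>D. restrict D (edges G'))"
    unfolding continuous_map_componentwise
  proof (intro conjI ballI)
    fix e assume e: "e \<in> edges G'"
    then have "e \<in> edges G" using edges_G by blast
    then show "continuous_map (moduli_space G) proj_space (\<lambda>D. restrict D (edges G') e)"
      using continuous_map_moduli_edge e by simp
  qed auto
  moreover have "admissible G' (restrict D (edges G'))" if "D \<in> topspace (moduli_space G)" for D
    using collapse_dec_in[OF that] by (auto simp: collapse_dec_def topspace_moduli)
  ultimately have "continuous_map (moduli_space G) (moduli_space G') (\<lambda>D. restrict D (edges G'))"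
    unfolding moduli_space_def[of G'] continuous_map_in_subtopology by auto
  then show "continuous_map (moduli_space G) total_space collapse_dec"
    unfolding collapse_dec_def using bigon_facts by (intro continuous_map_pairedI continuous_map_moduli_edge) auto
  show "collapse_dec \<in> topspace (moduli_space G) \<rightarrow> orth_bundle" using collapse_dec_in by auto
qed

lemma continuous_map_expand_dec: "continuous_map bundle_space (moduli_space G) expand_dec"
proof -
  have edge: "continuous_map bundle_space proj_space (\<lambda>z. fst z e)" if "e \<in> edges G'" for e
    using continuous_map_compose[OF continuous_map_subtopology_fst continuous_map_moduli_edge[OF that]] by (simp add: o_def)
  have "continuous_map bundle_space (subtopology (prod_topology proj_space proj_space) {(L, M). orthogonal_lines L M}) (\<lambda>z. (snd z, fst z a))"
    unfolding continuous_map_in_subtopology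
  proof
    show "continuous_map bundle_space (prod_topology proj_space proj_space) (\<lambda>z. (snd z, fst z a))"
      using edge[OF a_in_G'] by (intro continuous_map_pairedI continuous_map_subtopology_snd)
  qed (auto simp: orth_bundle_def)
  from continuous_map_compose[OF this continuous_map_orth_line]
  have orth: "continuous_map bundle_space proj_space (\<lambda>z. orth_line (snd z) (fst z a))" by (simp add: o_def)
  have "continuous_map bundle_space (product_topology (\<lambda>_. proj_space) (edges G)) expand_dec"
    unfolding continuous_map_componentwise
  proof (intro conjI ballI)
    show "expand_dec ` topspace bundle_space \<subseteq> extensional (edges G)" by (auto simp: expand_dec_def)
    fix e assume e: "e \<in> edges G"
    consider "e = b" | "e = c" | "e = d" | "e \<in> edges G'" using e edges_G by blast
    then show "continuous_map bundle_space proj_space (\<lambda>z. expand_dec z e)"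
    proof cases
      case 1
      then show ?thesis using edge[OF a_in_G'] by (simp add: expand_dec_apply)
    next
      case 2
      then show ?thesis using continuous_map_subtopology_snd by (simp add: expand_dec_apply)
    next
      case 3
      then show ?thesis using orth by (simp add: expand_dec_apply)
    next
      case 4
      then show ?thesis using edge[OF 4] by (simp add: expand_dec_apply)
    qed
  qed
  then show ?thesis
    unfolding moduli_space_def[of G] continuous_map_in_subtopology
    using expand_dec_in by (auto simp: topspace_moduli)
qed

lemma homeomorphic_maps_collapse: "homeomorphic_maps (moduli_space G) bundle_space collapse_dec expand_dec"
  unfolding homeomorphic_maps_def
proof (intro conjI ballI continuous_map_collapse_dec continuous_map_expand_dec)
  fix D assume D: "D \<in> topspace (moduli_space G)"
  have ext: "D \<in> extensional (edges G)" using D by (auto simp: topspace_moduli PiE_def)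
  show "expand_dec (collapse_dec D) = D"
  proof
    fix e
    consider "e \<notin> edges G" | "e = b" | "e = c" | "e = d" | "e \<in> edges G'" using edges_G by blast
    then show "expand_dec (collapse_dec D) e = D e"
    proof cases
      case 1
      then show ?thesis using ext by (simp add: expand_dec_def extensional_def)
    qed (simp_all add: expand_dec_apply collapse_dec_def a_in_G' moduli_edges_eq[OF D])
  qed
next
  fix z assume "z \<in> topspace bundle_space"
  then obtain D L where DL: "z = (D, L)" "D \<in> extensional (edges G')"
    by (auto simp: topspace_moduli PiE_def)
  have "restrict (expand_dec (D, L)) (edges G') = D"
    using DL(2) by (auto simp: fun_eq_iff expand_dec_apply extensional_def)
  then show "collapse_dec (expand_dec z) = z" by (simp add: DL(1) collapse_dec_def expand_dec_apply)
qed

text \<open>The projection is \<open>fst \<circ> collapse_dec\<close>, which restricts a decoration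
  to the edges of \<open>G'\<close>.\<close>

lemma fibre_bundle_moduli:
  "\<exists>p. fibre_bundle (proj_space :: (complex ^ 2) set topology) (moduli_space G) (moduli_space G') p"
  using fibre_bundle_homeomorphic[OF fibre_bundle_orth_bundle homeomorphic_maps_collapse] by blast

lemma euler_characteristic_moduli:
  "euler_characteristic (moduli_space G) = 2 * euler_characteristic (moduli_space G')"
proof (rule euler_characteristic_double)
  fix p
  have "homology_group p (moduli_space G) \<cong> homology_group p bundle_space"
    using homeomorphic_maps_collapse homeomorphic_maps_imp_homeomorphic_space
    by (intro homeomorphic_space_imp_isomorphic_homology_groups) blast
  then have "abelian_rank (homology_group p (moduli_space G)) = abelian_rank (homology_group p bundle_space)"
    by (intro abelian_rank_iso) auto
  then show "abelian_rank (homology_group p (moduli_space G)) =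
      abelian_rank (homology_group p (moduli_space G')) + abelian_rank (homology_group (p - 2) (moduli_space G'))"
    by (simp add: abelian_rank_homology_orth_bundle)
qed

end

theorem lemma2:
  fixes G G' :: "('v, 'e) mgraph"
    and pt :: "'v \<Rightarrow> complex" and \<gamma> :: "'e \<Rightarrow> real \<Rightarrow> complex"
    and u v :: 'v and a b c d :: 'e
  assumes "finite_mgraph G"
    and "trivalent G"
    and "plane_drawing G pt \<gamma>"
    and "bigon G pt \<gamma> u v c d a b"
    and "G' = collapse_bigon G u v c d a b"
  shows "(\<exists>p. fibre_bundle (proj_space :: (complex ^ 2) set topology)
                (moduli_space G) (moduli_space G') p) \<and>
         euler_characteristic (moduli_space G) =
           euler_characteristic (proj_space :: (complex ^ 2) set topology) *
           euler_characteristic (moduli_space G') \<and>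
         euler_characteristic (proj_space :: (complex ^ 2) set topology) *
           euler_characteristic (moduli_space G') =
           2 * euler_characteristic (moduli_space G')"
proof -
  interpret B: bigon_collapse G pt \<gamma> u v a b c d using assms by unfold_locales
  have "G' = B.G'" using assms by (simp add: B.G'_def)
  then show ?thesis
    using B.fibre_bundle_moduli B.euler_characteristic_moduli by (simp add: euler_characteristic_proj_line)
qed

end
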